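(* Let $\varphi$ be a global formula of PDL. Then one can construct a CFM $\mathcal A=(C,0,(\mathcal A_p)_{p\in\mathcal P},F)$ such that for every MSC $M$: $M\in L(\mathcal A)$ if and only if $M\models\varphi$. Moreover, let $\ell$ be the number of basic global subformulas of $\varphi$ (subformulas of the form $\mathsf E\alpha$ or $\mathsf A\alpha$), let $m$ be the number of local subformulas of the form $\langle\pi\rangle\beta$ or $\langle\pi\rangle^{-1}\beta$ (subformulas of the local formulas $\alpha$ occurring in the basic global subformulas), and let $n\in\mathbb N$ be such that $s(\pi;\{\beta\})\le n$ for all such subformulas. Then the number of local states per process of $\mathcal A$ is in $2^{O(m(n+|\mathcal P|)+|\mathcal P|\ell+|\mathcal P|^2)}$ and the number of control messages $|C|$ is in $2^{O(\ell+mn+|\mathcal P|^2)}$.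
   Context: Fix a finite set $\mathcal P$ of processes, channels $\mathrm{Ch}=\{(p,q)\in\mathcal P^2: p\neq q\}$, local alphabets $\Sigma_p=\{p!q,\,p?q : q\in\mathcal P\setminus\{p\}\}$ and $\Sigma=\bigcup_p\Sigma_p$. For a $\Sigma$-labeled partial order $(V,\le,\lambda)$ let $P(v)=p$ iff $\lambda(v)\in\Sigma_p$, $V_p=P^{-1}(p)$; $(v,v')\in\mathrm{proc}$ iff $P(v)=P(v')$, $v<v'$ and no $u$ with $P(u)=P(v)$ satisfies $v<u<v'$; $(v,v')\in\mathrm{msg}$ iff for some $(p,q)\in\mathrm{Ch}$, $\lambda(v)=p!q$, $\lambda(v')=q?p$ and $|\{u\le v:\lambda(u)=p!q\}|=|\{u\le v':\lambda(u)=q?p\}|$. An MSC (finite or infinite) is such a structure with $\le=(\mathrm{proc}\cup\mathrm{msg})^*$, every set $\{u:u\le v\}$ finite, every $V_p$ linearly ordered, and $|\lambda^{-1}(p!q)|=|\lambda^{-1}(q?p)|$ for all $(p,q)\in\mathrm{Ch}$. A CFM is $\mathcal A=(C,k,(\mathcal A_p)_{p\in\mathcal P},F)$ with $C$ a finite set of control messages, $\mathcal A_p=(S_p,\to_p,\iota_p)$ where $S_p$ is a finite set of local states, $\iota_p\in S_p$, $\to_p\subseteq S_p\times(\Sigma_p\times\{0,1\}^k\times C)\times S_p$, and $F\subseteq\prod_p S_p$. For an MSC $M$ and $c:V\to\{0,1\}^k$, a run on $(M,c)$ is a pair $\rho:V\to\bigcup_pS_p$, $\mu:V\to C$ with $\mu(v)=\mu(\mathrm{msg}(v))$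 whenever $\mathrm{msg}(v)$ is defined, and $(\rho(\mathrm{proc}^{-1}(v)),\lambda(v),c(v),\mu(v),\rho(v))\in\to_{P(v)}$ if $v$ has a $\mathrm{proc}$-predecessor, $(\iota_{P(v)},\lambda(v),c(v),\mu(v),\rho(v))\in\to_{P(v)}$ otherwise. Let $\mathrm{cofinal}_\rho(p)=\{s\in S_p:\forall v\in V_p\,\exists v'\in V_p: v\le v',\rho(v')=s\}$; the run is accepting if some $(s_p)_p\in F$ has $s_p\in\mathrm{cofinal}_\rho(p)$ for all $p$. $L(\mathcal A)$ is the set of $(M,c)$ admitting an accepting run (for $k=0$, a set of MSCs). PDL: path expressions $\pi::=\mathrm{proc}\mid\mathrm{msg}\mid\{\alpha\}\mid\pi;\pi\mid\pi+\pi\mid\pi^*$ and local formulas $\alpha::=\mathrm{true}\mid\sigma\ (\sigma\in\Sigma)\mid\alpha\lor\alpha\mid\neg\alpha\mid\langle\pi\rangle\alpha\mid\langle\pi\rangle^{-1}\alpha$. Semantics at a node $v$ of an MSC $M$: $M,v\models\sigma$ iff $\lambda(v)=\sigma$; Boolean connectives as usual; $M,v\models\langle\mathrm{proc}\rangle\alpha$ (resp. $\langle\mathrm{msg}\rangle\alpha$) iff some $v'$ with $(v,v')\in\mathrm{proc}$ (resp. $\mathrm{msg}$) satisfies $\alpha$; $\langle\{\alpha\}\rangle\beta$ iff $v\models\alpha$ and $v\models\beta$; $\langle\pi_1;\pi_2\rangle\alpha$ iff $\langle\pi_1\rangle\langle\pi_2\rangle\alpha$; $\langle\pi_1+\pi_2\rangle\alpha$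 iff $\langle\pi_1\rangle\alpha\lor\langle\pi_2\rangle\alpha$; $\langle\pi^*\rangle\alpha$ iff $(\langle\pi\rangle)^j\alpha$ for some $j\ge0$. The backward modality $\langle\pi\rangle^{-1}$ is defined by the same clauses with $(v',v)\in\mathrm{proc}$, $(v',v)\in\mathrm{msg}$ in the base cases and $\langle\pi_1;\pi_2\rangle^{-1}\alpha$ iff $\langle\pi_1\rangle^{-1}\langle\pi_2\rangle^{-1}\alpha$. Global formulas: $\varphi::=\mathsf E\alpha\mid\mathsf A\alpha\mid\varphi\lor\varphi\mid\varphi\land\varphi$, with $M\models\mathsf E\alpha$ iff some node satisfies $\alpha$, $M\models\mathsf A\alpha$ iff all nodes satisfy $\alpha$. Size: $s(\{\alpha\})=s(\mathrm{proc})=s(\mathrm{msg})=1$, $s(\pi_1+\pi_2)=s(\pi_1;\pi_2)=s(\pi_1)+s(\pi_2)$, $s(\pi^* )=s(\pi)$. Subformulas: $\mathrm{sub}(\mathrm{proc})=\mathrm{sub}(\mathrm{msg})=\emptyset$, $\mathrm{sub}(\{\alpha\})=\mathrm{sub}(\alpha)$, $\mathrm{sub}(\pi_1;\pi_2)=\mathrm{sub}(\pi_1+\pi_2)=\mathrm{sub}(\pi_1)\cup\mathrm{sub}(\pi_2)$, $\mathrm{sub}(\pi^* )=\mathrm{sub}(\pi)$, $\mathrm{sub}(\sigma)=\{\sigma\}$, $\mathrm{sub}(\neg\alpha)=\{\neg\alpha\}\cup\mathrm{sub}(\alpha)$, $\mathrm{sub}(\alpha\lor\beta)=\{\alpha\lor\beta\}\cup\mathrm{sub}(\alpha)\cup\mathrm{sub}(\beta)$,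 $\mathrm{sub}(\langle\pi\rangle\alpha)=\{\langle\pi\rangle\alpha\}\cup\mathrm{sub}(\pi)\cup\mathrm{sub}(\alpha)$, and likewise for $\langle\pi\rangle^{-1}\alpha$.
   Formalization: For a process p without events, cofinal(p) is taken to be {ι_p} instead of all of S_p; with the literal definition the claim fails (e.g. for E true and the empty MSC). "One can construct" is rendered as existence with the stated size bounds, for MSCs with nodes in a given type (ℕ suffices). *)

theory Defs
  imports Main "HOL-Library.FuncSet" "HOL-Library.Equipollence"
begin

section \<open>Message sequence charts\<close>

text \<open>\<open>Send p q\<close> is \<open>p!q\<close> (\<open>p\<close> sends to \<open>q\<close>), and \<open>Recv p q\<close> is \<open>p?q\<close>
  (\<open>p\<close> receives from \<open>q\<close>).\<close>

datatype 'p act = Send 'p 'p | Recv 'p 'p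

primrec subj :: "'p act \<Rightarrow> 'p" where
  "subj (Send p q) = p"
| "subj (Recv p q) = p"

definition Ch :: "'p set \<Rightarrow> ('p \<times> 'p) set" where
  "Ch P = {(p, q). p \<in> P \<and> q \<in> P \<and> p \<noteq> q}"

definition Sigma_loc :: "'p set \<Rightarrow> 'p \<Rightarrow> 'p act set" where
  "Sigma_loc P p = Send p ` (P - {p}) \<union> Recv p ` (P - {p})"

definition Sigma_all :: "'p set \<Rightarrow> 'p act set" where
  "Sigma_all P = (\<Union>p\<in>P. Sigma_loc P p)"

record ('v, 'p) msc =
  nodes :: "'v set"
  le :: "'v rel"
  lab :: "'v \<Rightarrow> 'p act"

text \<open>For labels in \<open>Sigma_all P\<close>, \<open>lab M v\<close> lies in \<open>Sigma_loc P p\<close> iff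
  \<open>subj (lab M v) = p\<close>; so \<open>subj (lab M v)\<close> is the process of \<open>v\<close>.\<close>

definition nodes_of :: "('v, 'p) msc \<Rightarrow> 'p \<Rightarrow> 'v set" where
  "nodes_of M p = {v \<in> nodes M. subj (lab M v) = p}"

definition lt :: "('v, 'p) msc \<Rightarrow> 'v rel" where
  "lt M = {(u, v) \<in> le M. u \<noteq> v}"

definition proc_rel :: "('v, 'p) msc \<Rightarrow> 'v rel" where
  "proc_rel M = {(v, v'). v \<in> nodes M \<and> v' \<in> nodes M \<and>
     subj (lab M v) = subj (lab M v') \<and> (v, v') \<in> lt M \<and>
     \<not> (\<exists>u \<in> nodes M. subj (lab M u) = subj (lab M v) \<and> (v, u) \<in> lt M \<and> (u, v') \<in> lt M)}"

text \<open>In an MSC the two sets counted below are finite, since all sets \<open>{u. (u, v) \<in> le M}\<close> are.\<close>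

definition msg_rel :: "'p set \<Rightarrow> ('v, 'p) msc \<Rightarrow> 'v rel" where
  "msg_rel P M = {(v, v'). v \<in> nodes M \<and> v' \<in> nodes M \<and>
     (\<exists>(p, q) \<in> Ch P. lab M v = Send p q \<and> lab M v' = Recv q p \<and>
        card {u \<in> nodes M. (u, v) \<in> le M \<and> lab M u = Send p q} =
        card {u \<in> nodes M. (u, v') \<in> le M \<and> lab M u = Recv q p})}"

text \<open>The sets of all sends and of all receives on a channel may be infinite, so their
  cardinalities are compared by \<open>\<approx>\<close> and not by \<open>card\<close>.\<close>

definition is_msc :: "'p set \<Rightarrow> ('v, 'p) msc \<Rightarrow> bool" where
  "is_msc P M \<longleftrightarrow>
     partial_order_on (nodes M) (le M) \<and>
     lab M ` nodes M \<subseteq> Sigma_all P \<and>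
     le M = Restr ((proc_rel M \<union> msg_rel P M)\<^sup>*) (nodes M) \<and>
     (\<forall>v \<in> nodes M. finite {u \<in> nodes M. (u, v) \<in> le M}) \<and>
     (\<forall>p \<in> P. total_on (nodes_of M p) (le M)) \<and>
     (\<forall>(p, q) \<in> Ch P.
        {v \<in> nodes M. lab M v = Send p q} \<approx> {v \<in> nodes M. lab M v = Recv q p})"


section \<open>Communicating finite-state machines\<close>

text \<open>Elements of \<open>{0,1}\<^sup>k\<close> are Boolean lists of length \<open>k\<close>.\<close>

definition bits :: "nat \<Rightarrow> bool list set" where
  "bits k = {bs. length bs = k}"

record ('p, 's, 'c) cfm =
  ctrl :: "'c set"
  dim :: nat
  states :: "'p \<Rightarrow> 's set"
  trans_rel :: "'p \<Rightarrow> ('s \<times> ('p act \<times> bool list \<times> 'c) \<times> 's) set"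
  init :: "'p \<Rightarrow> 's"
  final :: "('p \<Rightarrow> 's) set"

definition is_cfm :: "'p set \<Rightarrow> ('p, 's, 'c) cfm \<Rightarrow> bool" where
  "is_cfm P A \<longleftrightarrow>
     finite (ctrl A) \<and>
     (\<forall>p \<in> P. finite (states A p) \<and> init A p \<in> states A p \<and>
        trans_rel A p \<subseteq>
          states A p \<times> (Sigma_loc P p \<times> bits (dim A) \<times> ctrl A) \<times> states A p) \<and>
     final A \<subseteq> PiE P (states A)"

definition is_run ::
  "'p set \<Rightarrow> ('p, 's, 'c) cfm \<Rightarrow> ('v, 'p) msc \<Rightarrow> ('v \<Rightarrow> bool list) \<Rightarrow> ('v \<Rightarrow> 's) \<Rightarrow> ('v \<Rightarrow> 'c) \<Rightarrow> bool"
where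
  "is_run P A M c \<rho> \<mu> \<longleftrightarrow>
     \<rho> ` nodes M \<subseteq> (\<Union>p\<in>P. states A p) \<and>
     \<mu> ` nodes M \<subseteq> ctrl A \<and>
     (\<forall>(v, v') \<in> msg_rel P M. \<mu> v = \<mu> v') \<and>
     (\<forall>(u, v) \<in> proc_rel M.
        (\<rho> u, (lab M v, c v, \<mu> v), \<rho> v) \<in> trans_rel A (subj (lab M v))) \<and>
     (\<forall>v \<in> nodes M. v \<notin> Range (proc_rel M) \<longrightarrow>
        (init A (subj (lab M v)), (lab M v, c v, \<mu> v), \<rho> v) \<in> trans_rel A (subj (lab M v)))"

text \<open>A process without any event stays in its initial state forever, so exactly that state is
  cofinal. The formula of the second branch alone would make every state of such a
  process cofinal; then acceptance could not depend on whether a process is active, and not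
  even \<open>GE LTrue\<close> (some node exists) would be recognisable.\<close>

definition cofinal :: "('p, 's, 'c) cfm \<Rightarrow> ('v, 'p) msc \<Rightarrow> ('v \<Rightarrow> 's) \<Rightarrow> 'p \<Rightarrow> 's set" where
  "cofinal A M \<rho> p =
     (if nodes_of M p = {} then {init A p}
      else {s \<in> states A p. \<forall>v \<in> nodes_of M p. \<exists>v' \<in> nodes_of M p. (v, v') \<in> le M \<and> \<rho> v' = s})"

definition accepting ::
  "'p set \<Rightarrow> ('p, 's, 'c) cfm \<Rightarrow> ('v, 'p) msc \<Rightarrow> ('v \<Rightarrow> 's) \<Rightarrow> bool"
where
  "accepting P A M \<rho> \<longleftrightarrow> (\<exists>s \<in> final A. \<forall>p \<in> P. s p \<in> cofinal A M \<rho> p)"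

definition lang ::
  "'p set \<Rightarrow> ('p, 's, 'c) cfm \<Rightarrow> (('v, 'p) msc \<times> ('v \<Rightarrow> bool list)) set"
where
  "lang P A = {(M, c). is_msc P M \<and> c ` nodes M \<subseteq> bits (dim A) \<and>
     (\<exists>\<rho> \<mu>. is_run P A M c \<rho> \<mu> \<and> accepting P A M \<rho>)}"

text \<open>For \<open>dim A = 0\<close> the only labelling of nodes is the constant empty bit vector, and \<open>lang\<close>
  is regarded as a set of MSCs.\<close>

definition lang0 :: "'p set \<Rightarrow> ('p, 's, 'c) cfm \<Rightarrow> ('v, 'p) msc set" where
  "lang0 P A = {M. (M, \<lambda>_. []) \<in> lang P A}"


section \<open>Propositional dynamic logic\<close>

text \<open>The set functions \<open>acts_pexp\<close>, \<open>acts_lform\<close>, \<open>acts_gform\<close> collect the atoms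
  occurring in an expression.\<close>

datatype (acts_pexp: 'a) pexp =
    Proc
  | Msg
  | Test "'a lform"
  | Seq "'a pexp" "'a pexp"
  | Choice "'a pexp" "'a pexp"
  | Star "'a pexp"
and (acts_lform: 'a) lform =
    LTrue
  | Act 'a
  | LOr "'a lform" "'a lform"
  | LNot "'a lform"
  | Dia "'a pexp" "'a lform"
  | BDia "'a pexp" "'a lform"

datatype (acts_gform: 'a) gform =
    GE "'a lform"
  | GA "'a lform"
  | GOr "'a gform" "'a gform"
  | GAnd "'a gform" "'a gform"

text \<open>\<open>lsem P M \<alpha>\<close> is the set of nodes satisfying \<open>\<alpha>\<close>; \<open>fwd P M \<pi>\<close> and \<open>bwd P M \<pi>\<close> map the
  set of nodes satisfying \<open>\<alpha>\<close> to the set of those satisfying \<open>Dia \<pi> \<alpha>\<close> and \<open>BDia \<pi> \<alpha>\<close>.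
  In \<open>bwd\<close> the order of a sequential composition is not reversed.\<close>

fun fwd :: "'p set \<Rightarrow> ('v, 'p) msc \<Rightarrow> 'p act pexp \<Rightarrow> 'v set \<Rightarrow> 'v set"
and bwd :: "'p set \<Rightarrow> ('v, 'p) msc \<Rightarrow> 'p act pexp \<Rightarrow> 'v set \<Rightarrow> 'v set"
and lsem :: "'p set \<Rightarrow> ('v, 'p) msc \<Rightarrow> 'p act lform \<Rightarrow> 'v set"
where
  "fwd P M Proc = (\<lambda>X. {v \<in> nodes M. \<exists>v'. (v, v') \<in> proc_rel M \<and> v' \<in> X})"
| "fwd P M Msg = (\<lambda>X. {v \<in> nodes M. \<exists>v'. (v, v') \<in> msg_rel P M \<and> v' \<in> X})"
| "fwd P M (Test \<alpha>) = (\<lambda>X. lsem P M \<alpha> \<inter> X)"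
| "fwd P M (Seq \<pi>1 \<pi>2) = (\<lambda>X. fwd P M \<pi>1 (fwd P M \<pi>2 X))"
| "fwd P M (Choice \<pi>1 \<pi>2) = (\<lambda>X. fwd P M \<pi>1 X \<union> fwd P M \<pi>2 X)"
| "fwd P M (Star \<pi>) = (\<lambda>X. \<Union>j. (fwd P M \<pi> ^^ j) X)"
| "bwd P M Proc = (\<lambda>X. {v \<in> nodes M. \<exists>v'. (v', v) \<in> proc_rel M \<and> v' \<in> X})"
| "bwd P M Msg = (\<lambda>X. {v \<in> nodes M. \<exists>v'. (v', v) \<in> msg_rel P M \<and> v' \<in> X})"
| "bwd P M (Test \<alpha>) = (\<lambda>X. lsem P M \<alpha> \<inter> X)"
| "bwd P M (Seq \<pi>1 \<pi>2) = (\<lambda>X. bwd P M \<pi>1 (bwd P M \<pi>2 X))"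
| "bwd P M (Choice \<pi>1 \<pi>2) = (\<lambda>X. bwd P M \<pi>1 X \<union> bwd P M \<pi>2 X)"
| "bwd P M (Star \<pi>) = (\<lambda>X. \<Union>j. (bwd P M \<pi> ^^ j) X)"
| "lsem P M LTrue = nodes M"
| "lsem P M (Act \<sigma>) = {v \<in> nodes M. lab M v = \<sigma>}"
| "lsem P M (LOr \<alpha> \<beta>) = lsem P M \<alpha> \<union> lsem P M \<beta>"
| "lsem P M (LNot \<alpha>) = nodes M - lsem P M \<alpha>"
| "lsem P M (Dia \<pi> \<alpha>) = fwd P M \<pi> (lsem P M \<alpha>)"
| "lsem P M (BDia \<pi> \<alpha>) = bwd P M \<pi> (lsem P M \<alpha>)"

primrec gsat :: "'p set \<Rightarrow> ('v, 'p) msc \<Rightarrow> 'p act gform \<Rightarrow> bool" where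
  "gsat P M (GE \<alpha>) \<longleftrightarrow> (\<exists>v \<in> nodes M. v \<in> lsem P M \<alpha>)"
| "gsat P M (GA \<alpha>) \<longleftrightarrow> (\<forall>v \<in> nodes M. v \<in> lsem P M \<alpha>)"
| "gsat P M (GOr \<phi> \<psi>) \<longleftrightarrow> gsat P M \<phi> \<or> gsat P M \<psi>"
| "gsat P M (GAnd \<phi> \<psi>) \<longleftrightarrow> gsat P M \<phi> \<and> gsat P M \<psi>"

fun psize :: "'a pexp \<Rightarrow> nat" where
  "psize Proc = 1"
| "psize Msg = 1"
| "psize (Test \<alpha>) = 1"
| "psize (Seq \<pi>1 \<pi>2) = psize \<pi>1 + psize \<pi>2"
| "psize (Choice \<pi>1 \<pi>2) = psize \<pi>1 + psize \<pi>2"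
| "psize (Star \<pi>) = psize \<pi>"

fun psub :: "'a pexp \<Rightarrow> 'a lform set"
and lsub :: "'a lform \<Rightarrow> 'a lform set"
where
  "psub Proc = {}"
| "psub Msg = {}"
| "psub (Test \<alpha>) = lsub \<alpha>"
| "psub (Seq \<pi>1 \<pi>2) = psub \<pi>1 \<union> psub \<pi>2"
| "psub (Choice \<pi>1 \<pi>2) = psub \<pi>1 \<union> psub \<pi>2"
| "psub (Star \<pi>) = psub \<pi>"
| "lsub LTrue = {LTrue}"
| "lsub (Act \<sigma>) = {Act \<sigma>}"
| "lsub (LOr \<alpha> \<beta>) = {LOr \<alpha> \<beta>} \<union> lsub \<alpha> \<union> lsub \<beta>"
| "lsub (LNot \<alpha>) = {LNot \<alpha>} \<union> lsub \<alpha>"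
| "lsub (Dia \<pi> \<alpha>) = {Dia \<pi> \<alpha>} \<union> psub \<pi> \<union> lsub \<alpha>"
| "lsub (BDia \<pi> \<alpha>) = {BDia \<pi> \<alpha>} \<union> psub \<pi> \<union> lsub \<alpha>"

primrec basic_gsub :: "'a gform \<Rightarrow> 'a gform set" where
  "basic_gsub (GE \<alpha>) = {GE \<alpha>}"
| "basic_gsub (GA \<alpha>) = {GA \<alpha>}"
| "basic_gsub (GOr \<phi> \<psi>) = basic_gsub \<phi> \<union> basic_gsub \<psi>"
| "basic_gsub (GAnd \<phi> \<psi>) = basic_gsub \<phi> \<union> basic_gsub \<psi>"

definition local_subs :: "'a gform \<Rightarrow> 'a lform set" where
  "local_subs \<phi> = (\<Union>\<alpha> \<in> {\<alpha>. GE \<alpha> \<in> basic_gsub \<phi> \<or> GA \<alpha> \<in> basic_gsub \<phi>}. lsub \<alpha>)"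

definition modal_subs :: "'a gform \<Rightarrow> 'a lform set" where
  "modal_subs \<phi> = {\<gamma> \<in> local_subs \<phi>. \<exists>\<pi> \<beta>. \<gamma> = Dia \<pi> \<beta> \<or> \<gamma> = BDia \<pi> \<beta>}"

definition size_bound :: "'a gform \<Rightarrow> nat \<Rightarrow> bool" where
  "size_bound \<phi> n \<longleftrightarrow>
     (\<forall>\<pi> \<beta>. Dia \<pi> \<beta> \<in> modal_subs \<phi> \<or> BDia \<pi> \<beta> \<in> modal_subs \<phi> \<longrightarrow>
        psize (Seq \<pi> (Test \<beta>)) \<le> n)"

end

theory Submission
  imports Defs
begin

text \<open>
  The machine guesses at every event which modal formulas \<open>Dia \<pi> k\<close>, \<open>BDia \<pi> k\<close> with \<open>\<pi>\<close> one of
  \<open>Proc\<close>, \<open>Msg\<close> hold there, where \<open>k\<close> ranges over the continuations (partial derivatives) of the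
  modal subformulas of \<open>\<phi>\<close>; there are at most \<open>m * n\<close> of them. These guesses are compared along
  the process and message edges. As pasts are finite, local consistency already forces backward
  formulas to be guessed correctly, and it forces true forward formulas to be guessed. It remains to
  exclude that a forward formula is claimed at infinitely many events and never fulfilled.

  To this end the machine splits the events into epochs that increase by at most one along edges and
  requires that each claim is fulfilled by the end of the following epoch. Epochs are only known
  modulo a constant, but on a channel used infinitely often every epoch contains a send and a
  receive, and all other channels are used in epoch zero only; since channels are FIFO, this suffices
  to keep the true epochs of sender and receiver synchronised. Acceptance enforces that all
  processes using such a channel pass infinitely many epochs, hence every epoch is finite.
  Conversely, in any MSC suitable epochs arise from an increasing sequence of finite
  downward closed sets of events.
\<close>

section \<open>Evaluating path expressions from local information\<close>

text \<open>The obstacle is that acceptance inspects every process separately, while a forward claim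
  may wander between processes for ever, so that no process on its own notices that the claim is
  never met. Epochs act as breakpoints common to all processes: nothing due may cross into a new
  epoch, and whatever is still claimed at the crossing becomes due in the new one. A claim may be
  raised just before an epoch ends, hence the slack of one epoch. With finite epochs, a claim
  deferred for ever would have to leave its last admissible epoch.

  Local comparison is so strong because \<open>proc_rel\<close> and \<open>msg_rel\<close> are
  partial functions in both directions: an atom is decided at a single neighbour, so the guesses can
  be required to satisfy an equivalence and not just an implication. For the converse, a true
  forward claim is witnessed by a finite path, and the next finite set is chosen large enough to
  contain such a path.\<close>

fun tests :: "'a pexp \<Rightarrow> 'a lform set" where
  "tests Proc = {}"
| "tests Msg = {}"
| "tests (Test \<alpha>) = {\<alpha>}"
| "tests (Seq \<pi>1 \<pi>2) = tests \<pi>1 \<union> tests \<pi>2"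
| "tests (Choice \<pi>1 \<pi>2) = tests \<pi>1 \<union> tests \<pi>2"
| "tests (Star \<pi>) = tests \<pi>"

text \<open>Passing to the converse relations turns \<open>fwd\<close> into \<open>bwd\<close>, as
  the order of a composition is not reversed there. With relations and test semantics as parameters,
  the same recursion also describes paths confined to a finite set of nodes.\<close>

fun preim :: "'v set \<Rightarrow> 'v rel \<Rightarrow> 'v rel \<Rightarrow> ('a lform \<Rightarrow> 'v set) \<Rightarrow> 'a pexp \<Rightarrow> 'v set \<Rightarrow> 'v set" where
  "preim N R S s Proc X = {v \<in> N. \<exists>w. (v, w) \<in> R \<and> w \<in> X}"
| "preim N R S s Msg X = {v \<in> N. \<exists>w. (v, w) \<in> S \<and> w \<in> X}"
| "preim N R S s (Test \<alpha>) X = s \<alpha> \<inter> X"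
| "preim N R S s (Seq \<pi>1 \<pi>2) X = preim N R S s \<pi>1 (preim N R S s \<pi>2 X)"
| "preim N R S s (Choice \<pi>1 \<pi>2) X = preim N R S s \<pi>1 X \<union> preim N R S s \<pi>2 X"
| "preim N R S s (Star \<pi>) X = (\<Union>j. (preim N R S s \<pi> ^^ j) X)"

lemma fwd_preim: "fwd P M \<pi> = preim (nodes M) (proc_rel M) (msg_rel P M) (lsem P M) \<pi>"
  by (induct \<pi> rule: psize.induct) (auto intro!: ext)

lemma bwd_preim: "bwd P M \<pi> = preim (nodes M) ((proc_rel M)\<inverse>) ((msg_rel P M)\<inverse>) (lsem P M) \<pi>"
  by (induct \<pi> rule: psize.induct) (auto intro!: ext)

lemma preim_mono:
  assumes "X \<subseteq> Y" "R \<subseteq> R'" "S \<subseteq> S'"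
  shows "preim N R S s \<pi> X \<subseteq> preim N R' S' s \<pi> Y"
  using assms(1)
proof (induct \<pi> arbitrary: X Y rule: psize.induct)
  case (6 \<pi>)
  have "(preim N R S s \<pi> ^^ j) X \<subseteq> (preim N R' S' s \<pi> ^^ j) Y" for j
    by (induct j) (use 6 in auto)
  then show ?case by auto
next
  case (4 \<pi>1 \<pi>2)
  then show ?case by simp
next
  case (5 \<pi>1 \<pi>2)
  then show ?case by (simp add: le_supI1 le_supI2)
qed (use assms in auto)

text \<open>A path from \<open>v\<close> ends in a single node of \<open>X\<close>, so the operator
  commutes with arbitrary unions.\<close>

lemma preim_additive: "v \<in> preim N R S s \<pi> X \<Longrightarrow> \<exists>x\<in>X. v \<in> preim N R S s \<pi> {x}"
proof (induct \<pi> arbitrary: v X rule: psize.induct)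
  case (4 \<pi>1 \<pi>2)
  from 4(3) have "v \<in> preim N R S s \<pi>1 (preim N R S s \<pi>2 X)" by simp
  from 4(1)[OF this] obtain y where y: "y \<in> preim N R S s \<pi>2 X" "v \<in> preim N R S s \<pi>1 {y}" by blast
  from 4(2)[OF y(1)] obtain x where x: "x \<in> X" "y \<in> preim N R S s \<pi>2 {x}" by blast
  have "{y} \<subseteq> preim N R S s \<pi>2 {x}" using x by auto
  from preim_mono[OF this order_refl order_refl, of N R S s \<pi>1] y x show ?case by auto
next
  case (5 \<pi>1 \<pi>2)
  from 5(3) have "v \<in> preim N R S s \<pi>1 X \<or> v \<in> preim N R S s \<pi>2 X" by simp
  then show ?case using 5(1,2)[of v X] by auto
next
  case (6 \<pi>)
  have "v \<in> (preim N R S s \<pi> ^^ j) X \<Longrightarrow> \<exists>x\<in>X. v \<in> (preim N R S s \<pi> ^^ j) {x}" for j v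
  proof (induct j arbitrary: v)
    case (Suc j)
    then have "v \<in> preim N R S s \<pi> ((preim N R S s \<pi> ^^ j) X)" by simp
    from 6(1)[OF this] obtain y where
      y: "y \<in> (preim N R S s \<pi> ^^ j) X" "v \<in> preim N R S s \<pi> {y}" by blast
    from Suc(1)[OF y(1)] obtain x where x: "x \<in> X" "y \<in> (preim N R S s \<pi> ^^ j) {x}" by blast
    have "{y} \<subseteq> (preim N R S s \<pi> ^^ j) {x}" using x by auto
    from preim_mono[OF this order_refl order_refl, of N R S s \<pi>] y x show ?case by auto
  qed auto
  then show ?case using 6(2) by fastforce
qed auto

text \<open>Additivity selects one node of the union and thereby a single iterate; monotonicity
  alone would not suffice for infinitely many iterates.\<close>

lemma preim_Star_unfold:
  "preim N R S s \<pi> (preim N R S s (Star \<pi>) X) \<subseteq> preim N R S s (Star \<pi>) X"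
proof
  fix v assume "v \<in> preim N R S s \<pi> (preim N R S s (Star \<pi>) X)"
  from preim_additive[OF this] obtain x j where
    x: "x \<in> (preim N R S s \<pi> ^^ j) X" "v \<in> preim N R S s \<pi> {x}" by auto
  have "{x} \<subseteq> (preim N R S s \<pi> ^^ j) X" using x by auto
  from preim_mono[OF this order_refl order_refl, of N R S s \<pi>] x have "v \<in> (preim N R S s \<pi> ^^ Suc j) X" by auto
  then show "v \<in> preim N R S s (Star \<pi>) X"
    unfolding preim.simps by (rule UN_I[OF UNIV_I])
qed

text \<open>The truth of a formula at a node with label \<open>\<sigma>\<close> is computed from the set of those formulas
  \<open>Dia Proc k\<close>, \<open>Dia Msg k\<close>, \<open>BDia Proc k\<close>, \<open>BDia Msg k\<close> that hold there. \<open>x\<close> is the truth of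
  the continuation \<open>k\<close> at the same node. In the case of \<open>Star\<close>, the least fixed point of the monotone
  Boolean map \<open>y \<mapsto> x \<or> f y\<close> is \<open>x \<or> f False\<close>. \<open>C \<subseteq> B\<close> restricts the formulas by which an outermost
  chain of diamonds may be continued at other nodes.\<close>

fun dia_eval :: "'a pexp \<Rightarrow> 'a \<Rightarrow> 'a lform set \<Rightarrow> ('a pexp \<Rightarrow> 'a lform \<Rightarrow> 'a lform) \<Rightarrow>
    'a lform set \<Rightarrow> 'a lform \<Rightarrow> bool \<Rightarrow> bool"
and eval :: "'a lform \<Rightarrow> 'a \<Rightarrow> 'a lform set \<Rightarrow> 'a lform set \<Rightarrow> bool" where
  "dia_eval Proc \<sigma> B mk C k x = (mk Proc k \<in> C)"
| "dia_eval Msg \<sigma> B mk C k x = (mk Msg k \<in> C)"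
| "dia_eval (Test \<alpha>) \<sigma> B mk C k x = (eval \<alpha> \<sigma> B B \<and> x)"
| "dia_eval (Seq \<pi>1 \<pi>2) \<sigma> B mk C k x = dia_eval \<pi>1 \<sigma> B mk C (mk \<pi>2 k) (dia_eval \<pi>2 \<sigma> B mk C k x)"
| "dia_eval (Choice \<pi>1 \<pi>2) \<sigma> B mk C k x = (dia_eval \<pi>1 \<sigma> B mk C k x \<or> dia_eval \<pi>2 \<sigma> B mk C k x)"
| "dia_eval (Star \<pi>) \<sigma> B mk C k x = (x \<or> dia_eval \<pi> \<sigma> B mk C (mk (Star \<pi>) k) False)"
| "eval LTrue \<sigma> B C = True"
| "eval (Act \<tau>) \<sigma> B C = (\<sigma> = \<tau>)"
| "eval (LOr \<alpha> \<beta>) \<sigma> B C = (eval \<alpha> \<sigma> B B \<or> eval \<beta> \<sigma> B B)"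
| "eval (LNot \<alpha>) \<sigma> B C = (\<not> eval \<alpha> \<sigma> B B)"
| "eval (Dia \<pi> \<alpha>) \<sigma> B C = dia_eval \<pi> \<sigma> B Dia C \<alpha> (eval \<alpha> \<sigma> B C)"
| "eval (BDia \<pi> \<alpha>) \<sigma> B C = dia_eval \<pi> \<sigma> B BDia B \<alpha> (eval \<alpha> \<sigma> B B)"

text \<open>These are partial derivatives in the manner of Antimirov: each occurrence of
  \<open>Proc\<close> or \<open>Msg\<close> contributes one atom, whose continuation is what remains
  of the path after it.\<close>

fun path_atoms :: "('a pexp \<Rightarrow> 'a lform \<Rightarrow> 'a lform) \<Rightarrow> 'a pexp \<Rightarrow> 'a lform \<Rightarrow> 'a lform set" where
  "path_atoms mk Proc k = {mk Proc k}"
| "path_atoms mk Msg k = {mk Msg k}"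
| "path_atoms mk (Test \<alpha>) k = {}"
| "path_atoms mk (Seq \<pi>1 \<pi>2) k = path_atoms mk \<pi>1 (mk \<pi>2 k) \<union> path_atoms mk \<pi>2 k"
| "path_atoms mk (Choice \<pi>1 \<pi>2) k = path_atoms mk \<pi>1 k \<union> path_atoms mk \<pi>2 k"
| "path_atoms mk (Star \<pi>) k = path_atoms mk \<pi> (mk (Star \<pi>) k)"

lemma dia_eval_mono:
  assumes "C \<subseteq> C'" "x \<longrightarrow> y" "dia_eval \<pi> \<sigma> B mk C k x"
  shows "dia_eval \<pi> \<sigma> B mk C' k y"
  using assms(2,3)
proof (induct \<pi> arbitrary: k x y rule: psize.induct)
  case (4 \<pi>1 \<pi>2)
  then show ?case by (metis dia_eval.simps(4))
next
  case (5 \<pi>1 \<pi>2)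
  then show ?case by (metis dia_eval.simps(5))
next
  case (6 \<pi>)
  then show ?case by (metis dia_eval.simps(6))
qed (use assms(1) in auto)

lemma eval_mono:
  assumes "C \<subseteq> C'"
  shows "eval \<alpha> \<sigma> B C \<Longrightarrow> eval \<alpha> \<sigma> B C'"
  by (induct \<alpha> rule: lform.induct[of "\<lambda>_. True"])
     (auto intro: dia_eval_mono[OF assms] dia_eval_mono[OF order_refl])

text \<open>\<open>H\<close> is a prediction of the truth of the continuations; only its closure under
  \<open>dia_eval\<close> matters, so that it may be instantiated by guessed and by actual truth values.\<close>

lemma dia_eval_complete:
  assumes Proc: "\<And>v w k. mk Proc k \<in> A \<Longrightarrow> v \<in> N \<Longrightarrow> (v, w) \<in> R \<Longrightarrow> H w k \<Longrightarrow> mk Proc k \<in> C v"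
    and Msg: "\<And>v w k. mk Msg k \<in> A \<Longrightarrow> v \<in> N \<Longrightarrow> (v, w) \<in> S \<Longrightarrow> H w k \<Longrightarrow> mk Msg k \<in> C v"
    and H: "\<And>v \<pi> k. tests \<pi> \<subseteq> T \<Longrightarrow> v \<in> N \<Longrightarrow>
      dia_eval \<pi> (l v) (B v) mk (C v) k (H v k) \<Longrightarrow> H v (mk \<pi> k)"
    and T: "\<And>v \<alpha>. \<alpha> \<in> T \<Longrightarrow> v \<in> s \<alpha> \<Longrightarrow> eval \<alpha> (l v) (B v) (B v)"
  shows "path_atoms mk \<pi> k \<subseteq> A \<Longrightarrow> tests \<pi> \<subseteq> T \<Longrightarrow> Y \<subseteq> N \<Longrightarrow> (\<And>w. w \<in> Y \<Longrightarrow> H w k) \<Longrightarrow>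
    v \<in> preim N R S s \<pi> Y \<Longrightarrow> dia_eval \<pi> (l v) (B v) mk (C v) k (v \<in> Y) \<and> v \<in> N"
proof (induct \<pi> arbitrary: k Y v rule: psize.induct)
  case (4 \<pi>1 \<pi>2)
  let ?Z = "preim N R S s \<pi>2 Y"
  have Z: "dia_eval \<pi>2 (l w) (B w) mk (C w) k (w \<in> Y) \<and> w \<in> N" if "w \<in> ?Z" for w
    using 4(2)[of k Y w] 4(3-6) that by auto
  have "H w (mk \<pi>2 k)" if "w \<in> ?Z" for w
    by (rule H) (use Z[OF that] 4(4,6) dia_eval_mono[OF order_refl, of "w \<in> Y" "H w k"] in auto)
  then have "dia_eval \<pi>1 (l v) (B v) mk (C v) (mk \<pi>2 k) (v \<in> ?Z) \<and> v \<in> N"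
    using 4(1)[of "mk \<pi>2 k" ?Z v] 4(3-7) Z by auto
  moreover have "v \<in> ?Z \<longrightarrow> dia_eval \<pi>2 (l v) (B v) mk (C v) k (v \<in> Y)" using Z by blast
  ultimately show ?case using dia_eval_mono[OF order_refl] by (metis dia_eval.simps(4))
next
  case (5 \<pi>1 \<pi>2)
  then have "v \<in> preim N R S s \<pi>1 Y \<or> v \<in> preim N R S s \<pi>2 Y" by simp
  then show ?case using 5(1,2)[of k Y v] 5(3-6) by auto
next
  case (6 \<pi>)
  let ?T = "preim N R S s \<pi>" and ?k = "mk (Star \<pi>) k"
  \<comment> \<open>A node of an iterate either lies in the previous iterate already or is reached
    with the loop variable \<open>False\<close>, which is how \<open>dia_eval\<close> treats
    \<open>Star\<close>.\<close>
  have *: "(\<forall>w \<in> (?T ^^ j) Y. w \<in> N \<and> H w ?k \<and>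
      (w \<in> Y \<or> dia_eval \<pi> (l w) (B w) mk (C w) ?k False))" for j
  proof (induct j)
    case 0
    have "H w ?k" if "w \<in> Y" for w by (rule H) (use that 6(3-5) in auto)
    then show ?case using 6(4) by auto
  next
    case (Suc j)
    show ?case
    proof
      fix w assume "w \<in> (?T ^^ Suc j) Y"
      then have "w \<in> ?T ((?T ^^ j) Y)" by simp
      with 6(1)[of ?k "(?T ^^ j) Y" w] 6(2,3) Suc
      have w: "dia_eval \<pi> (l w) (B w) mk (C w) ?k (w \<in> (?T ^^ j) Y) \<and> w \<in> N" by auto
      show "w \<in> N \<and> H w ?k \<and> (w \<in> Y \<or> dia_eval \<pi> (l w) (B w) mk (C w) ?k False)"
      proof (cases "w \<in> (?T ^^ j) Y")
        case True
        then show ?thesis using Suc by blast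
      next
        case False
        then have "dia_eval (Star \<pi>) (l w) (B w) mk (C w) k (H w k)" using w by simp
        with H[of "Star \<pi>" w k] 6(3) w False show ?thesis by simp
      qed
    qed
  qed
  from 6(6) obtain j where "v \<in> (?T ^^ j) Y" by auto
  then show ?case using *[of j] by auto
qed (use Proc Msg T in auto)

text \<open>\<open>good\<close> singles out the continuations for which claimed atoms may be
  trusted. It has to be stable under prefixing paths with reliable tests, because \<open>Seq\<close>
  and \<open>Star\<close> move such paths into the continuation.\<close>

lemma dia_eval_sound:
  assumes Proc: "\<And>k. mk Proc k \<in> C \<Longrightarrow> good k \<Longrightarrow> \<exists>w. (v, w) \<in> R \<and> w \<in> h k"
    and Msg: "\<And>k. mk Msg k \<in> C \<Longrightarrow> good k \<Longrightarrow> \<exists>w. (v, w) \<in> S \<and> w \<in> h k"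
    and h: "\<And>\<pi> k. h (mk \<pi> k) = preim N R S s \<pi> (h k)"
    and v: "v \<in> N"
    and good: "\<And>\<pi> k. good k \<Longrightarrow> tests \<pi> \<subseteq> T \<Longrightarrow> good (mk \<pi> k)"
    and T: "\<And>\<alpha>. \<alpha> \<in> T \<Longrightarrow> eval \<alpha> \<sigma> B B \<Longrightarrow> v \<in> s \<alpha>"
  shows "good k \<Longrightarrow> tests \<pi> \<subseteq> T \<Longrightarrow> dia_eval \<pi> \<sigma> B mk C k x \<Longrightarrow> (x \<Longrightarrow> v \<in> h k) \<Longrightarrow> v \<in> h (mk \<pi> k)"
proof (induct \<pi> arbitrary: k x rule: psize.induct)
  case (4 \<pi>1 \<pi>2)
  have "v \<in> h (mk \<pi>1 (mk \<pi>2 k))"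
  proof (rule 4(1))
    show "good (mk \<pi>2 k)" using good 4(3,4) by auto
    show "dia_eval \<pi>1 \<sigma> B mk C (mk \<pi>2 k) (dia_eval \<pi>2 \<sigma> B mk C k x)" using 4(5) by simp
    show "v \<in> h (mk \<pi>2 k)" if "dia_eval \<pi>2 \<sigma> B mk C k x"
      by (rule 4(2)[OF _ _ that]) (use 4 in auto)
  qed (use 4(4) in auto)
  then show ?case by (simp add: h)
next
  case (5 \<pi>1 \<pi>2)
  from 5(5) have "dia_eval \<pi>1 \<sigma> B mk C k x \<or> dia_eval \<pi>2 \<sigma> B mk C k x" by simp
  then have "v \<in> h (mk \<pi>1 k) \<or> v \<in> h (mk \<pi>2 k)"
    using 5(1)[of k x] 5(2)[of k x] 5(3,4,6) by auto
  then show ?case by (simp add: h)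
next
  case (6 \<pi>)
  show ?case
  proof (cases x)
    case True
    then have "v \<in> (preim N R S s \<pi> ^^ 0) (h k)" using 6 by simp
    then show ?thesis unfolding h preim.simps by (rule UN_I[OF UNIV_I])
  next
    case False
    have "v \<in> h (mk \<pi> (mk (Star \<pi>) k))"
      by (rule 6(1)[of _ False]) (use 6(2-4) False good[of k "Star \<pi>"] in auto)
    then show ?thesis using preim_Star_unfold[of N R S s \<pi> "h k"] unfolding h by blast
  qed
qed (use Proc Msg T v h in auto)

lemma preim_nodes: "(\<And>\<alpha>. \<alpha> \<in> tests \<pi> \<Longrightarrow> s \<alpha> \<subseteq> N) \<Longrightarrow> X \<subseteq> N \<Longrightarrow> preim N R S s \<pi> X \<subseteq> N"
proof (induct \<pi> arbitrary: X rule: psize.induct)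
  case (6 \<pi>)
  have "(preim N R S s \<pi> ^^ j) X \<subseteq> N" for j by (induct j) (use 6 in auto)
  then show ?case by auto
qed auto

text \<open>This is applied to actual truth values, once for the full semantics and once for paths
  confined to a finite set; hence \<open>h\<close> and the relations stay abstract.\<close>

lemma dia_eval_truth:
  assumes C: "\<And>v k. v \<in> N \<Longrightarrow> mk Proc k \<in> C v \<longleftrightarrow> mk Proc k \<in> A \<and> v \<in> h (mk Proc k)"
      "\<And>v k. v \<in> N \<Longrightarrow> mk Msg k \<in> C v \<longleftrightarrow> mk Msg k \<in> A \<and> v \<in> h (mk Msg k)"
    and h: "\<And>\<pi> k. h (mk \<pi> k) = preim N R S s \<pi> (h k)"
    and T: "\<And>v \<alpha>. \<alpha> \<in> tests \<pi> \<Longrightarrow> v \<in> N \<Longrightarrow> eval \<alpha> (l v) (B v) (B v) \<longleftrightarrow> v \<in> s \<alpha>"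
    and s: "\<And>\<alpha>. s \<alpha> \<subseteq> N" "h k \<subseteq> N"
    and A: "path_atoms mk \<pi> k \<subseteq> A" and v: "v \<in> N"
  shows "dia_eval \<pi> (l v) (B v) mk (C v) k (v \<in> h k) \<longleftrightarrow> v \<in> h (mk \<pi> k)"
proof
  have sound: "v \<in> h (mk \<pi>' k)" if "tests \<pi>' \<subseteq> tests \<pi>" "v \<in> N"
    "dia_eval \<pi>' (l v) (B v) mk (C v) k (v \<in> h k)" for v \<pi>' k
    by (rule dia_eval_sound[where C = "C v" and R = R and S = S and N = N and s = s
        and good = "\<lambda>_. True" and T = "tests \<pi>" and h = h and mk = mk and \<sigma> = "l v" and B = "B v"])
      (use that C T in \<open>auto simp: h\<close>)
  show "v \<in> h (mk \<pi> k)" if "dia_eval \<pi> (l v) (B v) mk (C v) k (v \<in> h k)"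
    by (rule sound[OF order_refl v that])
  show "dia_eval \<pi> (l v) (B v) mk (C v) k (v \<in> h k)" if "v \<in> h (mk \<pi> k)"
    by (rule conjunct1, rule dia_eval_complete[where R = R and S = S and N = N and s = s
        and T = "tests \<pi>" and H = "\<lambda>w k. w \<in> h k" and A = A and C = C and mk = mk])
      (use that C T A s sound in \<open>auto simp: h subset_iff\<close>)
qed

section \<open>Order properties of message sequence charts\<close>

lemma finite_Sigma_loc: "finite P \<Longrightarrow> finite (Sigma_loc P p)"
  by (simp add: Sigma_loc_def)

locale msc_model =
  fixes P :: "'p set" and M :: "('v, 'p) msc"
  assumes msc: "is_msc P M" and finP: "finite P"
begin

abbreviation "N \<equiv> nodes M"
abbreviation "R \<equiv> proc_rel M"
abbreviation "S \<equiv> msg_rel P M"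
abbreviation "pr v \<equiv> subj (lab M v)"
abbreviation leM (infix "\<sqsubseteq>" 50) where "u \<sqsubseteq> v \<equiv> (u, v) \<in> le M"

lemma le_nodes: "u \<sqsubseteq> v \<Longrightarrow> u \<in> N \<and> v \<in> N"
proof -
  assume u: "u \<sqsubseteq> v"
  have "le M = Restr ((R \<union> S)\<^sup>*) N" using msc unfolding is_msc_def by blast
  with u show ?thesis by blast
qed

lemma le_refl: "v \<in> N \<Longrightarrow> v \<sqsubseteq> v"
  using msc unfolding is_msc_def partial_order_on_def preorder_on_def refl_on_def by blast

lemma le_trans: "u \<sqsubseteq> v \<Longrightarrow> v \<sqsubseteq> w \<Longrightarrow> u \<sqsubseteq> w"
  using msc unfolding is_msc_def partial_order_on_def preorder_on_def trans_def by blast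

lemma le_antisym: "u \<sqsubseteq> v \<Longrightarrow> v \<sqsubseteq> u \<Longrightarrow> u = v"
  using msc unfolding is_msc_def partial_order_on_def antisym_def by blast

lemma past_finite: "finite {u. u \<sqsubseteq> v}"
proof (cases "v \<in> N")
  case True
  then have "finite {u \<in> N. u \<sqsubseteq> v}" using msc unfolding is_msc_def by blast
  moreover have "{u. u \<sqsubseteq> v} = {u \<in> N. u \<sqsubseteq> v}" using le_nodes by auto
  ultimately show ?thesis by simp
next
  case False
  then have "{u. u \<sqsubseteq> v} = {}" using le_nodes by auto
  then show ?thesis by simp
qed

lemma past_finite': "finite {u. u \<sqsubseteq> v \<and> Q u}"
  by (rule finite_subset[OF _ past_finite]) auto

lemma lab_loc: "v \<in> N \<Longrightarrow> lab M v \<in> Sigma_loc P (pr v)"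
proof -
  assume "v \<in> N"
  then have "lab M v \<in> Sigma_all P" using msc unfolding is_msc_def by blast
  then show ?thesis by (auto simp: Sigma_all_def Sigma_loc_def)
qed

lemma pr_in: "v \<in> N \<Longrightarrow> pr v \<in> P"
proof -
  assume "v \<in> N"
  then have "lab M v \<in> Sigma_all P" using msc unfolding is_msc_def by blast
  then show ?thesis by (auto simp: Sigma_all_def Sigma_loc_def)
qed

lemma total: "u \<in> N \<Longrightarrow> v \<in> N \<Longrightarrow> pr u = pr v \<Longrightarrow> u \<sqsubseteq> v \<or> v \<sqsubseteq> u"
proof -
  assume *: "u \<in> N" "v \<in> N" "pr u = pr v"
  then have "total_on (nodes_of M (pr v)) (le M)" using msc pr_in unfolding is_msc_def by blast
  then show ?thesis using * le_refl[of v] by (cases "u = v") (auto simp: total_on_def nodes_of_def)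
qed

lemma past_card_less: "u \<sqsubseteq> v \<Longrightarrow> u \<noteq> v \<Longrightarrow> card {w. w \<sqsubseteq> u} < card {w. w \<sqsubseteq> v}"
proof (rule psubset_card_mono[OF past_finite])
  assume *: "u \<sqsubseteq> v" "u \<noteq> v"
  then have "v \<notin> {w. w \<sqsubseteq> u}" using le_antisym by auto
  moreover have "v \<in> {w. w \<sqsubseteq> v}" using * le_nodes le_refl by auto
  moreover have "{w. w \<sqsubseteq> u} \<subseteq> {w. w \<sqsubseteq> v}" using * le_trans by auto
  ultimately show "{w. w \<sqsubseteq> u} \<subset> {w. w \<sqsubseteq> v}" by blast
qed

lemma past_induct [consumes 1, case_names less]:
  assumes "v \<in> N" "\<And>v. v \<in> N \<Longrightarrow> (\<And>u. u \<sqsubseteq> v \<Longrightarrow> u \<noteq> v \<Longrightarrow> Q u) \<Longrightarrow> Q v"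
  shows "Q v"
  using assms(1)
proof (induct "card {w. w \<sqsubseteq> v}" arbitrary: v rule: less_induct)
  case less
  show ?case using assms(2)[OF less(2)] less(1) past_card_less le_nodes by blast
qed

lemma finite_greatest:
  assumes "finite X" "X \<noteq> {}" "\<And>u v. u \<in> X \<Longrightarrow> v \<in> X \<Longrightarrow> u \<sqsubseteq> v \<or> v \<sqsubseteq> u"
  shows "\<exists>x\<in>X. \<forall>u\<in>X. u \<sqsubseteq> x"
  using assms
proof (induct rule: finite_ne_induct)
  case (insert x F)
  then obtain y where y: "y \<in> F" "\<forall>u\<in>F. u \<sqsubseteq> y" by blast
  show ?case
  proof (cases "x \<sqsubseteq> y")
    case True
    then show ?thesis using y by auto
  next
    case False
    then have "y \<sqsubseteq> x" "x \<sqsubseteq> x" using insert(5)[of x y] insert(5)[of x x] y by auto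
    then show ?thesis using y le_trans by blast
  qed
qed auto

lemma least_exists:
  assumes "X \<noteq> {}" "X \<subseteq> N" "\<And>u v. u \<in> X \<Longrightarrow> v \<in> X \<Longrightarrow> u \<sqsubseteq> v \<or> v \<sqsubseteq> u"
  shows "\<exists>x\<in>X. \<forall>u\<in>X. x \<sqsubseteq> u"
proof -
  obtain y where y: "y \<in> X" using assms by auto
  from y assms(2) have "y \<in> N" by auto
  then show ?thesis using y
  proof (induct y rule: past_induct)
    case (less v)
    show ?case
    proof (cases "\<exists>u\<in>X. u \<sqsubseteq> v \<and> u \<noteq> v")
      case True
      then show ?thesis using less by blast
    next
      case False
      then have "v \<sqsubseteq> u" if "u \<in> X" for u
        using assms(3)[OF less(3) that] le_refl[OF less(1)] that by blast
      then show ?thesis using less(3) by blast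
    qed
  qed
qed

section \<open>Neighbouring events of a process\<close>

lemma procD:
  assumes "(u, v) \<in> R"
  shows "u \<in> N" "v \<in> N" "pr u = pr v" "u \<sqsubseteq> v" "u \<noteq> v"
  using assms unfolding proc_rel_def lt_def by auto

lemma proc_between: "(u, v) \<in> R \<Longrightarrow> w \<in> N \<Longrightarrow> pr w = pr v \<Longrightarrow> w \<sqsubseteq> u \<or> v \<sqsubseteq> w"
  using total[of w u] total[of w v] unfolding proc_rel_def lt_def by auto

lemma procI:
  "u \<in> N \<Longrightarrow> v \<in> N \<Longrightarrow> pr u = pr v \<Longrightarrow> u \<sqsubseteq> v \<Longrightarrow> u \<noteq> v \<Longrightarrow>
    (\<And>w. w \<in> N \<Longrightarrow> pr w = pr v \<Longrightarrow> w \<sqsubseteq> u \<or> v \<sqsubseteq> w) \<Longrightarrow> (u, v) \<in> R"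
  using le_antisym unfolding proc_rel_def lt_def by fastforce

lemma proc_unique_right: "(u, v) \<in> R \<Longrightarrow> (u, w) \<in> R \<Longrightarrow> v = w"
  using proc_between[of u v w] proc_between[of u w v] procD[of u v] procD[of u w] le_antisym by auto

lemma proc_unique_left: "(u, w) \<in> R \<Longrightarrow> (v, w) \<in> R \<Longrightarrow> u = v"
  using proc_between[of u w v] proc_between[of v w u] procD[of u w] procD[of v w] le_antisym by auto

lemma proc_pred_exists:
  assumes "u \<sqsubseteq> v" "u \<noteq> v" "pr u = pr v"
  shows "\<exists>w. (w, v) \<in> R"
proof -
  note n = le_nodes[OF assms(1)]
  let ?X = "{w. w \<sqsubseteq> v \<and> w \<noteq> v \<and> pr w = pr v}"
  have "\<exists>x\<in>?X. \<forall>u\<in>?X. u \<sqsubseteq> x"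
  proof (rule finite_greatest)
    show "a \<sqsubseteq> b \<or> b \<sqsubseteq> a" if "a \<in> ?X" "b \<in> ?X" for a b
      using that le_nodes by (intro total) auto
  qed (use assms past_finite' in auto)
  then obtain x where x: "x \<in> ?X" "\<forall>u\<in>?X. u \<sqsubseteq> x" by blast
  have "(x, v) \<in> R"
  proof (rule procI)
    show "w \<sqsubseteq> x \<or> v \<sqsubseteq> w" if "w \<in> N" "pr w = pr v" for w
      using total[OF that(1) conjunct2[OF n] that(2)] that x le_refl[OF that(1)] by blast
  qed (use x n le_nodes in auto)
  then show ?thesis by blast
qed

lemma proc_succ_exists:
  assumes "u \<sqsubseteq> v" "u \<noteq> v" "pr u = pr v"
  shows "\<exists>w. (u, w) \<in> R"
proof -
  note n = le_nodes[OF assms(1)]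
  let ?X = "{w. u \<sqsubseteq> w \<and> w \<noteq> u \<and> pr w = pr u}"
  have "\<exists>x\<in>?X. \<forall>w\<in>?X. x \<sqsubseteq> w"
  proof (rule least_exists)
    show "a \<sqsubseteq> b \<or> b \<sqsubseteq> a" if "a \<in> ?X" "b \<in> ?X" for a b
      using that le_nodes by (intro total) auto
    show "?X \<subseteq> N" using le_nodes by blast
  qed (use assms in auto)
  then obtain x where x: "x \<in> ?X" "\<forall>w\<in>?X. x \<sqsubseteq> w" by blast
  have "(u, x) \<in> R"
  proof (rule procI)
    show "w \<sqsubseteq> u \<or> x \<sqsubseteq> w" if "w \<in> N" "pr w = pr x" for w
      using total[OF conjunct1[OF n] that(1)] that x le_refl[OF that(1)] by auto
  qed (use x n le_nodes in auto)
  then show ?thesis by blast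
qed

lemma proc_induct [consumes 1, case_names first succ]:
  assumes "v \<in> N"
    and "\<And>v. v \<in> N \<Longrightarrow> v \<notin> Range R \<Longrightarrow> Q v"
    and "\<And>u v. (u, v) \<in> R \<Longrightarrow> Q u \<Longrightarrow> Q v"
  shows "Q v"
  using assms(1)
proof (induct v rule: past_induct)
  case (less v)
  then show ?case using assms(2,3) procD by (metis RangeE)
qed

lemma first_least: "v \<in> N \<Longrightarrow> v \<notin> Range R \<Longrightarrow> w \<in> N \<Longrightarrow> pr w = pr v \<Longrightarrow> v \<sqsubseteq> w"
  using total[of v w] proc_pred_exists[of w v] le_refl by (metis RangeI)

lemma last_greatest: "v \<in> N \<Longrightarrow> v \<notin> Domain R \<Longrightarrow> w \<in> N \<Longrightarrow> pr w = pr v \<Longrightarrow> w \<sqsubseteq> v"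
  using total[of v w] proc_succ_exists[of v w] le_refl by (metis DomainI)

section \<open>Matching of sends and receives by their rank\<close>

definition rank :: "'p act \<Rightarrow> 'v \<Rightarrow> nat" where
  "rank \<sigma> v = card {u. u \<sqsubseteq> v \<and> lab M u = \<sigma>}"

lemma rank_pos: "v \<in> N \<Longrightarrow> lab M v = \<sigma> \<Longrightarrow> 1 \<le> rank \<sigma> v"
proof -
  assume "v \<in> N" "lab M v = \<sigma>"
  then have "v \<in> {u. u \<sqsubseteq> v \<and> lab M u = \<sigma>}" using le_refl by simp
  then have "0 < rank \<sigma> v" unfolding rank_def card_gt_0_iff using past_finite' by (metis empty_iff)
  then show ?thesis by simp
qed

lemma rank_less:
  assumes "u \<sqsubseteq> v" "u \<noteq> v" "lab M v = \<sigma>"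
  shows "rank \<sigma> u < rank \<sigma> v"
  unfolding rank_def
proof (rule psubset_card_mono[OF past_finite'])
  have "v \<notin> {w. w \<sqsubseteq> u \<and> lab M w = \<sigma>}" using assms le_antisym by auto
  moreover have "v \<in> {w. w \<sqsubseteq> v \<and> lab M w = \<sigma>}" using assms le_nodes le_refl by auto
  moreover have "{w. w \<sqsubseteq> u \<and> lab M w = \<sigma>} \<subseteq> {w. w \<sqsubseteq> v \<and> lab M w = \<sigma>}" using assms le_trans by auto
  ultimately show "{w. w \<sqsubseteq> u \<and> lab M w = \<sigma>} \<subset> {w. w \<sqsubseteq> v \<and> lab M w = \<sigma>}" by blast
qed

lemma rank_inj:
  assumes "u \<in> N" "v \<in> N" "lab M u = \<sigma>" "lab M v = \<sigma>" "rank \<sigma> u = rank \<sigma> v"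
  shows "u = v"
  using total[of u v] rank_less[of u v \<sigma>] rank_less[of v u \<sigma>] assms by auto

lemma rank_pred:
  assumes "v \<in> N" "lab M v = \<sigma>" "1 < rank \<sigma> v"
  shows "\<exists>u. u \<sqsubseteq> v \<and> u \<noteq> v \<and> lab M u = \<sigma> \<and> Suc (rank \<sigma> u) = rank \<sigma> v"
proof -
  let ?Y = "{u. u \<sqsubseteq> v \<and> lab M u = \<sigma>}"
  have v: "v \<in> ?Y" using assms le_refl by auto
  then have c: "Suc (card (?Y - {v})) = card ?Y" using card_Suc_Diff1[OF past_finite' v] by simp
  then have "?Y - {v} \<noteq> {}" using assms(3) unfolding rank_def by force
  have "\<exists>x\<in>?Y - {v}. \<forall>u\<in>?Y - {v}. u \<sqsubseteq> x"
  proof (rule finite_greatest)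
    show "a \<sqsubseteq> b \<or> b \<sqsubseteq> a" if "a \<in> ?Y - {v}" "b \<in> ?Y - {v}" for a b
      using that le_nodes by (intro total) auto
    show "finite (?Y - {v})" using past_finite' by auto
  qed fact
  then obtain x where x: "x \<in> ?Y - {v}" "\<forall>u \<in> ?Y - {v}. u \<sqsubseteq> x" by blast
  have "{u. u \<sqsubseteq> x \<and> lab M u = \<sigma>} = ?Y - {v}"
  proof (rule set_eqI)
    fix u
    have "u \<sqsubseteq> x \<Longrightarrow> u \<sqsubseteq> v" "\<not> v \<sqsubseteq> x" using x le_trans[of u x v] le_antisym[of x v] by blast+
    then show "u \<in> {u. u \<sqsubseteq> x \<and> lab M u = \<sigma>} \<longleftrightarrow> u \<in> ?Y - {v}" using x(2) by blast
  qed
  then show ?thesis using c x unfolding rank_def by auto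
qed

lemma rank_downward:
  assumes "v \<in> N" "lab M v = \<sigma>" "1 \<le> n" "n \<le> rank \<sigma> v"
  shows "\<exists>u. u \<in> N \<and> lab M u = \<sigma> \<and> rank \<sigma> u = n"
  using assms(1,2,4)
proof (induct v rule: past_induct)
  case (less v)
  show ?case
  proof (cases "rank \<sigma> v = n")
    case True
    then show ?thesis using less by auto
  next
    case False
    then have "1 < rank \<sigma> v" "n < rank \<sigma> v" using less assms(3) by auto
    with rank_pred[of v \<sigma>] less obtain u
      where "u \<sqsubseteq> v" "u \<noteq> v" "lab M u = \<sigma>" "Suc (rank \<sigma> u) = rank \<sigma> v" by auto
    then show ?thesis using less(2)[of u] \<open>n < rank \<sigma> v\<close> by auto
  qed
qed

text \<open>If all ranks at \<open>\<tau>\<close> were smaller, only finitely many events would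
  carry \<open>\<tau>\<close>, hence equally many \<open>\<sigma>\<close>; but at least
  \<open>rank \<sigma> v\<close> events do. Finiteness has to be derived, as equipollent sets may be
  infinite.\<close>

lemma rank_exists:
  assumes v: "v \<in> N" "lab M v = \<sigma>" and eq: "{v \<in> N. lab M v = \<sigma>} \<approx> {v \<in> N. lab M v = \<tau>}"
  shows "\<exists>w \<in> N. lab M w = \<tau> \<and> rank \<tau> w = rank \<sigma> v"
proof -
  let ?X = "{v \<in> N. lab M v = \<sigma>}" and ?Y = "{v \<in> N. lab M v = \<tau>}"
  have "\<exists>w \<in> ?Y. rank \<sigma> v \<le> rank \<tau> w"
  proof (rule ccontr)
    assume "\<not> ?thesis"
    then have *: "rank \<tau> ` ?Y \<subseteq> {1..<rank \<sigma> v}" using rank_pos by (auto simp: not_le)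
    have inj: "inj_on (rank \<tau>) ?Y" using rank_inj by (auto intro!: inj_onI)
    have fY: "finite ?Y" using finite_subset[OF *] finite_imageD[OF _ inj] by auto
    have "card ?Y < rank \<sigma> v"
      using card_mono[OF _ *] card_image[OF inj] rank_pos[OF v] by auto
    moreover have "finite ?X" using fY eq eqpoll_finite_iff by auto
    moreover have "card ?X = card ?Y" using eq eqpoll_iff_card[OF \<open>finite ?X\<close> fY] by simp
    moreover have "rank \<sigma> v \<le> card ?X"
      unfolding rank_def using le_nodes by (intro card_mono[OF \<open>finite ?X\<close>]) auto
    ultimately show False by simp
  qed
  then show ?thesis using rank_downward[of _ \<tau> "rank \<sigma> v"] rank_pos[OF v] by auto
qed

lemma msg_rel_rank:
  "(v, w) \<in> S \<longleftrightarrow> v \<in> N \<and> w \<in> N \<and> (\<exists>p q. (p, q) \<in> Ch P \<and> lab M v = Send p q \<and> lab M w = Recv q p \<and>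
     rank (Send p q) v = rank (Recv q p) w)"
proof -
  have *: "{u \<in> N. u \<sqsubseteq> x \<and> lab M u = \<sigma>} = {u. u \<sqsubseteq> x \<and> lab M u = \<sigma>}" for x \<sigma>
    using le_nodes by auto
  show ?thesis unfolding msg_rel_def rank_def * by auto
qed

lemma msg_nodes: "(v, w) \<in> S \<Longrightarrow> v \<in> N \<and> w \<in> N"
  by (auto simp: msg_rel_rank)

lemma msg_labE:
  assumes "(v, w) \<in> S"
  obtains p q where "(p, q) \<in> Ch P" "lab M v = Send p q" "lab M w = Recv q p"
  using assms by (auto simp: msg_rel_rank)

lemma msg_le: "(v, w) \<in> S \<Longrightarrow> v \<sqsubseteq> w"
  using msc msg_nodes unfolding is_msc_def by blast

lemma msg_neq: "(v, w) \<in> S \<Longrightarrow> v \<noteq> w"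
  by (auto simp: msg_rel_rank)

lemma msg_unique_right: "(v, w) \<in> S \<Longrightarrow> (v, w') \<in> S \<Longrightarrow> w = w'"
  unfolding msg_rel_rank by (metis act.inject(1) rank_inj)

lemma msg_unique_left: "(v, w) \<in> S \<Longrightarrow> (v', w) \<in> S \<Longrightarrow> v = v'"
  unfolding msg_rel_rank by (metis act.inject(2) rank_inj)

lemma channel_eqpoll:
  "(p, q) \<in> Ch P \<Longrightarrow> {v \<in> N. lab M v = Send p q} \<approx> {v \<in> N. lab M v = Recv q p}"
  using msc unfolding is_msc_def by auto

lemma Send_Ch: "v \<in> N \<Longrightarrow> lab M v = Send p q \<Longrightarrow> (p, q) \<in> Ch P"
  using lab_loc[of v] pr_in[of v] by (auto simp: Ch_def Sigma_loc_def)

lemma Recv_Ch: "v \<in> N \<Longrightarrow> lab M v = Recv q p \<Longrightarrow> (p, q) \<in> Ch P"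
  using lab_loc[of v] pr_in[of v] by (auto simp: Ch_def Sigma_loc_def)

text \<open>Equipollence of the two ends of a channel leaves no message in transit for ever.\<close>

lemma send_matched: "v \<in> N \<Longrightarrow> lab M v = Send p q \<Longrightarrow> \<exists>w. (v, w) \<in> S"
  using rank_exists[OF _ _ channel_eqpoll] Send_Ch unfolding msg_rel_rank by metis

lemma recv_matched: "w \<in> N \<Longrightarrow> lab M w = Recv q p \<Longrightarrow> \<exists>v. (v, w) \<in> S"
  using rank_exists[OF _ _ eqpoll_sym[OF channel_eqpoll]] Recv_Ch unfolding msg_rel_rank by metis

lemma stepD: "(u, v) \<in> R \<union> S \<Longrightarrow> u \<in> N \<and> v \<in> N \<and> u \<sqsubseteq> v \<and> u \<noteq> v"
  using procD msg_nodes msg_le msg_neq by blast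

end

section \<open>Consistent labellings\<close>

fun modal_atoms :: "'a lform \<Rightarrow> 'a lform set" where
  "modal_atoms (Dia \<pi> k) = path_atoms Dia \<pi> k"
| "modal_atoms (BDia \<pi> k) = path_atoms BDia \<pi> k"
| "modal_atoms _ = {}"

text \<open>The atoms on which \<open>eval\<close> of \<open>\<alpha>\<close> can depend.\<close>

definition form_atoms :: "'a lform \<Rightarrow> 'a lform set" where
  "form_atoms \<alpha> = \<Union>(modal_atoms ` lsub \<alpha>)"

lemma form_atoms_simps [simp]:
  "form_atoms LTrue = {}"
  "form_atoms (Act \<sigma>) = {}"
  "form_atoms (LOr \<alpha> \<beta>) = form_atoms \<alpha> \<union> form_atoms \<beta>"
  "form_atoms (LNot \<alpha>) = form_atoms \<alpha>"
  "form_atoms (Dia \<pi> \<alpha>) = path_atoms Dia \<pi> \<alpha> \<union> \<Union>(modal_atoms ` psub \<pi>) \<union> form_atoms \<alpha>"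
  "form_atoms (BDia \<pi> \<alpha>) = path_atoms BDia \<pi> \<alpha> \<union> \<Union>(modal_atoms ` psub \<pi>) \<union> form_atoms \<alpha>"
  by (auto simp: form_atoms_def)

lemma path_atoms_shape: "\<gamma> \<in> path_atoms mk \<pi> k \<Longrightarrow> \<exists>k'. \<gamma> = mk Proc k' \<or> \<gamma> = mk Msg k'"
  by (induct \<pi> arbitrary: k rule: psize.induct) auto

text \<open>A continuation is composed of parts of \<open>\<pi>\<close> and \<open>k\<close>, so its
  evaluation asks for no new atoms.\<close>

lemma path_atoms_closed:
  assumes "mk = Dia \<or> mk = BDia" "\<pi>' \<in> {Proc, Msg}"
  shows "mk \<pi>' \<delta> \<in> path_atoms mk \<pi> k \<Longrightarrow>
    form_atoms \<delta> \<subseteq> path_atoms mk \<pi> k \<union> \<Union>(modal_atoms ` psub \<pi>) \<union> form_atoms k"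
proof (induct \<pi> arbitrary: k rule: psize.induct)
  case (4 \<pi>1 \<pi>2)
  have eq: "form_atoms (mk \<pi>2 k) = path_atoms mk \<pi>2 k \<union> \<Union>(modal_atoms ` psub \<pi>2) \<union> form_atoms k"
    using assms(1) by auto
  from 4(3) have "mk \<pi>' \<delta> \<in> path_atoms mk \<pi>1 (mk \<pi>2 k) \<or> mk \<pi>' \<delta> \<in> path_atoms mk \<pi>2 k" by simp
  then show ?case using 4(1)[of "mk \<pi>2 k"] 4(2)[of k] unfolding eq by auto
next
  case (5 \<pi>1 \<pi>2)
  from 5(3) have "mk \<pi>' \<delta> \<in> path_atoms mk \<pi>1 k \<or> mk \<pi>' \<delta> \<in> path_atoms mk \<pi>2 k" by simp
  then show ?case using 5(1)[of k] 5(2)[of k] by auto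
next
  case (6 \<pi>)
  have eq: "form_atoms (mk (Star \<pi>) k) =
      path_atoms mk (Star \<pi>) k \<union> \<Union>(modal_atoms ` psub (Star \<pi>)) \<union> form_atoms k"
    using assms(1) by auto
  from 6(2) have "mk \<pi>' \<delta> \<in> path_atoms mk \<pi> (mk (Star \<pi>) k)" by simp
  from 6(1)[OF this] show ?case unfolding eq by auto
qed (use assms in auto)

text \<open>The formulas on which a chain of claims can live: continuations of a modal formula whose
  tests have already been dealt with.\<close>

inductive chain_form :: "('a lform \<Rightarrow> bool) \<Rightarrow> ('a pexp \<Rightarrow> 'a lform \<Rightarrow> 'a lform) \<Rightarrow> 'a lform \<Rightarrow> bool"
  for cor mk where
  base: "cor k \<Longrightarrow> chain_form cor mk k"
| step: "chain_form cor mk k \<Longrightarrow> tests \<pi> \<subseteq> {\<alpha>. cor \<alpha>} \<Longrightarrow> chain_form cor mk (mk \<pi> k)"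

context msc_model
begin

abbreviation sem where "sem \<equiv> lsem P M"

lemma sem_Dia: "sem (Dia \<pi> k) = preim N R S sem \<pi> (sem k)"
  by (simp add: fwd_preim)

lemma sem_BDia: "sem (BDia \<pi> k) = preim N (R\<inverse>) (S\<inverse>) sem \<pi> (sem k)"
  by (simp add: bwd_preim)

lemma sem_nodes: "sem \<alpha> \<subseteq> N"
proof -
  have "\<forall>\<alpha>\<in>tests \<pi>. sem \<alpha> \<subseteq> N" "sem \<alpha> \<subseteq> N" for \<pi> \<alpha>
  proof (induct \<pi> and \<alpha>)
    case (Dia \<pi> k)
    then show ?case unfolding sem_Dia by (intro preim_nodes) auto
  next
    case (BDia \<pi> k)
    then show ?case unfolding sem_BDia by (intro preim_nodes) auto
  qed auto
  then show ?thesis by blast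
qed

end

text \<open>What an accepting run provides, with actual epochs in place of residues.
  \<open>B\<close> contains the claims, \<open>C\<close> those due within the current epoch.
  \<open>same\<close> keeps due claims due; \<open>jump\<close> lets nothing due enter a new epoch
  and makes due there what remains of every other claim.\<close>

locale labelling = msc_model P M for P :: "'p set" and M :: "('v, 'p) msc" +
  fixes A :: "'p act lform set" and B C :: "'v \<Rightarrow> 'p act lform set" and ep :: "'v \<Rightarrow> nat"
  assumes BA: "\<And>v. v \<in> N \<Longrightarrow> B v \<subseteq> A" and CB: "\<And>v. v \<in> N \<Longrightarrow> C v \<subseteq> B v"
    and DiaProc: "\<And>v k. v \<in> N \<Longrightarrow> Dia Proc k \<in> A \<Longrightarrow>
      Dia Proc k \<in> B v \<longleftrightarrow> (\<exists>w. (v, w) \<in> R \<and> eval k (lab M w) (B w) (B w))"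
    and DiaMsg: "\<And>v k. v \<in> N \<Longrightarrow> Dia Msg k \<in> A \<Longrightarrow>
      Dia Msg k \<in> B v \<longleftrightarrow> (\<exists>w. (v, w) \<in> S \<and> eval k (lab M w) (B w) (B w))"
    and BDiaProc: "\<And>v k. v \<in> N \<Longrightarrow> BDia Proc k \<in> A \<Longrightarrow>
      BDia Proc k \<in> B v \<longleftrightarrow> (\<exists>w. (w, v) \<in> R \<and> eval k (lab M w) (B w) (B w))"
    and BDiaMsg: "\<And>v k. v \<in> N \<Longrightarrow> BDia Msg k \<in> A \<Longrightarrow>
      BDia Msg k \<in> B v \<longleftrightarrow> (\<exists>w. (w, v) \<in> S \<and> eval k (lab M w) (B w) (B w))"
    and epoch: "\<And>v w. (v, w) \<in> R \<union> S \<Longrightarrow> ep w = ep v \<or> ep w = Suc (ep v)"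
    and same: "\<And>v w \<pi> k. ((v, w) \<in> R \<and> \<pi> = Proc \<or> (v, w) \<in> S \<and> \<pi> = Msg) \<Longrightarrow> ep w = ep v \<Longrightarrow>
      Dia \<pi> k \<in> C v \<Longrightarrow> eval k (lab M w) (B w) (C w)"
    and jump: "\<And>v w \<pi> k. ((v, w) \<in> R \<and> \<pi> = Proc \<or> (v, w) \<in> S \<and> \<pi> = Msg) \<Longrightarrow> ep w = Suc (ep v) \<Longrightarrow>
      Dia \<pi> k \<notin> C v \<and> (Dia \<pi> k \<in> B v \<longrightarrow> eval k (lab M w) (B w) (C w))"
    and epoch_finite: "\<And>d. finite {v \<in> N. ep v \<le> d}"
begin

text \<open>The claims with deadline \<open>d\<close>: all of them while epoch \<open>d\<close> is
  yet to come, and only the due ones within it.\<close>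

definition dueby :: "nat \<Rightarrow> 'v \<Rightarrow> 'p act lform set" where
  "dueby d v = (if ep v = d then C v else B v)"

abbreviation tr where "tr v k \<equiv> eval k (lab M v) (B v) (B v)"
definition "correct \<alpha> \<longleftrightarrow> (\<forall>v \<in> N. tr v \<alpha> \<longleftrightarrow> v \<in> sem \<alpha>)"

lemma dueby_subset: "v \<in> N \<Longrightarrow> dueby d v \<subseteq> B v"
  using CB by (auto simp: dueby_def)

text \<open>A claim due by \<open>d\<close> is handed on to a later node that is still in an epoch \<open>\<le> d\<close>, and there
  are only finitely many of these.\<close>

lemma claims_fulfilled:
  assumes "v \<in> N" "ep v \<le> d" "d \<le> Suc (ep v)"
    "chain_form correct Dia k" "eval k (lab M v) (B v) (dueby d v)"
  shows "v \<in> sem k"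
  using assms
proof (induct "card {w \<in> N. ep w \<le> d \<and> v \<sqsubseteq> w}" arbitrary: v k rule: less_induct)
  case less
  have later: "\<exists>w. (v, w) \<in> T \<and> w \<in> sem k'"
    if k': "Dia \<pi> k' \<in> dueby d v" "chain_form correct Dia k'" and T: "T = R \<and> \<pi> = Proc \<or> T = S \<and> \<pi> = Msg"
    for \<pi> k' T
  proof -
    have inB: "Dia \<pi> k' \<in> B v" using k' dueby_subset less by blast
    then obtain w where w: "(v, w) \<in> T" "tr w k'"
      using T DiaProc[OF less(2)] DiaMsg[OF less(2)] BA[OF less(2)] by blast
    have vw: "w \<in> N" "v \<sqsubseteq> w" "v \<noteq> w" using w T stepD by auto
    have *: "(v, w) \<in> R \<and> \<pi> = Proc \<or> (v, w) \<in> S \<and> \<pi> = Msg" using w T by blast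
    have e: "ep w = ep v \<or> ep w = Suc (ep v)" using epoch w T by blast
    have "ep w \<le> d \<and> d \<le> Suc (ep w) \<and> eval k' (lab M w) (B w) (dueby d w)"
    \<comment> \<open>Within epoch \<open>d\<close> leaving is forbidden by \<open>jump\<close>. One
      epoch earlier, either the epoch stays the same and so does the deadline, or the step into
      epoch \<open>d\<close> makes the claim due.\<close>
    proof (cases "d = ep v")
      case True
      then have "Dia \<pi> k' \<in> C v" using k' by (simp add: dueby_def)
      with True e same[OF *] jump[OF *] show ?thesis by (auto simp: dueby_def)
    next
      case False
      then have "d = Suc (ep v)" using less by simp
      with False e w inB jump[OF *] show ?thesis by (auto simp: dueby_def)
    qed
    moreover have "card {x \<in> N. ep x \<le> d \<and> w \<sqsubseteq> x} < card {x \<in> N. ep x \<le> d \<and> v \<sqsubseteq> x}"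
    proof (rule psubset_card_mono)
      show "finite {x \<in> N. ep x \<le> d \<and> v \<sqsubseteq> x}" by (rule finite_subset[OF _ epoch_finite[of d]]) auto
      have "v \<notin> {x \<in> N. ep x \<le> d \<and> w \<sqsubseteq> x}" using vw le_antisym by auto
      moreover have "v \<in> {x \<in> N. ep x \<le> d \<and> v \<sqsubseteq> x}" using less le_refl by auto
      moreover have "{x \<in> N. ep x \<le> d \<and> w \<sqsubseteq> x} \<subseteq> {x \<in> N. ep x \<le> d \<and> v \<sqsubseteq> x}"
        using vw le_trans by auto
      ultimately show "{x \<in> N. ep x \<le> d \<and> w \<sqsubseteq> x} \<subset> {x \<in> N. ep x \<le> d \<and> v \<sqsubseteq> x}" by blast
    qed
    ultimately have "w \<in> sem k'" using less(1)[of w k'] vw k' by blast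
    with w show ?thesis by blast
  qed
  from less(5,6) show ?case
  proof (induct k rule: chain_form.induct)
    case (base k)
    then show ?case using eval_mono[OF dueby_subset[OF less(2)]] less(2) by (auto simp: correct_def)
  next
    case (step k \<pi>)
    show ?case
    proof (rule dia_eval_sound[where mk = Dia and h = sem and C = "dueby d v" and R = R and S = S and N = N
          and s = sem and T = "{\<alpha>. correct \<alpha>}" and good = "chain_form correct Dia" and \<sigma> = "lab M v" and B = "B v"])
      show "dia_eval \<pi> (lab M v) (B v) Dia (dueby d v) k (eval k (lab M v) (B v) (dueby d v))"
        using step by simp
      show "chain_form correct Dia k" "tests \<pi> \<subseteq> {\<alpha>. correct \<alpha>}" by fact+
      show "chain_form correct Dia (Dia \<pi>' k')"
        if "chain_form correct Dia k'" "tests \<pi>' \<subseteq> {\<alpha>. correct \<alpha>}" for \<pi>' k'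
        using that by (rule chain_form.step)
      show "v \<in> sem \<alpha>" if "\<alpha> \<in> {\<alpha>. correct \<alpha>}" "tr v \<alpha>" for \<alpha>
        using that less(2) by (simp add: correct_def)
    qed (use later[of Proc] later[of Msg] step less(2) sem_Dia in auto)
  qed
qed

text \<open>Backward chains descend into a finite past and cannot be deferred for ever, so no epochs
  are needed.\<close>

lemma past_claims_sound:
  assumes "v \<in> N" "chain_form correct BDia k" "tr v k"
  shows "v \<in> sem k"
  using assms
proof (induct v arbitrary: k rule: past_induct)
  case (less v)
  have earlier: "\<exists>w. (v, w) \<in> T\<inverse> \<and> w \<in> sem k'"
    if k': "BDia \<pi> k' \<in> B v" "chain_form correct BDia k'" and T: "T = R \<and> \<pi> = Proc \<or> T = S \<and> \<pi> = Msg"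
    for \<pi> k' T
  proof -
    obtain w where w: "(w, v) \<in> T" "tr w k'"
      using k' T BDiaProc[OF less(1)] BDiaMsg[OF less(1)] BA[OF less(1)] by blast
    then have "w \<in> sem k'" using less(2)[of w k'] k' T stepD by blast
    with w show ?thesis by blast
  qed
  from less(3,4) show ?case
  proof (induct k rule: chain_form.induct)
    case (base k)
    then show ?case using less(1) by (auto simp: correct_def)
  next
    case (step k \<pi>)
    show ?case
    proof (rule dia_eval_sound[where mk = BDia and h = sem and C = "B v" and R = "R\<inverse>" and S = "S\<inverse>" and N = N
          and s = sem and T = "{\<alpha>. correct \<alpha>}" and good = "chain_form correct BDia" and \<sigma> = "lab M v" and B = "B v"])
      show "dia_eval \<pi> (lab M v) (B v) BDia (B v) k (tr v k)" using step by simp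
      show "chain_form correct BDia k" "tests \<pi> \<subseteq> {\<alpha>. correct \<alpha>}" by fact+
      show "chain_form correct BDia (BDia \<pi>' k')"
        if "chain_form correct BDia k'" "tests \<pi>' \<subseteq> {\<alpha>. correct \<alpha>}" for \<pi>' k'
        using that by (rule chain_form.step)
      show "v \<in> sem \<alpha>" if "\<alpha> \<in> {\<alpha>. correct \<alpha>}" "tr v \<alpha>" for \<alpha>
        using that less(1) by (simp add: correct_def)
    qed (use earlier[of Proc] earlier[of Msg] step less(1) sem_BDia in auto)
  qed
qed

lemma labelling_correct:
  "(\<Union>(modal_atoms ` psub \<pi>) \<subseteq> A \<longrightarrow> tests \<pi> \<subseteq> {\<alpha>. correct \<alpha>})"
  "(form_atoms \<alpha> \<subseteq> A \<longrightarrow> correct \<alpha>)"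
proof (induct \<pi> and \<alpha>)
  case (Test \<alpha>)
  then show ?case by (simp add: form_atoms_def)
next
  case (Dia \<pi> k)
  show ?case
  proof
    assume A: "form_atoms (Dia \<pi> k) \<subseteq> A"
    then have t: "tests \<pi> \<subseteq> {\<alpha>. correct \<alpha>}" and k: "correct k" using Dia by auto
    have "v \<in> sem (Dia \<pi> k)" if "v \<in> N" "tr v (Dia \<pi> k)" for v
      \<comment> \<open>For this deadline \<open>dueby\<close> is all of \<open>B v\<close>, so
        every guessed claim is covered.\<close>
      by (rule claims_fulfilled[where d = "Suc (ep v)"])
        (use that t chain_form.step[OF chain_form.base, of correct k \<pi> Dia] k in \<open>auto simp: dueby_def\<close>)
    moreover have "tr v (Dia \<pi> k)" if "v \<in> N" "v \<in> sem (Dia \<pi> k)" for v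
    proof -
      \<comment> \<open>The guesses themselves serve as \<open>H\<close>: they are closed under
        evaluation because \<open>tr\<close> is defined by it. Hence true formulas are guessed
        without any appeal to finiteness.\<close>
      have "dia_eval \<pi> (lab M v) (B v) Dia (B v) k (v \<in> sem k) \<and> v \<in> N"
        by (rule dia_eval_complete[where mk = Dia and R = R and S = S and N = N and s = sem and l = "lab M"
              and A = A and T = "{\<alpha>. correct \<alpha>}" and H = tr and C = B])
          (use that t k A DiaProc DiaMsg sem_nodes subsetD[OF sem_nodes] in \<open>auto simp: correct_def fwd_preim\<close>)
      moreover have "(v \<in> sem k) = tr v k" using k that(1) by (simp add: correct_def)
      ultimately show ?thesis by simp
    qed
    ultimately show "correct (Dia \<pi> k)" unfolding correct_def by blast
  qed
next
  case (BDia \<pi> k)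
  show ?case
  proof
    assume A: "form_atoms (BDia \<pi> k) \<subseteq> A"
    then have t: "tests \<pi> \<subseteq> {\<alpha>. correct \<alpha>}" and k: "correct k" using BDia by auto
    have "v \<in> sem (BDia \<pi> k)" if "v \<in> N" "tr v (BDia \<pi> k)" for v
      by (rule past_claims_sound)
        (use that t chain_form.step[OF chain_form.base, of correct k \<pi> BDia] k in auto)
    moreover have "tr v (BDia \<pi> k)" if "v \<in> N" "v \<in> sem (BDia \<pi> k)" for v
    proof -
      have "dia_eval \<pi> (lab M v) (B v) BDia (B v) k (v \<in> sem k) \<and> v \<in> N"
        by (rule dia_eval_complete[where mk = BDia and R = "R\<inverse>" and S = "S\<inverse>" and N = N and s = sem and l = "lab M"
              and A = A and T = "{\<alpha>. correct \<alpha>}" and H = tr and C = B])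
          (use that t k A BDiaProc BDiaMsg sem_nodes subsetD[OF sem_nodes] in \<open>auto simp: correct_def bwd_preim\<close>)
      moreover have "(v \<in> sem k) = tr v k" using k that(1) by (simp add: correct_def)
      ultimately show ?thesis by simp
    qed
    ultimately show "correct (BDia \<pi> k)" unfolding correct_def by blast
  qed
qed (auto simp: correct_def)

end

section \<open>The machine\<close>

lemma subj_in_processes: "is_msc P M \<Longrightarrow> v \<in> nodes M \<Longrightarrow> subj (lab M v) \<in> P"
  unfolding is_msc_def Sigma_all_def Sigma_loc_def by fastforce

text \<open>The machine below has records of formula sets as states, while the result asks for
  natural numbers. One \<open>f\<close> serves all processes, since one function
  \<open>\<rho>\<close> labels the events of all of them.\<close>

definition rename_cfm ::
  "'p set \<Rightarrow> ('s \<Rightarrow> 't) \<Rightarrow> ('c \<Rightarrow> 'd) \<Rightarrow> ('p, 's, 'c) cfm \<Rightarrow> ('p, 't, 'd) cfm" where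
  "rename_cfm P f g A = \<lparr>ctrl = g ` ctrl A, dim = dim A, states = \<lambda>p. f ` states A p,
     trans_rel = \<lambda>p. {(f s, (\<sigma>, b, g m), f t) | s \<sigma> b m t. (s, (\<sigma>, b, m), t) \<in> trans_rel A p},
     init = \<lambda>p. f (init A p), final = (\<lambda>s. \<lambda>p\<in>P. f (s p)) ` final A\<rparr>"

lemma rename_cfm_simps [simp]:
  "ctrl (rename_cfm P f g A) = g ` ctrl A" "dim (rename_cfm P f g A) = dim A"
  "states (rename_cfm P f g A) p = f ` states A p"
  "init (rename_cfm P f g A) p = f (init A p)"
  "final (rename_cfm P f g A) = (\<lambda>s. \<lambda>p\<in>P. f (s p)) ` final A"
  "trans_rel (rename_cfm P f g A) p =
     {(f s, (\<sigma>, b, g m), f t) | s \<sigma> b m t. (s, (\<sigma>, b, m), t) \<in> trans_rel A p}"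
  by (simp_all add: rename_cfm_def)

lemma is_cfm_rename: "is_cfm P A \<Longrightarrow> is_cfm P (rename_cfm P f g A)"
  unfolding is_cfm_def rename_cfm_simps by (intro conjI) (fastforce simp: PiE_def Pi_def)+

lemma accepting_run_rename:
  assumes A: "is_cfm P A" and M: "is_msc P M"
    and run: "is_run P A M c \<rho> \<mu>" "accepting P A M \<rho>"
  shows "is_run P (rename_cfm P f g A) M c (f \<circ> \<rho>) (g \<circ> \<mu>) \<and> accepting P (rename_cfm P f g A) M (f \<circ> \<rho>)"
proof
  show "is_run P (rename_cfm P f g A) M c (f \<circ> \<rho>) (g \<circ> \<mu>)"
    using run(1) unfolding is_run_def rename_cfm_simps by (intro conjI) (fastforce)+
  from run(2) obtain s where s: "s \<in> final A" "\<forall>p\<in>P. s p \<in> cofinal A M \<rho> p"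
    unfolding accepting_def by blast
  have "f (s p) \<in> cofinal (rename_cfm P f g A) M (f \<circ> \<rho>) p" if "p \<in> P" for p
  proof (cases "nodes_of M p = {}")
    case True
    have "s p \<in> cofinal A M \<rho> p" using s(2) that by blast
    with True show ?thesis by (simp add: cofinal_def)
  next
    case False
    have "s p \<in> cofinal A M \<rho> p" using s(2) that by blast
    with False have "s p \<in> states A p"
      "\<forall>v\<in>nodes_of M p. \<exists>v'\<in>nodes_of M p. (v, v') \<in> le M \<and> \<rho> v' = s p"
      by (auto simp: cofinal_def)
    then have "f (s p) \<in> f ` states A p"
      "\<forall>v\<in>nodes_of M p. \<exists>v'\<in>nodes_of M p. (v, v') \<in> le M \<and> (f \<circ> \<rho>) v' = f (s p)"
      by (simp, metis comp_apply)
    then show ?thesis using False unfolding cofinal_def rename_cfm_simps by simp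
  qed
  then show "accepting P (rename_cfm P f g A) M (f \<circ> \<rho>)"
    using s(1) unfolding accepting_def rename_cfm_simps
    by (intro bexI[of _ "\<lambda>p\<in>P. f (s p)"]) auto
qed

text \<open>Injectivity enters in this direction only: states merged by \<open>f\<close> could
  splice transitions into runs that \<open>A\<close> does not have.\<close>

lemma accepting_run_unrename:
  assumes A: "is_cfm P A" and M: "is_msc P M"
    and f: "inj_on f (\<Union>p\<in>P. states A p)" and g: "inj_on g (ctrl A)"
    and run: "is_run P (rename_cfm P f g A) M c \<rho> \<mu>" "accepting P (rename_cfm P f g A) M \<rho>"
  shows "\<exists>\<rho> \<mu>. is_run P A M c \<rho> \<mu> \<and> accepting P A M \<rho>"
proof (intro exI conjI)
  let ?Q = "\<Union>p\<in>P. states A p"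
  define fi gi where "fi = inv_into ?Q f" and "gi = inv_into (ctrl A) g"
  have fi: "fi (f s) = s" if "s \<in> states A p" "p \<in> P" for s p
    unfolding fi_def using that by (intro inv_into_f_f[OF f]) auto
  have gi: "gi (g m) = m" if "m \<in> ctrl A" for m unfolding gi_def using that by (rule inv_into_f_f[OF g])
  have tr: "(fi s, (\<sigma>, b, gi m), fi t) \<in> trans_rel A p"
    if "(s, (\<sigma>, b, m), t) \<in> trans_rel (rename_cfm P f g A) p" "p \<in> P" for s \<sigma> b m t p
  proof -
    from that obtain s' m' t' where *: "s = f s'" "m = g m'" "t = f t'"
      "(s', (\<sigma>, b, m'), t') \<in> trans_rel A p" by auto
    moreover from this have "s' \<in> states A p" "t' \<in> states A p" "m' \<in> ctrl A"
      using A that(2) unfolding is_cfm_def by blast+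
    ultimately show ?thesis using fi gi that(2) by simp
  qed
  have ini: "fi (f (init A p)) = init A p" if "p \<in> P" for p
    using A that fi unfolding is_cfm_def by blast
  show "is_run P A M c (fi \<circ> \<rho>) (gi \<circ> \<mu>)"
    unfolding is_run_def
  proof (intro conjI ballI)
    have "\<rho> v \<in> (\<Union>p\<in>P. f ` states A p)" if "v \<in> nodes M" for v
      using run(1) that unfolding is_run_def rename_cfm_simps by blast
    then show "(fi \<circ> \<rho>) ` nodes M \<subseteq> (\<Union>p\<in>P. states A p)" using fi by fastforce
    have "\<mu> v \<in> g ` ctrl A" if "v \<in> nodes M" for v
      using run(1) that unfolding is_run_def rename_cfm_simps by blast
    then show "(gi \<circ> \<mu>) ` nodes M \<subseteq> ctrl A" using gi by fastforce
    fix e assume "e \<in> msg_rel P M"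
    then show "case e of (v, v') \<Rightarrow> (gi \<circ> \<mu>) v = (gi \<circ> \<mu>) v'"
      using run(1) unfolding is_run_def by auto
  next
    fix e assume e: "e \<in> proc_rel M"
    then obtain u v where "e = (u, v)" "v \<in> nodes M" unfolding proc_rel_def by auto
    then show "case e of (u, v) \<Rightarrow>
        ((fi \<circ> \<rho>) u, (lab M v, c v, (gi \<circ> \<mu>) v), (fi \<circ> \<rho>) v) \<in> trans_rel A (subj (lab M v))"
      using e run(1) tr[OF _ subj_in_processes[OF M]] unfolding is_run_def by fastforce
  next
    fix v assume "v \<in> nodes M"
    then show "v \<notin> Range (proc_rel M) \<longrightarrow>
      (init A (subj (lab M v)), (lab M v, c v, (gi \<circ> \<mu>) v), (fi \<circ> \<rho>) v) \<in> trans_rel A (subj (lab M v))"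
      using run(1) tr[of "f (init A (subj (lab M v)))"] subj_in_processes[OF M] ini
      unfolding is_run_def by (simp del: rename_cfm_simps(6))
  qed
  from run(2) obtain s where s: "s \<in> final A"
    "\<And>p. p \<in> P \<Longrightarrow> f (s p) \<in> cofinal (rename_cfm P f g A) M \<rho> p"
    unfolding accepting_def by auto
  have sQ: "s p \<in> states A p" if "p \<in> P" for p using A s(1) that unfolding is_cfm_def by blast
  have "s p \<in> cofinal A M (fi \<circ> \<rho>) p" if p: "p \<in> P" for p
  proof (cases "nodes_of M p = {}")
    case True
    then have "f (s p) = f (init A p)" using s(2)[OF p] by (simp add: cofinal_def)
    then have "s p = init A p" using fi[OF sQ[OF p] p] ini[OF p] by metis
    then show ?thesis using True by (simp add: cofinal_def)
  next
    case False
    then have *: "\<forall>v\<in>nodes_of M p. \<exists>v'\<in>nodes_of M p. (v, v') \<in> le M \<and> \<rho> v' = f (s p)"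
      using s(2)[OF p] by (simp add: cofinal_def)
    have "\<exists>v'\<in>nodes_of M p. (v, v') \<in> le M \<and> (fi \<circ> \<rho>) v' = s p" if "v \<in> nodes_of M p" for v
      using bspec[OF * that] fi[OF sQ[OF p] p] by auto
    then show ?thesis using False sQ[OF p] by (simp add: cofinal_def)
  qed
  then show "accepting P A M (fi \<circ> \<rho>)" using s(1) unfolding accepting_def by blast
qed

lemma exists_nat_cfm:
  fixes A :: "('p, 's, 'c) cfm"
  assumes A: "is_cfm P A" and P: "finite P"
  shows "\<exists>A' :: ('p, nat, nat) cfm. is_cfm P A' \<and> dim A' = dim A \<and>
    (\<forall>M :: ('v, 'p) msc. M \<in> lang0 P A' \<longleftrightarrow> M \<in> lang0 P A) \<and>
    (\<forall>p\<in>P. card (states A' p) \<le> card (states A p)) \<and> card (ctrl A') \<le> card (ctrl A)"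
proof -
  have fin: "finite (\<Union>p\<in>P. states A p)" "finite (ctrl A)" using A P unfolding is_cfm_def by auto
  obtain f :: "'s \<Rightarrow> nat" where f: "inj_on f (\<Union>p\<in>P. states A p)"
    using finite_imp_inj_to_nat_seg[OF fin(1)] by auto
  obtain g :: "'c \<Rightarrow> nat" where g: "inj_on g (ctrl A)"
    using finite_imp_inj_to_nat_seg[OF fin(2)] by auto
  have "M \<in> lang0 P (rename_cfm P f g A) \<longleftrightarrow> M \<in> lang0 P A" for M :: "('v, 'p) msc"
  proof (cases "is_msc P M")
    case True
    have "(\<exists>\<rho> \<mu>. is_run P (rename_cfm P f g A) M (\<lambda>_. []) \<rho> \<mu> \<and> accepting P (rename_cfm P f g A) M \<rho>) \<longleftrightarrow>
        (\<exists>\<rho> \<mu>. is_run P A M (\<lambda>_. []) \<rho> \<mu> \<and> accepting P A M \<rho>)"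
      using accepting_run_rename[OF A True, of "\<lambda>_. []"]
        accepting_run_unrename[OF A True f g, of "\<lambda>_. []"] by metis
    then show ?thesis by (simp add: lang0_def lang_def del: rename_cfm_simps(1,3-6))
  qed (simp add: lang0_def lang_def)
  moreover have "card (f ` states A p) \<le> card (states A p)" if "p \<in> P" for p
    using A that unfolding is_cfm_def by (auto intro: card_image_le)
  ultimately show ?thesis
    using is_cfm_rename[OF A] fin(2)
    by (intro exI[of _ "rename_cfm P f g A"]) (auto intro: card_image_le)
qed

text \<open>A local state other than the initial one describes an event: \<open>holds\<close> is the guessed set of
  true atoms, and \<open>due\<close> are those to be fulfilled within the current epoch. \<open>res\<close> is the number of
  the epoch modulo \<open>modulus P\<close>, \<open>inc\<close> marks the first event of an epoch other than the first one,
  \<open>zero\<close> the events of the first epoch. \<open>lst\<close> marks the last event, \<open>alive\<close> guesses the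
  labels occurring infinitely often, \<open>dn\<close> are the labels that have occurred in the current epoch.\<close>

record 'p mark =
  lbl :: "'p act"
  holds :: "'p act lform set"
  due :: "'p act lform set"
  res :: nat
  inc :: bool
  zero :: bool
  lst :: bool
  alive :: "'p act set"
  dn :: "'p act set"
  seen :: "'p act gform set"

text \<open>The sender's claims, its due claims and the residue of its epoch. Its label is not sent,
  as the label of the receive determines it.\<close>

type_synonym 'p packet = "'p act lform set \<times> 'p act lform set \<times> nat"

text \<open>\<open>G\<close> collects evidence found anywhere: for \<open>GE \<alpha>\<close> a node
  satisfying \<open>\<alpha>\<close>, for \<open>GA \<alpha>\<close> a counterexample. Evidence only
  accumulates, so finitely many bits per process record it.\<close>

fun gval :: "'a gform set \<Rightarrow> 'a gform \<Rightarrow> bool" where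
  "gval G (GE \<alpha>) \<longleftrightarrow> GE \<alpha> \<in> G"
| "gval G (GA \<alpha>) \<longleftrightarrow> GA \<alpha> \<notin> G"
| "gval G (GOr \<phi> \<psi>) \<longleftrightarrow> gval G \<phi> \<or> gval G \<psi>"
| "gval G (GAnd \<phi> \<psi>) \<longleftrightarrow> gval G \<phi> \<and> gval G \<psi>"

definition hits :: "'a gform \<Rightarrow> 'a \<Rightarrow> 'a lform set \<Rightarrow> 'a gform set" where
  "hits \<phi> \<sigma> B = {GE \<alpha> | \<alpha>. GE \<alpha> \<in> basic_gsub \<phi> \<and> eval \<alpha> \<sigma> B B} \<union>
     {GA \<alpha> | \<alpha>. GA \<alpha> \<in> basic_gsub \<phi> \<and> \<not> eval \<alpha> \<sigma> B B}"

definition all_atoms :: "'a gform \<Rightarrow> 'a lform set" where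
  "all_atoms \<phi> = \<Union>(modal_atoms ` modal_subs \<phi>)"

text \<open>The consistency conditions for one edge from \<open>\<sigma>0\<close>,
  \<open>B0\<close>, \<open>C0\<close> to \<open>\<sigma>\<close>, \<open>B\<close>,
  \<open>C\<close>; the flag \<open>j\<close> says that the edge enters a new epoch.\<close>

definition link :: "'a lform set \<Rightarrow> 'a pexp \<Rightarrow> bool \<Rightarrow> 'a \<Rightarrow> 'a lform set \<Rightarrow> 'a lform set \<Rightarrow>
    'a \<Rightarrow> 'a lform set \<Rightarrow> 'a lform set \<Rightarrow> bool" where
  "link A \<pi> j \<sigma>0 B0 C0 \<sigma> B C \<longleftrightarrow> (\<forall>k.
     (Dia \<pi> k \<in> A \<longrightarrow> (Dia \<pi> k \<in> B0 \<longleftrightarrow> eval k \<sigma> B B)) \<and>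
     (BDia \<pi> k \<in> A \<longrightarrow> (BDia \<pi> k \<in> B \<longleftrightarrow> eval k \<sigma>0 B0 B0)) \<and>
     (if j then Dia \<pi> k \<notin> C0 \<and> (Dia \<pi> k \<in> B0 \<longrightarrow> eval k \<sigma> B C)
      else Dia \<pi> k \<in> C0 \<longrightarrow> eval k \<sigma> B C))"

text \<open>At least 3 even for empty \<open>P\<close>, so that shifts by 1 and 2 are visible in the
  residue; divisible by 3, so that residues determine epochs modulo 3; and greater than
  \<open>3 * idx p\<close> for every process.\<close>

definition modulus :: "'p set \<Rightarrow> nat" where
  "modulus P = 3 * (card P + 1)"

locale translation =
  fixes P :: "'p set" and \<phi> :: "'p act gform" and idx :: "'p \<Rightarrow> nat"
  assumes finite_P: "finite P" and idx_inj: "inj_on idx P" and idx_less: "\<And>p. p \<in> P \<Longrightarrow> idx p < card P"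
begin

abbreviation "A \<equiv> all_atoms \<phi>"
abbreviation "L \<equiv> modulus P"

text \<open>Labels not guessed to be alive are confined to epoch zero, so dead channels need no
  synchronisation. That \<open>lst\<close> is honest is ensured by \<open>succ\<close>, which lets
  no event follow; an event without successor must not claim any \<open>Dia Proc\<close>.\<close>

definition valid :: "'p \<Rightarrow> 'p mark \<Rightarrow> bool" where
  "valid p t \<longleftrightarrow> lbl t \<in> Sigma_loc P p \<and> holds t \<subseteq> A \<and> due t \<subseteq> holds t \<and> res t < L \<and>
     alive t \<subseteq> Sigma_loc P p \<and> dn t \<subseteq> Sigma_loc P p \<and> seen t \<subseteq> basic_gsub \<phi> \<and>
     (\<not> zero t \<longrightarrow> lbl t \<in> alive t) \<and> (lst t \<longrightarrow> (\<forall>k. Dia Proc k \<notin> holds t))"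

text \<open>A send has no incoming and a receive no outgoing message, hence the bans on
  \<open>BDia Msg\<close> and \<open>Dia Msg\<close>. The edge is checked by the receiver, who tells
  from the residues whether it enters a new epoch.\<close>

definition comm :: "'p mark \<Rightarrow> 'p packet \<Rightarrow> bool" where
  "comm t m \<longleftrightarrow> (case lbl t of
     Send p q \<Rightarrow> m = (holds t, due t, res t) \<and> (\<forall>k. BDia Msg k \<notin> holds t)
   | Recv p q \<Rightarrow> (\<forall>k. Dia Msg k \<notin> holds t) \<and> (case m of (B0, C0, r0) \<Rightarrow>
       (res t = r0 \<or> res t = (r0 + 1) mod L) \<and>
       link A Msg (res t \<noteq> r0) (Send q p) B0 C0 (lbl t) (holds t) (due t)))"

definition start :: "'p mark \<Rightarrow> bool" where
  "start t \<longleftrightarrow> \<not> inc t \<and> zero t \<and> res t = 0 \<and> dn t = {lbl t} \<and>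
     seen t = hits \<phi> (lbl t) (holds t) \<and> (\<forall>k. BDia Proc k \<notin> holds t)"

text \<open>An epoch may end only after every alive label has occurred in it. This is what makes the
  epochs of the two ends of an alive channel comparable.\<close>

definition succ :: "'p mark \<Rightarrow> 'p mark \<Rightarrow> bool" where
  "succ s t \<longleftrightarrow> \<not> lst s \<and> alive t = alive s \<and>
     link A Proc (inc t) (lbl s) (holds s) (due s) (lbl t) (holds t) (due t) \<and>
     seen t = seen s \<union> hits \<phi> (lbl t) (holds t) \<and>
     (if inc t then alive s \<subseteq> dn s \<and> dn t = {lbl t} \<and> res t = (res s + 1) mod L \<and> \<not> zero t
      else dn t = insert (lbl t) (dn s) \<and> res t = res s \<and> zero t = zero s)"

definition alive_of :: "'p mark option \<Rightarrow> 'p act set" where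
  "alive_of s = (case s of None \<Rightarrow> {} | Some t \<Rightarrow> alive t)"

definition seen_of :: "'p mark option \<Rightarrow> 'p act gform set" where
  "seen_of s = (case s of None \<Rightarrow> {} | Some t \<Rightarrow> seen t)"

text \<open>In the accepting states the counts of epochs of two processes sharing an alive channel are
  different modulo \<open>L\<close> but equal modulo \<open>3\<close>. This rules out that both processes stop.\<close>

definition fin_ok :: "'p \<Rightarrow> 'p mark option \<Rightarrow> bool" where
  "fin_ok p s \<longleftrightarrow> (case s of None \<Rightarrow> True
     | Some t \<Rightarrow> if alive t = {} then lst t else inc t \<and> res t = 3 * idx p)"

definition pdl_states :: "'p \<Rightarrow> 'p mark option set" where
  "pdl_states p = insert None (Some ` Collect (valid p))"

text \<open>\<open>None\<close> cannot be entered again, so it is cofinal exactly for processes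
  without events. The condition on channels in \<open>final\<close> compares the guesses
  \<open>alive\<close> of both ends, so that messages need not carry them.\<close>

definition pdl_cfm :: "('p, 'p mark option, 'p packet) cfm" where
  "pdl_cfm = \<lparr>ctrl = Pow A \<times> Pow A \<times> {..<L}, dim = 0, states = pdl_states,
     trans_rel = \<lambda>p. {(s, (\<sigma>, b, m), s'). s \<in> pdl_states p \<and> b = [] \<and> m \<in> Pow A \<times> Pow A \<times> {..<L} \<and>
       (\<exists>t. s' = Some t \<and> valid p t \<and> \<sigma> = lbl t \<and> comm t m \<and>
          (case s of None \<Rightarrow> start t | Some s0 \<Rightarrow> succ s0 t))},
     init = \<lambda>p. None,
     final = {f \<in> PiE P pdl_states. (\<forall>p\<in>P. fin_ok p (f p)) \<and>
       (\<forall>(p, q) \<in> Ch P. Send p q \<in> alive_of (f p) \<longleftrightarrow> Recv q p \<in> alive_of (f q)) \<and>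
       gval (\<Union>p\<in>P. seen_of (f p)) \<phi>}\<rparr>"

end

section \<open>Size of the machine\<close>

lemma finite_path_atoms: "finite (path_atoms mk \<pi> k)"
  by (induct \<pi> arbitrary: k rule: psize.induct) auto

lemma card_path_atoms: "card (path_atoms mk \<pi> k) \<le> psize \<pi>"
proof (induct \<pi> arbitrary: k rule: psize.induct)
  case (4 \<pi>1 \<pi>2)
  then show ?case using card_Un_le order_trans add_mono by (metis path_atoms.simps(4) psize.simps(4))
next
  case (5 \<pi>1 \<pi>2)
  then show ?case using card_Un_le order_trans add_mono by (metis path_atoms.simps(5) psize.simps(5))
qed auto

lemma finite_lsub:
  fixes \<pi> :: "'a pexp" and \<alpha> :: "'a lform"
  shows "finite (psub \<pi>)" "finite (lsub \<alpha>)"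
  by (induct \<pi> and \<alpha>) auto

lemma finite_basic_gsub: "finite (basic_gsub \<phi>)"
  by (induct \<phi>) auto

lemma card_basic_gsub: "1 \<le> card (basic_gsub \<phi>)"
proof -
  have "basic_gsub \<phi> \<noteq> {}" by (induct \<phi>) auto
  then show ?thesis using finite_basic_gsub[of \<phi>] by (simp add: Suc_leI card_gt_0_iff)
qed

lemma finite_modal_subs: "finite (modal_subs \<phi>)"
proof -
  have "finite {\<alpha>. GE \<alpha> \<in> basic_gsub \<phi> \<or> GA \<alpha> \<in> basic_gsub \<phi>}"
    by (induct \<phi>) (auto simp: Collect_disj_eq)
  then have "finite (local_subs \<phi>)" unfolding local_subs_def by (intro finite_UN_I finite_lsub)
  then show ?thesis unfolding modal_subs_def by simp
qed

lemma modal_atoms_finite: "finite (modal_atoms \<gamma>)"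
  by (cases \<gamma>) (auto simp: finite_path_atoms)

lemma finite_all_atoms: "finite (all_atoms \<phi>)"
  unfolding all_atoms_def using finite_modal_subs modal_atoms_finite by auto

lemma card_all_atoms:
  assumes "size_bound \<phi> n"
  shows "card (all_atoms \<phi>) \<le> card (modal_subs \<phi>) * n"
proof -
  have "card (modal_atoms \<gamma>) \<le> n" if "\<gamma> \<in> modal_subs \<phi>" for \<gamma>
  proof -
    from that obtain \<pi> k where "\<gamma> = Dia \<pi> k \<or> \<gamma> = BDia \<pi> k" unfolding modal_subs_def by blast
    then have "card (modal_atoms \<gamma>) \<le> psize \<pi>" "psize (Seq \<pi> (Test k)) \<le> n"
      using assms that card_path_atoms unfolding size_bound_def by auto
    then show ?thesis by simp
  qed
  then have "(\<Sum>\<gamma>\<in>modal_subs \<phi>. card (modal_atoms \<gamma>)) \<le> card (modal_subs \<phi>) * n"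
    using sum_bounded_above[of "modal_subs \<phi>" "\<lambda>\<gamma>. card (modal_atoms \<gamma>)" n] by simp
  then show ?thesis unfolding all_atoms_def
    using card_UN_le[OF finite_modal_subs, of modal_atoms] order_trans by blast
qed

lemma form_atoms_all_atoms:
  assumes "\<alpha> \<in> local_subs \<phi>"
  shows "form_atoms \<alpha> \<subseteq> all_atoms \<phi>"
proof -
  have trans: "\<forall>\<beta> \<in> psub \<pi>. lsub \<beta> \<subseteq> psub \<pi>" "\<forall>\<beta> \<in> lsub \<alpha>. lsub \<beta> \<subseteq> lsub \<alpha>" for \<pi> :: "'a pexp" and \<alpha> :: "'a lform"
    by (induct \<pi> and \<alpha>) auto
  have "lsub \<alpha> \<subseteq> local_subs \<phi>" using assms trans(2) unfolding local_subs_def by blast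
  moreover have "modal_atoms \<gamma> = {} \<or> (\<exists>\<pi> k. \<gamma> = Dia \<pi> k \<or> \<gamma> = BDia \<pi> k)" for \<gamma> :: "'a lform"
    by (cases \<gamma>) auto
  ultimately show ?thesis unfolding form_atoms_def all_atoms_def modal_subs_def by blast
qed

lemma basic_in_local_subs: "GE \<alpha> \<in> basic_gsub \<phi> \<or> GA \<alpha> \<in> basic_gsub \<phi> \<Longrightarrow> \<alpha> \<in> local_subs \<phi>"
proof -
  have "\<alpha> \<in> lsub \<alpha>" by (cases \<alpha>) auto
  then show "GE \<alpha> \<in> basic_gsub \<phi> \<or> GA \<alpha> \<in> basic_gsub \<phi> \<Longrightarrow> ?thesis"
    unfolding local_subs_def by blast
qed

lemma all_atoms_closed:
  assumes "mk = Dia \<or> mk = BDia" "\<pi> \<in> {Proc, Msg}" "mk \<pi> k \<in> all_atoms \<phi>"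
  shows "form_atoms k \<subseteq> all_atoms \<phi>"
proof -
  from assms(3) obtain \<gamma> where \<gamma>: "\<gamma> \<in> modal_subs \<phi>" "mk \<pi> k \<in> modal_atoms \<gamma>"
    unfolding all_atoms_def by blast
  from \<gamma>(1) obtain \<pi>' k' where d: "\<gamma> = Dia \<pi>' k' \<or> \<gamma> = BDia \<pi>' k'" unfolding modal_subs_def by blast
  have f: "form_atoms \<gamma> \<subseteq> all_atoms \<phi>" using form_atoms_all_atoms \<gamma>(1) unfolding modal_subs_def by auto
  have "mk \<pi> k \<in> path_atoms mk \<pi>' k'" "form_atoms \<gamma> = path_atoms mk \<pi>' k' \<union> \<Union>(modal_atoms ` psub \<pi>') \<union> form_atoms k'"
    using \<gamma>(2) d assms(1) path_atoms_shape[of "mk \<pi> k"] by fastforce+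
  then show ?thesis using path_atoms_closed[OF assms(1,2), of k \<pi>' k'] f by blast
qed

lemma card_Sigma_loc:
  assumes "finite P"
  shows "card (Sigma_loc P p) \<le> 2 * card P"
proof -
  have "card (Sigma_loc P p) \<le> card (P - {p}) + card (P - {p})"
    unfolding Sigma_loc_def using assms
    by (intro order_trans[OF card_Un_le] add_mono card_image_le) auto
  moreover have "card (P - {p}) \<le> card P" using assms by (simp add: card_mono)
  ultimately show ?thesis by simp
qed

context translation
begin

lemma valid_subset:
  "Collect (valid p) \<subseteq> (\<lambda>(\<sigma>, B, C, r, i, z, l, a, d, G). \<lparr>lbl = \<sigma>, holds = B, due = C, res = r, inc = i,
     zero = z, lst = l, alive = a, dn = d, seen = G\<rparr>) `
   (Sigma_loc P p \<times> Pow A \<times> Pow A \<times> {..<L} \<times> UNIV \<times> UNIV \<times> UNIV \<times> Pow (Sigma_loc P p) \<times>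
     Pow (Sigma_loc P p) \<times> Pow (basic_gsub \<phi>))" (is "_ \<subseteq> ?h ` ?X")
proof
  fix t assume "t \<in> Collect (valid p)"
  then have "(lbl t, holds t, due t, res t, inc t, zero t, lst t, alive t, dn t, seen t) \<in> ?X"
    unfolding valid_def by auto
  moreover have "t = ?h (lbl t, holds t, due t, res t, inc t, zero t, lst t, alive t, dn t, seen t)"
    by simp
  ultimately show "t \<in> ?h ` ?X" by (rule rev_image_eqI)
qed

lemma finite_valid: "finite (Collect (valid p))"
  by (rule finite_subset[OF valid_subset])
    (auto simp: finite_Sigma_loc[OF finite_P] finite_all_atoms finite_basic_gsub)

lemma finite_pdl_states: "finite (pdl_states p)"
  unfolding pdl_states_def using finite_valid by simp

lemma is_cfm_pdl: "is_cfm P pdl_cfm"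
proof -
  have "pdl_states p \<subseteq> insert None (range Some)" "None \<in> pdl_states p" "valid p t \<Longrightarrow> Some t \<in> pdl_states p"
    "valid p t \<Longrightarrow> lbl t \<in> Sigma_loc P p" for p t
    unfolding pdl_states_def valid_def by auto
  then show ?thesis
    unfolding is_cfm_def pdl_cfm_def by (auto simp: finite_pdl_states finite_all_atoms bits_def)
qed

lemma card_pdl_states:
  assumes "p \<in> P" "size_bound \<phi> n"
  shows "card (pdl_states p) \<le> 2 ^ (16 * (card (modal_subs \<phi>) * (n + card P) +
    card P * card (basic_gsub \<phi>) + (card P)\<^sup>2))"
proof -
  define a c l s m where "a = card A" and "c = card P" and "l = card (basic_gsub \<phi>)"
    and "s = card (Sigma_loc P p)" and "m = card (modal_subs \<phi>)"
  have c: "1 \<le> c" using assms finite_P by (auto simp: c_def Suc_le_eq card_gt_0_iff)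
  have s: "s \<le> 2 * c" unfolding s_def c_def by (rule card_Sigma_loc[OF finite_P])
  have p: "c + 1 \<le> 2 ^ c" by (simp add: Suc_leI)
  have "card (Collect (valid p)) \<le> s * (2 ^ a * (2 ^ a * (L * (2 * (2 * (2 * (2 ^ s * (2 ^ s * 2 ^ l))))))))"
    using surj_card_le[OF _ valid_subset]
    by (simp add: card_cartesian_product card_Pow finite_Sigma_loc[OF finite_P] finite_all_atoms finite_basic_gsub
        a_def c_def l_def s_def)
  also have "\<dots> \<le> 2 ^ (c + 1) * (2 ^ a * (2 ^ a * (2 ^ (c + 2) * (2 * (2 * (2 * (2 ^ (2 * c) * (2 ^ (2 * c) * 2 ^ l))))))))"
  proof (intro mult_le_mono power_increasing s order_refl)
    show "s \<le> 2 ^ (c + 1)" using s p by simp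
    show "L \<le> 2 ^ (c + 2)" using p by (simp add: modulus_def c_def)
  qed auto
  also have "\<dots> = 2 ^ (6 * c + 2 * a + l + 6)" by (simp add: power_add[symmetric] flip: power_Suc)
  finally have *: "card (Collect (valid p)) \<le> 2 ^ (6 * c + 2 * a + l + 6)" .
  have "card (pdl_states p) \<le> 1 + card (Collect (valid p))"
    unfolding pdl_states_def using card_image_le[OF finite_valid, of Some p]
    by (simp add: card_insert_if finite_valid)
  also have "\<dots> \<le> 2 ^ (6 * c + 2 * a + l + 7)"
    using add_mono[OF one_le_power[of "2::nat" "6 * c + 2 * a + l + 6"] *] by (simp add: power_add mult.assoc mult.commute mult.left_commute)
  also have "\<dots> \<le> 2 ^ (16 * (m * (n + c) + c * l + c\<^sup>2))"
  proof (rule power_increasing)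
    have "a \<le> m * n" using card_all_atoms[OF assms(2)] by (simp add: a_def m_def)
    moreover have "c \<le> c\<^sup>2" using c by (simp add: power2_eq_square)
    moreover have "l \<le> c * l" using mult_le_mono1[OF c, of l] by simp
    \<comment> \<open>By \<open>1 \<le> c\<close> the summand \<open>6 * c + 7\<close> is at most
      \<open>13 * c\<^sup>2\<close>, which the factor 16 accommodates.\<close>
    ultimately show "6 * c + 2 * a + l + 7 \<le> 16 * (m * (n + c) + c * l + c\<^sup>2)"
      using c unfolding add_mult_distrib2 by linarith
  qed simp
  finally show ?thesis by (simp add: m_def c_def l_def)
qed

lemma card_pdl_ctrl:
  assumes "size_bound \<phi> n"
  shows "card (ctrl pdl_cfm) \<le> 2 ^ (16 * (card (basic_gsub \<phi>) + card (modal_subs \<phi>) * n + (card P)\<^sup>2))"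
proof -
  define a c l m where "a = card A" and "c = card P" and "l = card (basic_gsub \<phi>)"
    and "m = card (modal_subs \<phi>)"
  have p: "c + 1 \<le> 2 ^ c" by (simp add: Suc_leI)
  have "card (ctrl pdl_cfm) = 2 ^ a * (2 ^ a * L)"
    by (simp add: pdl_cfm_def card_cartesian_product card_Pow finite_all_atoms a_def)
  also have "\<dots> \<le> 2 ^ a * (2 ^ a * 2 ^ (c + 2))"
    using p by (intro mult_le_mono order_refl) (simp add: modulus_def c_def)
  also have "\<dots> = 2 ^ (2 * a + c + 2)" by (simp add: power_add[symmetric] flip: power_Suc)
  also have "\<dots> \<le> 2 ^ (16 * (l + m * n + c\<^sup>2))"
  proof (rule power_increasing)
    have "a \<le> m * n" using card_all_atoms[OF assms] by (simp add: a_def m_def)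
    moreover have "c \<le> c\<^sup>2" by (simp add: power2_eq_square)
    \<comment> \<open>\<open>P\<close> may be empty here, so the constant 2 is absorbed by the
      number of basic formulas.\<close>
    moreover have "1 \<le> l" unfolding l_def by (rule card_basic_gsub)
    ultimately show "2 * a + c + 2 \<le> 16 * (l + m * n + c\<^sup>2)"
      by (simp add: add_mult_distrib2)
  qed simp
  finally show ?thesis by (simp add: m_def c_def l_def)
qed

end

section \<open>Accepted charts satisfy the formula\<close>

lemma mod_add_neq_nat:
  fixes a k l :: nat
  assumes "0 < k" "k < l"
  shows "(a + k) mod l \<noteq> a mod l"
proof
  assume "(a + k) mod l = a mod l"
  then have "l dvd k" using mod_eq_dvd_iff_nat[of a "a + k" l] by simp
  with assms show False using nat_dvd_not_less by blast
qed

lemma multiples_of_3_gap: "a mod 3 = 0 \<Longrightarrow> b mod 3 = 0 \<Longrightarrow> a < b \<Longrightarrow> a + 2 < (b :: nat)"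
  by presburger

lemma linkD:
  assumes "link A \<pi> j \<sigma>0 B0 C0 \<sigma> B C"
  shows "Dia \<pi> k \<in> A \<Longrightarrow> Dia \<pi> k \<in> B0 \<longleftrightarrow> eval k \<sigma> B B"
    "BDia \<pi> k \<in> A \<Longrightarrow> BDia \<pi> k \<in> B \<longleftrightarrow> eval k \<sigma>0 B0 B0"
  using assms unfolding link_def by blast+

context msc_model
begin

definition proc_past :: "'v \<Rightarrow> 'v set" where
  "proc_past v = {u. u \<sqsubseteq> v \<and> pr u = pr v}"

lemma proc_past_first: "v \<in> N \<Longrightarrow> v \<notin> Range R \<Longrightarrow> proc_past v = {v}"
proof -
  assume v: "v \<in> N" "v \<notin> Range R"
  have "u = v" if "u \<sqsubseteq> v" "pr u = pr v" for u
    using first_least[OF v, of u] that le_nodes[OF that(1)] le_antisym by blast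
  then show ?thesis using le_refl[OF v(1)] unfolding proc_past_def by blast
qed

lemma proc_past_succ:
  assumes "(u, v) \<in> R"
  shows "proc_past v = insert v (proc_past u)" "v \<notin> proc_past u"
proof -
  note uv = procD[OF assms]
  have "w \<in> proc_past v \<longleftrightarrow> w \<in> insert v (proc_past u)" for w
    using proc_between[OF assms, of w] uv le_trans[of w u v] le_antisym[of w v] le_refl[of v] le_nodes[of w v]
    unfolding proc_past_def by auto
  then show "proc_past v = insert v (proc_past u)" by blast
  show "v \<notin> proc_past u" using uv le_antisym unfolding proc_past_def by blast
qed

lemma finite_proc_past: "finite (proc_past v)"
  unfolding proc_past_def by (rule past_finite')

lemma greatest_exists:
  assumes "finite (nodes_of M p)" "nodes_of M p \<noteq> {}"
  shows "\<exists>x \<in> nodes_of M p. \<forall>v \<in> nodes_of M p. v \<sqsubseteq> x"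
  using assms by (rule finite_greatest) (use total in \<open>auto simp: nodes_of_def\<close>)

lemma gval_gsat:
  fixes \<phi> \<psi> :: "'p act gform"
  assumes G: "\<And>\<alpha>. GE \<alpha> \<in> basic_gsub \<phi> \<Longrightarrow> GE \<alpha> \<in> G \<longleftrightarrow> (\<exists>v\<in>N. v \<in> sem \<alpha>)"
    "\<And>\<alpha>. GA \<alpha> \<in> basic_gsub \<phi> \<Longrightarrow> GA \<alpha> \<in> G \<longleftrightarrow> (\<exists>v\<in>N. v \<notin> sem \<alpha>)"
  shows "basic_gsub \<psi> \<subseteq> basic_gsub \<phi> \<Longrightarrow> gval G \<psi> \<longleftrightarrow> gsat P M \<psi>"
  by (induct \<psi>) (use G in auto)

end

locale accepted_run = translation P \<phi> idx + msc_model P M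
  for P :: "'p set" and \<phi> idx and M :: "('v, 'p) msc" +
  fixes \<rho> :: "'v \<Rightarrow> 'p mark option" and \<mu> :: "'v \<Rightarrow> 'p packet"
  assumes run: "is_run P pdl_cfm M (\<lambda>_. []) \<rho> \<mu>" and acc: "accepting P pdl_cfm M \<rho>"
begin

definition mk :: "'v \<Rightarrow> 'p mark" where "mk v = the (\<rho> v)"

lemma first_step:
  assumes "v \<in> N" "v \<notin> Range R"
  shows "\<rho> v = Some (mk v) \<and> valid (pr v) (mk v) \<and> lbl (mk v) = lab M v \<and> comm (mk v) (\<mu> v) \<and> start (mk v)"
proof -
  have "(init pdl_cfm (pr v), (lab M v, [], \<mu> v), \<rho> v) \<in> trans_rel pdl_cfm (pr v)"
    using run assms unfolding is_run_def by blast
  then show ?thesis unfolding pdl_cfm_def mk_def by auto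
qed

lemma proc_step:
  assumes "(u, v) \<in> R"
  shows "\<rho> v = Some (mk v) \<and> valid (pr v) (mk v) \<and> lbl (mk v) = lab M v \<and> comm (mk v) (\<mu> v) \<and>
    (case \<rho> u of None \<Rightarrow> start (mk v) | Some s \<Rightarrow> succ s (mk v))"
proof -
  have "(\<rho> u, (lab M v, [], \<mu> v), \<rho> v) \<in> trans_rel pdl_cfm (pr v)"
    using run assms unfolding is_run_def by blast
  then show ?thesis unfolding pdl_cfm_def mk_def by (auto split: option.splits)
qed

lemma mark:
  assumes "v \<in> N"
  shows "\<rho> v = Some (mk v)" "valid (pr v) (mk v)" "lbl (mk v) = lab M v" "comm (mk v) (\<mu> v)"
proof -
  have "\<rho> v = Some (mk v) \<and> valid (pr v) (mk v) \<and> lbl (mk v) = lab M v \<and> comm (mk v) (\<mu> v)"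
    using assms first_step proc_step by (cases "v \<in> Range R") blast+
  then show "\<rho> v = Some (mk v)" "valid (pr v) (mk v)" "lbl (mk v) = lab M v" "comm (mk v) (\<mu> v)"
    by blast+
qed

lemma first_start: "v \<in> N \<Longrightarrow> v \<notin> Range R \<Longrightarrow> start (mk v)"
  using first_step by blast

lemma proc_succ: "(u, v) \<in> R \<Longrightarrow> succ (mk u) (mk v)"
  using proc_step mark(1)[OF procD(1)] by fastforce

text \<open>The actual epoch of an event, recovered from the flags \<open>inc\<close>; the states
  know it only modulo \<open>L\<close>.\<close>

definition ep :: "'v \<Rightarrow> nat" where
  "ep v = card {u \<in> proc_past v. inc (mk u)}"

lemma ep_first: "v \<in> N \<Longrightarrow> v \<notin> Range R \<Longrightarrow> ep v = 0"
  using proc_past_first first_start unfolding ep_def start_def by auto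

lemma ep_succ:
  assumes "(u, v) \<in> R"
  shows "ep v = ep u + (if inc (mk v) then 1 else 0)"
proof -
  have "{w \<in> proc_past v. inc (mk w)} =
      (if inc (mk v) then insert v {w \<in> proc_past u. inc (mk w)} else {w \<in> proc_past u. inc (mk w)})"
    using proc_past_succ[OF assms] by auto
  then show ?thesis using proc_past_succ(2)[OF assms] finite_proc_past[of u] unfolding ep_def by auto
qed

lemma ep_mono: "u \<sqsubseteq> v \<Longrightarrow> pr u = pr v \<Longrightarrow> ep u \<le> ep v"
  unfolding ep_def using le_trans
  by (intro card_mono finite_subset[OF _ finite_proc_past[of v]]) (auto simp: proc_past_def)

lemma inc_ep:
  assumes "inc (mk w)" "v \<sqsubseteq> w" "v \<noteq> w" "pr v = pr w"
  shows "ep v < ep w"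
proof -
  obtain u where u: "(u, w) \<in> R" using proc_pred_exists assms by blast
  then have "v \<sqsubseteq> u" using proc_between[OF u, of v] assms le_antisym le_nodes by blast
  then have "ep v \<le> ep u" using procD[OF u] assms by (intro ep_mono) auto
  then show ?thesis using ep_succ[OF u] assms by simp
qed

lemma zero_ep: "v \<in> N \<Longrightarrow> zero (mk v) \<longleftrightarrow> ep v = 0"
proof (induct v rule: proc_induct)
  case (first v)
  then show ?case using ep_first first_start by (auto simp: start_def)
next
  case (succ u v)
  then show ?case using ep_succ[OF succ(1)] proc_succ[OF succ(1)] by (auto simp: succ_def split: if_splits)
qed

lemma mod_L_neq: "(a + 1) mod L \<noteq> a mod L" "(a + 2) mod L \<noteq> a mod L"
  by (rule mod_add_neq_nat; simp add: modulus_def)+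

lemma res_ep: "v \<in> N \<Longrightarrow> res (mk v) = ep v mod L"
proof (induct v rule: proc_induct)
  case (first v)
  then show ?case using ep_first first_start by (auto simp: start_def)
next
  case (succ u v)
  then show ?case using ep_succ[OF succ(1)] proc_succ[OF succ(1)]
    by (auto simp: succ_def mod_Suc_eq split: if_splits)
qed

lemma alive_past: "v \<in> N \<Longrightarrow> u \<in> proc_past v \<Longrightarrow> alive (mk u) = alive (mk v)"
proof (induct v rule: proc_induct)
  case (first v)
  then show ?case using proc_past_first by auto
next
  case (succ w v)
  then show ?case using proc_past_succ(1)[OF succ(1)] proc_succ[OF succ(1)] by (auto simp: succ_def)
qed

lemma seen_past: "v \<in> N \<Longrightarrow> seen (mk v) = (\<Union>u\<in>proc_past v. hits \<phi> (lab M u) (holds (mk u)))"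
proof (induct v rule: proc_induct)
  case (first v)
  then show ?case using proc_past_first first_start mark(3) by (auto simp: start_def)
next
  case (succ u v)
  then show ?case using proc_past_succ(1)[OF succ(1)] proc_succ[OF succ(1)] mark(3)[OF procD(2)[OF succ(1)]]
    by (auto simp: succ_def)
qed

lemma dn_past: "v \<in> N \<Longrightarrow> \<sigma> \<in> dn (mk v) \<Longrightarrow> \<exists>w\<in>proc_past v. lab M w = \<sigma> \<and> ep w = ep v"
proof (induct v rule: proc_induct)
  case (first v)
  then show ?case using proc_past_first first_start mark(3) by (auto simp: start_def)
next
  case (succ u v)
  have "\<sigma> = lab M v \<or> \<not> inc (mk v) \<and> \<sigma> \<in> dn (mk u)"
    using proc_succ[OF succ(1)] succ(3) mark(3)[OF procD(2)[OF succ(1)]]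
    by (auto simp: succ_def split: if_splits)
  then show ?case using succ(2) proc_past_succ(1)[OF succ(1)] ep_succ[OF succ(1)] by auto
qed

text \<open>\<open>succ\<close> ends an epoch only when \<open>dn\<close> contains all alive labels,
  so each of them occurs in every epoch already left.\<close>

lemma alive_epochs:
  "v \<in> N \<Longrightarrow> \<sigma> \<in> alive (mk v) \<Longrightarrow> j < ep v \<Longrightarrow> \<exists>w\<in>proc_past v. lab M w = \<sigma> \<and> ep w = j"
proof (induct v rule: proc_induct)
  case (first v)
  then show ?case using ep_first by simp
next
  case (succ u v)
  have al: "\<sigma> \<in> alive (mk u)" using proc_succ[OF succ(1)] succ(3) by (simp add: succ_def)
  show ?case
  proof (cases "j < ep u")
    case True
    then show ?thesis using succ(2)[OF al] proc_past_succ(1)[OF succ(1)] by auto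
  next
    case False
    then have "inc (mk v)" "j = ep u" using succ(4) ep_succ[OF succ(1)] by (auto split: if_splits)
    then have "\<sigma> \<in> dn (mk u)" using proc_succ[OF succ(1)] al by (auto simp: succ_def)
    then show ?thesis
      using dn_past[OF procD(1)[OF succ(1)]] \<open>j = ep u\<close> proc_past_succ(1)[OF succ(1)] by auto
  qed
qed

section \<open>Consequences of acceptance\<close>

definition fs :: "'p \<Rightarrow> 'p mark option" where
  "fs = (SOME f. f \<in> final pdl_cfm \<and> (\<forall>p\<in>P. f p \<in> cofinal pdl_cfm M \<rho> p))"

lemma fs: "fs \<in> final pdl_cfm" "p \<in> P \<Longrightarrow> fs p \<in> cofinal pdl_cfm M \<rho> p"
proof -
  have "\<exists>f. f \<in> final pdl_cfm \<and> (\<forall>p\<in>P. f p \<in> cofinal pdl_cfm M \<rho> p)"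
    using acc unfolding accepting_def by blast
  from someI_ex[OF this] show "fs \<in> final pdl_cfm" "p \<in> P \<Longrightarrow> fs p \<in> cofinal pdl_cfm M \<rho> p"
    unfolding fs_def by blast+
qed

lemma fs_ok: "p \<in> P \<Longrightarrow> fin_ok p (fs p)"
  using fs(1) unfolding pdl_cfm_def by simp

lemma fs_channel: "(p, q) \<in> Ch P \<Longrightarrow> Send p q \<in> alive_of (fs p) \<longleftrightarrow> Recv q p \<in> alive_of (fs q)"
  using fs(1) unfolding pdl_cfm_def by auto

lemma fs_gval: "gval (\<Union>p\<in>P. seen_of (fs p)) \<phi>"
  using fs(1) unfolding pdl_cfm_def by simp

lemma fs_empty: "p \<in> P \<Longrightarrow> nodes_of M p = {} \<Longrightarrow> fs p = None"
  using fs(2)[of p] unfolding cofinal_def pdl_cfm_def by simp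

lemma fs_cofinal:
  assumes "v \<in> N"
  obtains w where "v \<sqsubseteq> w" "w \<in> N" "pr w = pr v" "fs (pr v) = Some (mk w)"
proof -
  have "v \<in> nodes_of M (pr v)" using assms by (simp add: nodes_of_def)
  then obtain w where "w \<in> nodes_of M (pr v)" "v \<sqsubseteq> w" "\<rho> w = fs (pr v)"
    using fs(2)[OF pr_in[OF assms]] unfolding cofinal_def by (auto split: if_splits)
  then show ?thesis using that mark(1)[of w] by (auto simp: nodes_of_def)
qed

lemma alive_fs: "v \<in> N \<Longrightarrow> alive (mk v) = alive_of (fs (pr v))"
  using fs_cofinal[of v] alive_past[of _ v] unfolding alive_of_def proc_past_def
  by (metis (mono_tags, lifting) mem_Collect_eq option.simps(5))

lemma fs_nonempty: "p \<in> P \<Longrightarrow> alive_of (fs p) \<noteq> {} \<Longrightarrow> nodes_of M p \<noteq> {}"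
  using fs_empty unfolding alive_of_def by auto

lemma fs_alive_inc:
  assumes "v \<in> N" "alive_of (fs (pr v)) \<noteq> {}"
  obtains w where "v \<sqsubseteq> w" "w \<in> N" "pr w = pr v" "inc (mk w)" "res (mk w) = 3 * idx (pr v)"
proof -
  from fs_cofinal[OF assms(1)] obtain w where w: "v \<sqsubseteq> w" "w \<in> N" "pr w = pr v" "fs (pr v) = Some (mk w)" .
  moreover have "inc (mk w)" "res (mk w) = 3 * idx (pr v)"
    using fs_ok[OF pr_in[OF assms(1)]] w(4) assms(2) unfolding fin_ok_def alive_of_def by auto
  ultimately show ?thesis using that by blast
qed

lemma dead_lst:
  assumes "v \<in> N" "alive_of (fs (pr v)) = {}"
  obtains w where "v \<sqsubseteq> w" "w \<in> N" "pr w = pr v" "lst (mk w)" "w \<notin> Domain R"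
proof -
  from fs_cofinal[OF assms(1)] obtain w where w: "v \<sqsubseteq> w" "w \<in> N" "pr w = pr v" "fs (pr v) = Some (mk w)" .
  moreover have "lst (mk w)"
    using fs_ok[OF pr_in[OF assms(1)]] w(4) assms(2) unfolding fin_ok_def alive_of_def by auto
  moreover from this have "w \<notin> Domain R" using proc_succ unfolding succ_def by blast
  ultimately show ?thesis using that by blast
qed

lemma msg_packet:
  assumes "(v, w) \<in> S"
  shows "res (mk w) = res (mk v) \<or> res (mk w) = (res (mk v) + 1) mod L"
    "link A Msg (res (mk w) \<noteq> res (mk v)) (lab M v) (holds (mk v)) (due (mk v)) (lab M w) (holds (mk w)) (due (mk w))"
proof -
  obtain p q where pq: "lab M v = Send p q" "lab M w = Recv q p" using msg_labE[OF assms] by metis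
  have vw: "v \<in> N" "w \<in> N" using msg_nodes[OF assms] by auto
  have "\<mu> w = \<mu> v" using run assms unfolding is_run_def by fastforce
  also have "\<dots> = (holds (mk v), due (mk v), res (mk v))"
    using mark(3,4)[OF vw(1)] pq unfolding comm_def by simp
  finally show "res (mk w) = res (mk v) \<or> res (mk w) = (res (mk v) + 1) mod L"
    "link A Msg (res (mk w) \<noteq> res (mk v)) (lab M v) (holds (mk v)) (due (mk v)) (lab M w) (holds (mk w)) (due (mk w))"
    using mark(3,4)[OF vw(2)] pq unfolding comm_def by auto
qed

text \<open>A skipped epoch would be a completed one without the alive label
  \<open>\<sigma>\<close>, since no event labelled \<open>\<sigma>\<close> lies between consecutive
  ranks.\<close>

lemma label_epoch_step:
  assumes "u \<in> N" "v \<in> N" "lab M u = \<sigma>" "lab M v = \<sigma>" "\<sigma> \<in> alive (mk v)" "rank \<sigma> v = Suc (rank \<sigma> u)"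
    "u \<sqsubseteq> v"
  shows "ep v \<le> Suc (ep u)"
proof (rule ccontr)
  assume *: "\<not> ep v \<le> Suc (ep u)"
  then obtain w where w: "w \<in> proc_past v" "lab M w = \<sigma>" "ep w = Suc (ep u)"
    using alive_epochs[OF assms(2,5), of "Suc (ep u)"] by auto
  have wN: "w \<in> N" "w \<sqsubseteq> v" using w le_nodes unfolding proc_past_def by auto
  have "\<not> w \<sqsubseteq> u" using ep_mono[of w u] w assms by auto
  then have "u \<sqsubseteq> w" "u \<noteq> w" using total[of u w] wN w assms le_refl by auto
  moreover have "w \<noteq> v" using w * by auto
  ultimately have "rank \<sigma> u < rank \<sigma> w" "rank \<sigma> w < rank \<sigma> v"
    using rank_less[of u w \<sigma>] rank_less[of w v \<sigma>] wN w assms by auto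
  then show False using assms(6) by simp
qed

lemma label_epoch_first:
  assumes "v \<in> N" "lab M v = \<sigma>" "\<sigma> \<in> alive (mk v)" "rank \<sigma> v = 1"
  shows "ep v = 0"
proof (rule ccontr)
  assume *: "ep v \<noteq> 0"
  then obtain w where w: "w \<in> proc_past v" "lab M w = \<sigma>" "ep w = 0"
    using alive_epochs[OF assms(1,3), of 0] by auto
  have wN: "w \<in> N" "w \<sqsubseteq> v" using w le_nodes unfolding proc_past_def by auto
  have "w \<noteq> v" using w * by auto
  then show False using rank_less[OF wN(2) _ assms(2)] rank_pos[OF wN(1) w(2)] assms(4) by simp
qed

lemma dead_ep: "v \<in> N \<Longrightarrow> lab M v \<notin> alive (mk v) \<Longrightarrow> ep v = 0"
  using mark(2,3)[of v] zero_ep[of v] unfolding valid_def by auto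

text \<open>Between two consecutive messages on an alive channel, either process passes at most one
  epoch, so that the residues modulo \<open>L\<close> determine the actual difference.\<close>

lemma msg_epoch: "(v, w) \<in> S \<Longrightarrow> ep w = ep v \<or> ep w = Suc (ep v)"
proof -
  assume "(v, w) \<in> S"
  then obtain p q where pq: "(p, q) \<in> Ch P" "lab M v = Send p q" "lab M w = Recv q p"
    using msg_labE by metis
  show ?thesis
  proof (cases "Send p q \<in> alive_of (fs p)")
    \<comment> \<open>Dead labels occur in epoch zero only, and both ends agree that the channel is
      dead.\<close>
    case False
    then have "ep v = 0" "ep w = 0"
      using fs_channel[OF pq(1)] pq msg_nodes[OF \<open>(v, w) \<in> S\<close>] alive_fs by (auto intro!: dead_ep)
    then show ?thesis by simp
  next
    case True
    have al: "Send p q \<in> alive (mk x)" if "x \<in> N" "lab M x = Send p q" for x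
      using alive_fs that True by auto
    have al': "Recv q p \<in> alive (mk x)" if "x \<in> N" "lab M x = Recv q p" for x
      using alive_fs that True fs_channel[OF pq(1)] by auto
    show ?thesis
      using \<open>(v, w) \<in> S\<close> pq(2,3)
    proof (induct "rank (Send p q) v" arbitrary: v w)
      case 0
      then show ?case using rank_pos[of v "Send p q"] msg_nodes by fastforce
    next
      case (Suc n)
      have vw: "v \<in> N" "w \<in> N" using Suc(3) msg_nodes by auto
      have rk: "rank (Recv q p) w = rank (Send p q) v" using Suc(3-5) by (auto simp: msg_rel_rank)
      show ?case
      proof (cases n)
        case 0
        then show ?thesis
          using label_epoch_first[OF vw(1) Suc(4) al[OF vw(1) Suc(4)]]
            label_epoch_first[OF vw(2) Suc(5) al'[OF vw(2) Suc(5)]] rk Suc(2) by simp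
      next
        case (Suc m)
        note Suc' = Suc
        have "1 < rank (Send p q) v" "1 < rank (Recv q p) w" using rk Suc Suc.hyps(2) by auto
        then obtain u x where u: "u \<sqsubseteq> v" "lab M u = Send p q" "Suc (rank (Send p q) u) = rank (Send p q) v"
          and x: "x \<sqsubseteq> w" "lab M x = Recv q p" "Suc (rank (Recv q p) x) = rank (Recv q p) w"
          using rank_pred[OF vw(1) Suc.prems(2)] rank_pred[OF vw(2) Suc.prems(3)] by blast
        have ux: "u \<in> N" "x \<in> N" using u x le_nodes by auto
        have "(u, x) \<in> S" unfolding msg_rel_rank using ux u x rk pq(1) by auto
        then have IH: "ep x = ep u \<or> ep x = Suc (ep u)" using Suc.hyps(1)[of u x] u x Suc.hyps(2) by auto
        have v: "ep u \<le> ep v" "ep v \<le> Suc (ep u)"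
          using ep_mono[OF u(1)] u Suc.prems
            label_epoch_step[OF ux(1) vw(1) u(2) Suc.prems(2) al[OF vw(1) Suc.prems(2)]] by auto
        have w: "ep x \<le> ep w" "ep w \<le> Suc (ep x)"
          using ep_mono[OF x(1)] x Suc.prems
            label_epoch_step[OF ux(2) vw(2) x(2) Suc.prems(3) al'[OF vw(2) Suc.prems(3)]] by auto
        have res: "ep w mod L = ep v mod L \<or> ep w mod L = (ep v + 1) mod L"
          using msg_packet(1)[OF Suc.prems(1)] res_ep vw by (auto simp: mod_Suc_eq)
        \<comment> \<open>The induction hypothesis and the bounds for either process leave the
          values -1, 0, 1 and 2 for \<open>ep w\<close> minus \<open>ep v\<close>. The two outer
          ones would identify residues of numbers that differ by 1 or 2.\<close>
        have "ep w + 1 \<noteq> ep v"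
        proof
          assume "ep w + 1 = ep v"
          then have "(ep w + 1) mod L = ep w mod L \<or> (ep w + 2) mod L = ep w mod L" using res by auto
          then show False using mod_L_neq by blast
        qed
        moreover have "ep w \<noteq> ep v + 2"
        proof
          assume "ep w = ep v + 2"
          then have "(ep v + 2) mod L = ep v mod L \<or> (ep v + 1 + 1) mod L = (ep v + 1) mod L" using res by auto
          then show False using mod_L_neq by blast
        qed
        ultimately show ?thesis using IH v w by linarith
      qed
    qed
  qed
qed

text \<open>The accepting state carries \<open>inc\<close> and recurs for ever on an infinite
  process, and each recurrence begins another epoch.\<close>

lemma epochs_unbounded:
  assumes "p \<in> P" "alive_of (fs p) \<noteq> {}" "infinite (nodes_of M p)"
  shows "\<exists>v\<in>nodes_of M p. d \<le> ep v"
proof (induct d)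
  case 0
  then show ?case using assms(3) by (metis finite.emptyI ex_in_conv le0)
next
  case (Suc d)
  then obtain v where v: "v \<in> N" "pr v = p" "d \<le> ep v" by (auto simp: nodes_of_def)
  have "\<not> nodes_of M p \<subseteq> {u. u \<sqsubseteq> v}" using assms(3) past_finite finite_subset by blast
  then obtain x where x: "x \<in> N" "pr x = p" "\<not> x \<sqsubseteq> v" by (auto simp: nodes_of_def)
  then have vx: "v \<sqsubseteq> x" using total[of v x] v by auto
  from fs_alive_inc[OF x(1)] x(2) assms(2) obtain w where w: "x \<sqsubseteq> w" "w \<in> N" "pr w = p" "inc (mk w)"
    by metis
  have "ep v < ep w"
    by (rule inc_ep) (use w v x vx le_trans in auto)
  then show ?case using v w by (auto simp: nodes_of_def intro!: bexI[of _ w])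
qed

lemma alive_label_infinite:
  assumes "p \<in> P" "\<sigma> \<in> alive_of (fs p)" "infinite (nodes_of M p)"
  shows "infinite {v \<in> N. lab M v = \<sigma>}"
proof
  assume fin: "finite {v \<in> N. lab M v = \<sigma>}"
  define d where "d = Suc (Max (ep ` {v \<in> N. lab M v = \<sigma>}))"
  have "alive_of (fs p) \<noteq> {}" using assms(2) by blast
  from epochs_unbounded[OF assms(1) this assms(3), of "Suc d"]
  obtain v where v: "v \<in> N" "pr v = p" "d < ep v" by (auto simp: nodes_of_def)
  then obtain w where "w \<in> proc_past v" "lab M w = \<sigma>" "ep w = d"
    using alive_epochs[OF v(1)] alive_fs assms(2) by auto
  then have w: "w \<in> {v \<in> N. lab M v = \<sigma>}" "ep w = d" using le_nodes by (auto simp: proc_past_def)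
  have "ep w \<le> Max (ep ` {v \<in> N. lab M v = \<sigma>})" by (rule Max_ge) (use fin w in auto)
  then show False using w(2) unfolding d_def by simp
qed

lemma last_alive:
  assumes "p \<in> P" "alive_of (fs p) \<noteq> {}" "finite (nodes_of M p)"
  obtains x where "x \<in> N" "pr x = p" "\<And>v. v \<in> N \<Longrightarrow> pr v = p \<Longrightarrow> v \<sqsubseteq> x" "ep x mod L = 3 * idx p"
proof -
  obtain x where x: "x \<in> N" "pr x = p" "\<And>v. v \<in> N \<Longrightarrow> pr v = p \<Longrightarrow> v \<sqsubseteq> x"
    using greatest_exists[OF assms(3) fs_nonempty[OF assms(1,2)]] by (auto simp: nodes_of_def)
  from fs_alive_inc[OF x(1)] x(2) assms(2)
  obtain w where w: "x \<sqsubseteq> w" "w \<in> N" "pr w = p" "res (mk w) = 3 * idx p" by metis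
  then have "w = x" using x(3)[of w] le_antisym by blast
  then show ?thesis using that x w res_ep by auto
qed

text \<open>Both processes would stop in epochs that are multiples of 3 and distinct modulo
  \<open>L\<close>. The one ahead, by at least three epochs, has used the channel in an epoch out of
  reach for its partner, although a message enters at most one new epoch.\<close>

lemma channel_not_both_finite:
  assumes pq: "(p, q) \<in> Ch P" "Send p q \<in> alive_of (fs p)"
    and fin: "finite (nodes_of M p)" "finite (nodes_of M q)"
  shows False
proof -
  have P: "p \<in> P" "q \<in> P" "p \<noteq> q" using pq by (auto simp: Ch_def)
  have al: "Recv q p \<in> alive_of (fs q)" using fs_channel pq by blast
  obtain x where x: "x \<in> N" "pr x = p" "\<And>v. v \<in> N \<Longrightarrow> pr v = p \<Longrightarrow> v \<sqsubseteq> x" "ep x mod L = 3 * idx p"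
    using last_alive[OF P(1) _ fin(1)] pq(2) by blast
  obtain y where y: "y \<in> N" "pr y = q" "\<And>v. v \<in> N \<Longrightarrow> pr v = q \<Longrightarrow> v \<sqsubseteq> y" "ep y mod L = 3 * idx q"
    using last_alive[OF P(2) _ fin(2)] al by blast
  have three: "3 dvd L" by (simp add: modulus_def)
  have m3: "ep x mod 3 = 0" "ep y mod 3 = 0"
    using x(4) y(4) mod_mod_cancel[OF three, of "ep x"] mod_mod_cancel[OF three, of "ep y"] by auto
  have "\<not> ep x < ep y"
  proof
    assume "ep x < ep y"
    then have "ep x + 2 < ep y" by (rule multiples_of_3_gap[OF m3])
    \<comment> \<open>A receive may lie one epoch after its send, so \<open>ep x + 2\<close> is the
      earliest contradictory epoch. For sends, below, \<open>ep y + 1\<close> suffices because a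
      receive never lies in an earlier epoch.\<close>
    then obtain w where w: "w \<in> proc_past y" "lab M w = Recv q p" "ep w = ep x + 2"
      using alive_epochs[OF y(1), of "Recv q p" "ep x + 2"] alive_fs[OF y(1)] y(2) al by auto
    then have wN: "w \<in> N" using le_nodes by (auto simp: proc_past_def)
    obtain v where v: "(v, w) \<in> S" using recv_matched[OF wN w(2)] by blast
    then have vN: "v \<in> N" "pr v = p" using msg_nodes msg_labE[OF v] w(2) by (auto, metis act.inject(2) subj.simps(1))
    have "ep v \<le> ep x" using x(3)[OF vN] vN x(2) by (intro ep_mono) auto
    then show False using msg_epoch[OF v] w(3) by linarith
  qed
  moreover have "\<not> ep y < ep x"
  proof
    assume "ep y < ep x"
    then have "ep y + 1 < ep x" using multiples_of_3_gap[OF m3(2,1)] by linarith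
    then obtain v where v: "v \<in> proc_past x" "lab M v = Send p q" "ep v = ep y + 1"
      using alive_epochs[OF x(1), of "Send p q" "ep y + 1"] alive_fs[OF x(1)] x(2) pq(2) by auto
    then have vN: "v \<in> N" using le_nodes by (auto simp: proc_past_def)
    obtain w where w: "(v, w) \<in> S" using send_matched[OF vN v(2)] by blast
    then have wN: "w \<in> N" "pr w = q" using msg_nodes msg_labE[OF w] v(2) by (auto, metis act.inject(1) subj.simps(2))
    have "ep w \<le> ep y" using y(3)[OF wN] wN y(2) by (intro ep_mono) auto
    then show False using msg_epoch[OF w] v(3) by linarith
  qed
  ultimately have "ep x = ep y" by simp
  then have "idx p = idx q" using x(4) y(4) by simp
  then show False using idx_inj P unfolding inj_on_def by blast
qed

text \<open>With only one infinite process, the alive label would occur infinitely often at one end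
  of the channel and finitely often at the other.\<close>

lemma channel_infinite:
  assumes pq: "(p, q) \<in> Ch P" "Send p q \<in> alive_of (fs p)"
  shows "infinite (nodes_of M p) \<and> infinite (nodes_of M q)"
proof -
  have P: "p \<in> P" "q \<in> P" "p \<noteq> q" using pq by (auto simp: Ch_def)
  have al: "Recv q p \<in> alive_of (fs q)" using fs_channel pq by blast
  have eq: "finite {v \<in> N. lab M v = Send p q} \<longleftrightarrow> finite {v \<in> N. lab M v = Recv q p}"
    using eqpoll_finite_iff[OF channel_eqpoll[OF pq(1)]] .
  have "finite {v \<in> N. lab M v = Send p q}" if "finite (nodes_of M p)"
    by (rule finite_subset[OF _ that]) (auto simp: nodes_of_def)
  moreover have "finite {v \<in> N. lab M v = Recv q p}" if "finite (nodes_of M q)"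
    by (rule finite_subset[OF _ that]) (auto simp: nodes_of_def)
  ultimately show ?thesis
    using alive_label_infinite[OF P(1) pq(2)] alive_label_infinite[OF P(2) al] eq
      channel_not_both_finite[OF pq] by blast
qed

lemma alive_infinite:
  assumes "p \<in> P" "alive_of (fs p) \<noteq> {}"
  shows "infinite (nodes_of M p)"
proof -
  obtain \<sigma> where \<sigma>: "\<sigma> \<in> alive_of (fs p)" using assms by blast
  obtain v where v: "v \<in> N" "pr v = p" using fs_nonempty[OF assms] by (auto simp: nodes_of_def)
  then have "\<sigma> \<in> Sigma_loc P p" using alive_fs[OF v(1)] mark(2)[OF v(1)] \<sigma> unfolding valid_def by auto
  then obtain q where q: "q \<in> P" "q \<noteq> p" "\<sigma> = Send p q \<or> \<sigma> = Recv p q" unfolding Sigma_loc_def by auto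
  then have "(p, q) \<in> Ch P" "(q, p) \<in> Ch P" using assms(1) by (auto simp: Ch_def)
  then show ?thesis using channel_infinite[of p q] channel_infinite[of q p] fs_channel[of q p] q(3) \<sigma> by blast
qed

text \<open>A process that stops has no alive labels, so acceptance demands \<open>lst\<close> of
  its last event. Otherwise that event could claim a successor that never comes.\<close>

lemma last_not_Dia_Proc:
  assumes "v \<in> N" "v \<notin> Domain R"
  shows "Dia Proc k \<notin> holds (mk v)"
proof -
  have "nodes_of M (pr v) \<subseteq> {u. u \<sqsubseteq> v}" using last_greatest[OF assms] by (auto simp: nodes_of_def)
  then have "finite (nodes_of M (pr v))" using past_finite finite_subset by blast
  then have "alive_of (fs (pr v)) = {}" using alive_infinite pr_in[OF assms(1)] by blast
  from dead_lst[OF assms(1) this] obtain w where w: "v \<sqsubseteq> w" "w \<in> N" "pr w = pr v" "lst (mk w)" by blast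
  then have "w = v" using last_greatest[OF assms, of w] le_antisym by blast
  then show ?thesis using mark(2)[OF assms(1)] w(4) unfolding valid_def by blast
qed

lemma finite_epochs: "finite {v \<in> N. ep v \<le> d}"
proof -
  have "finite {v \<in> nodes_of M p. ep v \<le> d}" if p: "p \<in> P" for p
  proof (cases "alive_of (fs p) = {}")
    case True
    have "finite (nodes_of M p)"
    proof (cases "nodes_of M p = {}")
      case False
      then obtain v where v: "v \<in> N" "pr v = p" by (auto simp: nodes_of_def)
      from dead_lst[OF v(1)] True v(2)
      obtain w where w: "w \<in> N" "pr w = p" "w \<notin> Domain R" by metis
      then have "nodes_of M p \<subseteq> {u. u \<sqsubseteq> w}" using last_greatest by (auto simp: nodes_of_def)
      then show ?thesis using past_finite finite_subset by blast
    qed simp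
    then show ?thesis by simp
  next
    case False
    then obtain v where v: "v \<in> N" "pr v = p" "Suc d \<le> ep v"
      using epochs_unbounded[OF p False alive_infinite[OF p False]] by (auto simp: nodes_of_def)
    have "{v \<in> nodes_of M p. ep v \<le> d} \<subseteq> {u. u \<sqsubseteq> v}"
    proof
      fix u assume "u \<in> {v \<in> nodes_of M p. ep v \<le> d}"
      then have u: "u \<in> N" "pr u = p" "ep u \<le> d" by (auto simp: nodes_of_def)
      then have "\<not> v \<sqsubseteq> u" using ep_mono[of v u] v by auto
      then show "u \<in> {u. u \<sqsubseteq> v}" using total[of u v] u v by auto
    qed
    then show ?thesis using past_finite finite_subset by blast
  qed
  then have "finite (\<Union>p\<in>P. {v \<in> nodes_of M p. ep v \<le> d})" using finP by blast
  moreover have "{v \<in> N. ep v \<le> d} \<subseteq> (\<Union>p\<in>P. {v \<in> nodes_of M p. ep v \<le> d})"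
    using pr_in by (auto simp: nodes_of_def)
  ultimately show ?thesis by (rule rev_finite_subset)
qed

lemma proc_link:
  assumes "(v, w) \<in> R"
  shows "link A Proc (ep w \<noteq> ep v) (lab M v) (holds (mk v)) (due (mk v)) (lab M w) (holds (mk w)) (due (mk w))"
  using proc_succ[OF assms] ep_succ[OF assms] mark(3) procD[OF assms] unfolding succ_def by auto

lemma msg_link:
  assumes "(v, w) \<in> S"
  shows "link A Msg (ep w \<noteq> ep v) (lab M v) (holds (mk v)) (due (mk v)) (lab M w) (holds (mk w)) (due (mk w))"
proof -
  \<comment> \<open>The difference is known to be 0 or 1 by now, so the receiver's comparison of
    residues is reliable.\<close>
  have "res (mk w) \<noteq> res (mk v) \<longleftrightarrow> ep w \<noteq> ep v"
    using msg_epoch[OF assms] res_ep msg_nodes[OF assms] mod_L_neq(1)[of "ep v"] by auto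
  then show ?thesis using msg_packet(2)[OF assms] by simp
qed

lemma no_msg_succ:
  assumes "v \<in> N" "v \<notin> Domain S"
  shows "Dia Msg k \<notin> holds (mk v)"
  using assms mark(3,4)[OF assms(1)] send_matched[OF assms(1)] unfolding comm_def
  by (cases "lab M v") auto

lemma no_msg_pred:
  assumes "v \<in> N" "v \<notin> Range S"
  shows "BDia Msg k \<notin> holds (mk v)"
  using assms mark(3,4)[OF assms(1)] recv_matched[OF assms(1)] unfolding comm_def
  by (cases "lab M v") auto

sublocale labelling P M A "\<lambda>v. holds (mk v)" "\<lambda>v. due (mk v)" ep
proof
  fix v assume v: "v \<in> N"
  show "holds (mk v) \<subseteq> A" "due (mk v) \<subseteq> holds (mk v)" using mark(2)[OF v] unfolding valid_def by auto
next
  fix v k assume v: "v \<in> N" and "Dia Proc k \<in> A"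
  then show "Dia Proc k \<in> holds (mk v) \<longleftrightarrow>
      (\<exists>w. (v, w) \<in> R \<and> eval k (lab M w) (holds (mk w)) (holds (mk w)))"
  proof (cases "v \<in> Domain R")
    case True
    then obtain w where w: "(v, w) \<in> R" by blast
    then have "\<And>w'. (v, w') \<in> R \<Longrightarrow> w' = w" using proc_unique_right by blast
    then show ?thesis using linkD(1)[OF proc_link[OF w] \<open>Dia Proc k \<in> A\<close>] w by blast
  next
    case False
    then show ?thesis using last_not_Dia_Proc[OF v] by blast
  qed
next
  fix v k assume v: "v \<in> N" and "Dia Msg k \<in> A"
  then show "Dia Msg k \<in> holds (mk v) \<longleftrightarrow>
      (\<exists>w. (v, w) \<in> S \<and> eval k (lab M w) (holds (mk w)) (holds (mk w)))"
  proof (cases "v \<in> Domain S")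
    case True
    then obtain w where w: "(v, w) \<in> S" by blast
    then have "\<And>w'. (v, w') \<in> S \<Longrightarrow> w' = w" using msg_unique_right by blast
    then show ?thesis using linkD(1)[OF msg_link[OF w] \<open>Dia Msg k \<in> A\<close>] w by blast
  next
    case False
    then show ?thesis using no_msg_succ[OF v] by blast
  qed
next
  fix v k assume v: "v \<in> N" and "BDia Proc k \<in> A"
  then show "BDia Proc k \<in> holds (mk v) \<longleftrightarrow>
      (\<exists>w. (w, v) \<in> R \<and> eval k (lab M w) (holds (mk w)) (holds (mk w)))"
  proof (cases "v \<in> Range R")
    case True
    then obtain w where w: "(w, v) \<in> R" by blast
    then have "\<And>w'. (w', v) \<in> R \<Longrightarrow> w' = w" using proc_unique_left by blast
    then show ?thesis using linkD(2)[OF proc_link[OF w] \<open>BDia Proc k \<in> A\<close>] w by blast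
  next
    case False
    then show ?thesis using first_start[OF v] unfolding start_def by blast
  qed
next
  fix v k assume v: "v \<in> N" and "BDia Msg k \<in> A"
  then show "BDia Msg k \<in> holds (mk v) \<longleftrightarrow>
      (\<exists>w. (w, v) \<in> S \<and> eval k (lab M w) (holds (mk w)) (holds (mk w)))"
  proof (cases "v \<in> Range S")
    case True
    then obtain w where w: "(w, v) \<in> S" by blast
    then have "\<And>w'. (w', v) \<in> S \<Longrightarrow> w' = w" using msg_unique_left by blast
    then show ?thesis using linkD(2)[OF msg_link[OF w] \<open>BDia Msg k \<in> A\<close>] w by blast
  next
    case False
    then show ?thesis using no_msg_pred[OF v] by blast
  qed
next
  fix v w assume "(v, w) \<in> R \<union> S"
  then show "ep w = ep v \<or> ep w = Suc (ep v)" using msg_epoch ep_succ by (auto split: if_splits)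
next
  fix v w and \<pi> :: "'p act pexp" and k assume "(v, w) \<in> R \<and> \<pi> = Proc \<or> (v, w) \<in> S \<and> \<pi> = Msg" "ep w = ep v" "Dia \<pi> k \<in> due (mk v)"
  then show "eval k (lab M w) (holds (mk w)) (due (mk w))"
    using proc_link[of v w] msg_link[of v w] unfolding link_def by auto
next
  fix v w and \<pi> :: "'p act pexp" and k assume "(v, w) \<in> R \<and> \<pi> = Proc \<or> (v, w) \<in> S \<and> \<pi> = Msg" "ep w = Suc (ep v)"
  then show "Dia \<pi> k \<notin> due (mk v) \<and> (Dia \<pi> k \<in> holds (mk v) \<longrightarrow> eval k (lab M w) (holds (mk w)) (due (mk w)))"
    using proc_link[of v w] msg_link[of v w] unfolding link_def by auto
qed (rule finite_epochs)

lemma seen_fs: "(\<Union>p\<in>P. seen_of (fs p)) = (\<Union>v\<in>N. hits \<phi> (lab M v) (holds (mk v)))"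
proof
  show "(\<Union>v\<in>N. hits \<phi> (lab M v) (holds (mk v))) \<subseteq> (\<Union>p\<in>P. seen_of (fs p))"
  proof (rule UN_least)
    fix v assume v: "v \<in> N"
    from fs_cofinal[OF v] obtain w where w: "v \<sqsubseteq> w" "w \<in> N" "pr w = pr v" "fs (pr v) = Some (mk w)" .
    then have "hits \<phi> (lab M v) (holds (mk v)) \<subseteq> seen_of (fs (pr v))"
      using seen_past[OF w(2)] unfolding seen_of_def proc_past_def by auto
    then show "hits \<phi> (lab M v) (holds (mk v)) \<subseteq> (\<Union>p\<in>P. seen_of (fs p))" using pr_in[OF v] by blast
  qed
  show "(\<Union>p\<in>P. seen_of (fs p)) \<subseteq> (\<Union>v\<in>N. hits \<phi> (lab M v) (holds (mk v)))"
  proof (rule UN_least)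
    fix p assume p: "p \<in> P"
    show "seen_of (fs p) \<subseteq> (\<Union>v\<in>N. hits \<phi> (lab M v) (holds (mk v)))"
    proof (cases "nodes_of M p = {}")
      case True
      then show ?thesis using fs_empty[OF p] by (simp add: seen_of_def)
    next
      case False
      then obtain v where v: "v \<in> N" "pr v = p" by (auto simp: nodes_of_def)
      from fs_cofinal[OF v(1)] v(2) obtain w where w: "w \<in> N" "fs p = Some (mk w)" by metis
      then show ?thesis using seen_past[OF w(1)] le_nodes unfolding seen_of_def proc_past_def by auto
    qed
  qed
qed

lemma satisfied: "gsat P M \<phi>"
proof -
  have cor: "eval \<alpha> (lab M v) (holds (mk v)) (holds (mk v)) \<longleftrightarrow> v \<in> sem \<alpha>"
    if "GE \<alpha> \<in> basic_gsub \<phi> \<or> GA \<alpha> \<in> basic_gsub \<phi>" "v \<in> N" for \<alpha> v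
    using labelling_correct(2) form_atoms_all_atoms[OF basic_in_local_subs[OF that(1)]] that(2)
    unfolding correct_def by blast
  show ?thesis
    using fs_gval unfolding seen_fs
    by (subst (asm) gval_gsat[where \<phi> = \<phi>]) (use cor in \<open>auto simp: hits_def\<close>)
qed

end

section \<open>Models are accepted\<close>

text \<open>A path is finite, so finitely many nodes witness it. \<open>F\<close> is the target as
  it appears within \<open>W'\<close>; its generality lets \<open>Seq\<close> and
  \<open>Star\<close> feed one confined operator into another.\<close>

lemma preim_witness:
  assumes R: "R \<subseteq> N \<times> N" "S \<subseteq> N \<times> N"
  shows "v \<in> preim N R S s \<pi> X \<Longrightarrow>
    (\<And>x. x \<in> X \<Longrightarrow> \<exists>W \<subseteq> N. finite W \<and> (\<forall>W'. W \<subseteq> W' \<longrightarrow> x \<in> F W')) \<Longrightarrow>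
    \<exists>W \<subseteq> N. finite W \<and> (\<forall>W'. W \<subseteq> W' \<longrightarrow> v \<in> preim N (Restr R W') (Restr S W') s \<pi> (F W'))"
proof (induct \<pi> arbitrary: v X F rule: psize.induct)
  case 1
  then obtain w where w: "v \<in> N" "(v, w) \<in> R" "w \<in> X" by auto
  from 1(2)[OF w(3)] obtain W where "W \<subseteq> N" "finite W" "\<forall>W'. W \<subseteq> W' \<longrightarrow> w \<in> F W'" by blast
  then show ?case using w R by (intro exI[of _ "insert v (insert w W)"]) auto
next
  case 2
  then obtain w where w: "v \<in> N" "(v, w) \<in> S" "w \<in> X" by auto
  from 2(2)[OF w(3)] obtain W where "W \<subseteq> N" "finite W" "\<forall>W'. W \<subseteq> W' \<longrightarrow> w \<in> F W'" by blast
  then show ?case using w R by (intro exI[of _ "insert v (insert w W)"]) auto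
next
  case (3 \<alpha>)
  then have v: "v \<in> s \<alpha>" "v \<in> X" by auto
  from 3(2)[OF v(2)] show ?case using v by auto
next
  case (4 \<pi>1 \<pi>2)
  from 4(3) have "v \<in> preim N R S s \<pi>1 (preim N R S s \<pi>2 X)" by simp
  from 4(1)[OF this, of "\<lambda>W'. preim N (Restr R W') (Restr S W') s \<pi>2 (F W')"] 4(2)[OF _ 4(4)]
  show ?case by simp
next
  case (5 \<pi>1 \<pi>2)
  from 5(3) consider "v \<in> preim N R S s \<pi>1 X" | "v \<in> preim N R S s \<pi>2 X" by auto
  then show ?case
  proof cases
    case 1
    from 5(1)[OF this 5(4)] show ?thesis by auto
  next
    case 2
    from 5(2)[OF this 5(4)] show ?thesis by auto
  qed
next
  case (6 \<pi>)
  have "v \<in> (preim N R S s \<pi> ^^ j) X \<Longrightarrow>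
    \<exists>W \<subseteq> N. finite W \<and> (\<forall>W'. W \<subseteq> W' \<longrightarrow> v \<in> (preim N (Restr R W') (Restr S W') s \<pi> ^^ j) (F W'))" for j v
  proof (induct j arbitrary: v)
    case 0
    then show ?case using 6(3)[of v] by simp
  next
    case (Suc j)
    then have "v \<in> preim N R S s \<pi> ((preim N R S s \<pi> ^^ j) X)" by simp
    from 6(1)[OF this, of "\<lambda>W'. (preim N (Restr R W') (Restr S W') s \<pi> ^^ j) (F W')"] Suc(1)
    show ?case by simp
  qed
  note step = this
  from 6(2) have "\<exists>j. v \<in> (preim N R S s \<pi> ^^ j) X" unfolding preim.simps by (rule UN_E) (rule exI)
  then obtain j where "v \<in> (preim N R S s \<pi> ^^ j) X" ..
  from step[OF this] obtain W where W: "W \<subseteq> N" "finite W"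
    "\<forall>W'. W \<subseteq> W' \<longrightarrow> v \<in> (preim N (Restr R W') (Restr S W') s \<pi> ^^ j) (F W')" by (elim exE conjE)
  have "v \<in> preim N (Restr R W') (Restr S W') s (Star \<pi>) (F W')" if "W \<subseteq> W'" for W'
    unfolding preim.simps by (rule UN_I[OF UNIV_I]) (rule W(3)[rule_format, OF that])
  then show ?case using W(1,2) by (intro exI[of _ W] conjI allI impI)
qed

context msc_model
begin

text \<open>Only the outermost chain of forward diamonds is confined to \<open>W\<close>; tests and
  all other formulas keep their full meaning. This mirrors the last set argument of
  \<open>eval\<close>.\<close>

fun near :: "'v set \<Rightarrow> 'p act lform \<Rightarrow> 'v set" where
  "near W (Dia \<pi> k) = preim N (Restr R W) (Restr S W) sem \<pi> (near W k)"
| "near W \<alpha> = sem \<alpha>"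

lemma near_subset: "near W \<alpha> \<subseteq> sem \<alpha>"
proof (induct W \<alpha> rule: near.induct)
  case (1 W \<pi> k)
  show ?case unfolding near.simps sem_Dia by (rule preim_mono[OF 1]) auto
qed auto

lemma near_witness:
  "v \<in> sem \<alpha> \<Longrightarrow> \<exists>W \<subseteq> N. finite W \<and> (\<forall>W'. W \<subseteq> W' \<longrightarrow> v \<in> near W' \<alpha>)"
proof (induct \<alpha> arbitrary: v rule: lform.induct[of "\<lambda>_. True"])
  case (Dia \<pi> k)
  have "R \<subseteq> N \<times> N" "S \<subseteq> N \<times> N" using procD(1,2) msg_nodes by auto
  from preim_witness[OF this, of v sem \<pi> "sem k" "\<lambda>W. near W k"] Dia show ?case
    unfolding near.simps sem_Dia by blast
qed (auto intro!: exI[of _ "{}"])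

text \<open>Adding the earliest remaining event of each label makes every label that recurs for ever
  appear in each epoch, and it eventually reaches every event.\<close>

definition unseen :: "'v set \<Rightarrow> 'v set" where
  "unseen D = {v \<in> N - D. \<forall>u \<in> N - D. lab M u = lab M v \<longrightarrow> v \<sqsubseteq> u}"

lemma finite_unseen: "finite (unseen D)"
proof (rule finite_imageD)
  have "lab M ` unseen D \<subseteq> (\<Union>p\<in>P. Sigma_loc P p)" using lab_loc pr_in unfolding unseen_def by auto
  moreover have "finite (\<Union>p\<in>P. Sigma_loc P p)" using finP finite_Sigma_loc[OF finP] by blast
  ultimately show "finite (lab M ` unseen D)" by (rule finite_subset)
  show "inj_on (lab M) (unseen D)" by (rule inj_onI) (auto simp: unseen_def intro: le_antisym)
qed

lemma unseen_exists:
  assumes "v \<in> N - D"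
  shows "\<exists>u \<in> unseen D. lab M u = lab M v \<and> u \<sqsubseteq> v"
proof -
  let ?X = "{u \<in> N - D. lab M u = lab M v}"
  have "\<exists>x\<in>?X. \<forall>u\<in>?X. x \<sqsubseteq> u"
    by (rule least_exists) (use assms total in auto)
  then show ?thesis using assms unfolding unseen_def by auto
qed

definition down :: "'v set \<Rightarrow> 'v set" where
  "down X = {u. \<exists>v\<in>X. u \<sqsubseteq> v}"

lemma finite_down: "finite X \<Longrightarrow> finite (down X)"
proof -
  have "down X = (\<Union>v\<in>X. {u. u \<sqsubseteq> v})" unfolding down_def by blast
  then show "finite X \<Longrightarrow> finite (down X)" using past_finite by simp
qed

lemma down_superset: "X \<subseteq> N \<Longrightarrow> X \<subseteq> down X"
  unfolding down_def using le_refl by blast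

lemma finite_next: "finite D \<Longrightarrow> finite ((R \<union> S) `` D)"
proof -
  assume "finite D"
  have one: "finite (T `` {v})" if "\<And>w w'. (v, w) \<in> T \<Longrightarrow> (v, w') \<in> T \<Longrightarrow> w = w'" for T :: "'v rel" and v
  proof (cases "T `` {v} = {}")
    case False
    then obtain w where "(v, w) \<in> T" by blast
    then have "T `` {v} \<subseteq> {w}" using that by blast
    then show ?thesis using finite_subset by blast
  qed simp
  have "finite (R `` {v})" "finite (S `` {v})" for v
    using proc_unique_right msg_unique_right by (blast intro: one)+
  then have "finite (\<Union>v\<in>D. R `` {v} \<union> S `` {v})" using \<open>finite D\<close> by blast
  moreover have "(R \<union> S) `` D = (\<Union>v\<in>D. R `` {v} \<union> S `` {v})" by blast
  ultimately show ?thesis by simp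
qed

definition witness :: "'v \<Rightarrow> 'p act lform \<Rightarrow> 'v set" where
  "witness v a = (if v \<in> sem a
     then SOME W. W \<subseteq> N \<and> finite W \<and> (\<forall>W'. W \<subseteq> W' \<longrightarrow> v \<in> near W' a) else {})"

lemma witness: "witness v a \<subseteq> N" "finite (witness v a)"
    "v \<in> sem a \<Longrightarrow> witness v a \<subseteq> W \<Longrightarrow> v \<in> near W a"
proof -
  have "v \<in> sem a \<Longrightarrow> witness v a \<subseteq> N \<and> finite (witness v a) \<and> (\<forall>W'. witness v a \<subseteq> W' \<longrightarrow> v \<in> near W' a)"
    unfolding witness_def using someI_ex[OF near_witness[of v a]] by simp
  then show "witness v a \<subseteq> N" "finite (witness v a)"
    "v \<in> sem a \<Longrightarrow> witness v a \<subseteq> W \<Longrightarrow> v \<in> near W a"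
    unfolding witness_def by (auto split: if_splits)
qed

end

locale model = translation P \<phi> idx + msc_model P M
  for P :: "'p set" and \<phi> idx and M :: "('v, 'p) msc"
begin

text \<open>An epoch is the difference of two consecutive layers. A layer contains the successors of the
  previous one, so that epochs do not increase by more than one along an edge.\<close>

primrec layer :: "nat \<Rightarrow> 'v set" where
  "layer 0 = down (unseen {} \<union> {v \<in> N. finite {u \<in> N. lab M u = lab M v}})"
| "layer (Suc i) = down (layer i \<union> (R \<union> S) `` layer i \<union> unseen (layer i) \<union>
     (\<Union>v\<in>layer i. \<Union>a\<in>A. witness v a))"

lemma layer_nodes: "layer i \<subseteq> N"
  by (cases i) (auto simp: down_def dest: le_nodes)

lemma layer_down: "v \<in> layer i \<Longrightarrow> u \<sqsubseteq> v \<Longrightarrow> u \<in> layer i"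
  by (cases i) (auto simp: down_def dest: le_trans)

lemma layer_Suc:
  "layer i \<union> (R \<union> S) `` layer i \<union> unseen (layer i) \<union> (\<Union>v\<in>layer i. \<Union>a\<in>A. witness v a) \<subseteq> layer (Suc i)"
  unfolding layer.simps using layer_nodes[of i] procD(2) msg_nodes witness(1)
  by (intro down_superset) (fastforce simp: unseen_def)

lemma finite_layer: "finite (layer i)"
proof (induct i)
  case 0
  let ?F = "{\<sigma> \<in> (\<Union>p\<in>P. Sigma_loc P p). finite {u \<in> N. lab M u = \<sigma>}}"
  have "finite (\<Union>p\<in>P. Sigma_loc P p)" using finP finite_Sigma_loc[OF finP] by blast
  then have "finite ?F" by (rule rev_finite_subset) auto
  then have "finite (\<Union>\<sigma>\<in>?F. {u \<in> N. lab M u = \<sigma>})" by (rule finite_UN_I) auto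
  moreover have "{v \<in> N. finite {u \<in> N. lab M u = lab M v}} \<subseteq> (\<Union>\<sigma>\<in>?F. {u \<in> N. lab M u = \<sigma>})"
    using lab_loc pr_in by fastforce
  ultimately have "finite {v \<in> N. finite {u \<in> N. lab M u = lab M v}}" by (rule rev_finite_subset)
  then show ?case using finite_unseen by (simp add: finite_down)
next
  case (Suc i)
  have "finite (\<Union>v\<in>layer i. \<Union>a\<in>A. witness v a)"
    using Suc finite_all_atoms witness(2) by blast
  then show ?case unfolding layer.simps using Suc finite_unseen finite_next by (intro finite_down) auto
qed

lemma layer_mono: "i \<le> j \<Longrightarrow> layer i \<subseteq> layer j"
  by (rule lift_Suc_mono_le[of layer]) (use layer_Suc in auto)

text \<open>The finitely many earlier events with the label of \<open>v\<close> lie in a common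
  layer; if \<open>v\<close> is not there as well, it is the next one with its label.\<close>

lemma layer_covers: "v \<in> N \<Longrightarrow> \<exists>i. v \<in> layer i"
proof (induct v rule: past_induct)
  case (less v)
  let ?X = "{u. u \<sqsubseteq> v \<and> lab M u = lab M v \<and> u \<noteq> v}"
  have "\<exists>i. ?X \<subseteq> layer i"
  proof -
    have "\<forall>u\<in>?X. \<exists>i. u \<in> layer i" using less(2) by blast
    then obtain f where f: "\<And>u. u \<in> ?X \<Longrightarrow> u \<in> layer (f u)" by (rule bchoice[THEN exE]) blast
    have "finite ?X" by (rule past_finite')
    then have "f u \<le> Max (f ` ?X)" if "u \<in> ?X" for u using that by (intro Max_ge) auto
    then show ?thesis using f layer_mono by blast
  qed
  then obtain i where i: "?X \<subseteq> layer i" ..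
  show ?case
  proof (cases "v \<in> layer i")
    case False
    then obtain u where "u \<in> unseen (layer i)" "lab M u = lab M v" "u \<sqsubseteq> v"
      using unseen_exists less(1) by blast
    moreover from this have "u = v" using i unfolding unseen_def by blast
    ultimately show ?thesis using layer_Suc by blast
  qed blast
qed

definition stage :: "'v \<Rightarrow> nat" where
  "stage v = (LEAST i. v \<in> layer i)"

lemma layer_stage: "v \<in> N \<Longrightarrow> v \<in> layer i \<longleftrightarrow> stage v \<le> i"
  using layer_covers layer_mono unfolding stage_def by (metis LeastI_ex Least_le subsetD)

lemma stage_mono: "u \<sqsubseteq> v \<Longrightarrow> stage u \<le> stage v"
  using layer_down[of v "stage v" u] layer_stage le_nodes by blast

lemma stage_step: "(u, v) \<in> R \<union> S \<Longrightarrow> stage v = stage u \<or> stage v = Suc (stage u)"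
proof -
  assume uv: "(u, v) \<in> R \<union> S"
  note n = stepD[OF uv]
  have "u \<in> layer (stage u)" using layer_stage n by blast
  then have "v \<in> layer (Suc (stage u))" using layer_Suc uv by blast
  then have "stage v \<le> Suc (stage u)" using layer_stage n by blast
  moreover have "stage u \<le> stage v" using stage_mono n by blast
  ultimately show ?thesis by linarith
qed

lemma stage_first: "v \<in> N \<Longrightarrow> v \<notin> Range R \<Longrightarrow> stage v = 0"
proof -
  assume v: "v \<in> N" "v \<notin> Range R"
  then have "v \<in> unseen {}" using first_least unfolding unseen_def by auto
  then have "v \<in> layer 0" using v le_refl by (auto simp: down_def)
  then show ?thesis using layer_stage v by blast
qed

text \<open>Layer 0 was given all events with finitely occurring labels for this purpose, as
  \<open>valid\<close> admits dead labels in epoch zero only.\<close>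

lemma stage_dead: "v \<in> N \<Longrightarrow> finite {u \<in> N. lab M u = lab M v} \<Longrightarrow> stage v = 0"
proof -
  assume v: "v \<in> N" "finite {u \<in> N. lab M u = lab M v}"
  then have "v \<in> layer 0" using le_refl by (auto simp: down_def)
  then show ?thesis using layer_stage v by blast
qed

text \<open>A finite layer cannot exhaust the label, so \<open>unseen\<close> contributes an event
  with it to the next difference.\<close>

lemma stage_label:
  assumes "infinite {u \<in> N. lab M u = \<sigma>}"
  shows "\<exists>v\<in>N. lab M v = \<sigma> \<and> stage v = i"
proof -
  have ex: "\<exists>v\<in>unseen D. lab M v = \<sigma>" if "finite D" for D
  proof -
    have "\<not> {u \<in> N. lab M u = \<sigma>} \<subseteq> D" using assms that finite_subset by blast
    then show ?thesis using unseen_exists by blast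
  qed
  show ?thesis
  proof (cases i)
    case 0
    obtain v where v: "v \<in> unseen {}" "lab M v = \<sigma>" using ex[of "{}"] by blast
    then have "v \<in> N" "v \<in> layer 0" using le_refl by (auto simp: down_def unseen_def)
    then have "stage v \<le> 0" using layer_stage by blast
    then show ?thesis using v(2) \<open>v \<in> N\<close> 0 by blast
  next
    case (Suc j)
    obtain v where v: "v \<in> unseen (layer j)" "lab M v = \<sigma>" using ex[OF finite_layer] by blast
    then have "v \<in> N" "v \<notin> layer j" "v \<in> layer (Suc j)" using layer_Suc by (auto simp: unseen_def)
    then have "stage v = Suc j" using layer_stage by (metis le_SucE)
    then show ?thesis using v(2) \<open>v \<in> N\<close> Suc by blast
  qed
qed

definition truth :: "'v \<Rightarrow> 'p act lform set" where
  "truth v = {a \<in> A. v \<in> sem a}"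

definition near_truth :: "'v set \<Rightarrow> 'v \<Rightarrow> 'p act lform set" where
  "near_truth W v = {a \<in> A. v \<in> near W a}"

lemma eval_truth:
  "\<Union>(modal_atoms ` psub \<pi>) \<subseteq> A \<longrightarrow> (\<forall>\<alpha>\<in>tests \<pi>. \<forall>v\<in>N. eval \<alpha> (lab M v) (truth v) (truth v) \<longleftrightarrow> v \<in> sem \<alpha>)"
  "form_atoms \<alpha> \<subseteq> A \<longrightarrow> (\<forall>v\<in>N. eval \<alpha> (lab M v) (truth v) (truth v) \<longleftrightarrow> v \<in> sem \<alpha>)"
proof (induct \<pi> and \<alpha>)
  case (Test \<alpha>)
  then show ?case by (simp add: form_atoms_def)
next
  case (Dia \<pi> k)
  show ?case
  proof (intro impI ballI)
    fix v assume a: "form_atoms (Dia \<pi> k) \<subseteq> A" and v: "v \<in> N"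
    have "dia_eval \<pi> (lab M v) (truth v) Dia (truth v) k (v \<in> sem k) \<longleftrightarrow> v \<in> sem (Dia \<pi> k)"
      by (rule dia_eval_truth[where mk = Dia and R = R and S = S and N = N and s = sem and A = A])
        (use a v Dia sem_nodes in \<open>auto simp: truth_def fwd_preim\<close>)
    moreover have "eval k (lab M v) (truth v) (truth v) = (v \<in> sem k)" using Dia a v by auto
    ultimately show "eval (Dia \<pi> k) (lab M v) (truth v) (truth v) \<longleftrightarrow> v \<in> sem (Dia \<pi> k)" by simp
  qed
next
  case (BDia \<pi> k)
  show ?case
  proof (intro impI ballI)
    fix v assume a: "form_atoms (BDia \<pi> k) \<subseteq> A" and v: "v \<in> N"
    have "dia_eval \<pi> (lab M v) (truth v) BDia (truth v) k (v \<in> sem k) \<longleftrightarrow> v \<in> sem (BDia \<pi> k)"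
      by (rule dia_eval_truth[where mk = BDia and R = "R\<inverse>" and S = "S\<inverse>" and N = N and s = sem and A = A])
        (use a v BDia sem_nodes in \<open>auto simp: truth_def bwd_preim\<close>)
    moreover have "eval k (lab M v) (truth v) (truth v) = (v \<in> sem k)" using BDia a v by auto
    ultimately show "eval (BDia \<pi> k) (lab M v) (truth v) (truth v) \<longleftrightarrow> v \<in> sem (BDia \<pi> k)" by simp
  qed
qed auto

text \<open>Confining the chain in the semantics agrees with restricting the last argument of
  \<open>eval\<close>, so the due sets can be chosen by actual truth.\<close>

lemma eval_near:
  "form_atoms \<alpha> \<subseteq> A \<Longrightarrow> v \<in> N \<Longrightarrow> eval \<alpha> (lab M v) (truth v) (near_truth W v) \<longleftrightarrow> v \<in> near W \<alpha>"
proof (induct \<alpha> arbitrary: v rule: lform.induct[of "\<lambda>_. True"])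
  case (Dia \<pi> k)
  have "dia_eval \<pi> (lab M v) (truth v) Dia (near_truth W v) k (v \<in> near W k) \<longleftrightarrow> v \<in> near W (Dia \<pi> k)"
  proof (rule dia_eval_truth[where mk = Dia and R = "Restr R W" and S = "Restr S W" and N = N and s = sem
        and A = A and C = "near_truth W" and B = truth and h = "near W" and l = "lab M"])
    show "eval \<alpha> (lab M v) (truth v) (truth v) \<longleftrightarrow> v \<in> sem \<alpha>" if "\<alpha> \<in> tests \<pi>" "v \<in> N" for v \<alpha>
      using eval_truth(1)[of \<pi>] Dia(3) that by auto
    show "near W k \<subseteq> N" using near_subset sem_nodes by blast
  qed (use Dia sem_nodes in \<open>auto simp: near_truth_def\<close>)
  then show ?case using Dia by simp
next
  case (LOr \<alpha> \<beta>)
  then show ?case using eval_truth(2)[of "LOr \<alpha> \<beta>"] by simp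
next
  case (LNot \<alpha>)
  then show ?case using eval_truth(2)[of "LNot \<alpha>"] by simp
next
  case (BDia \<pi> \<alpha>)
  then show ?case using eval_truth(2)[of "BDia \<pi> \<alpha>"] by simp
qed auto

definition active :: "'p \<Rightarrow> 'p act set" where
  "active p = {\<sigma> \<in> Sigma_loc P p. infinite {v \<in> N. lab M v = \<sigma>}}"

text \<open>The forward claims in \<open>due\<close> are those fulfilled inside the layer of
  \<open>v\<close>, that is, within its epoch, because stages never decrease along edges.\<close>

definition mk :: "'v \<Rightarrow> 'p mark" where
  "mk v = \<lparr>lbl = lab M v, holds = truth v, due = near_truth (layer (stage v)) v, res = stage v mod L,
     inc = (\<exists>u. (u, v) \<in> R \<and> stage u < stage v), zero = (stage v = 0), lst = (v \<notin> Domain R),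
     alive = active (pr v), dn = {lab M u | u. u \<in> proc_past v \<and> stage u = stage v},
     seen = (\<Union>u\<in>proc_past v. hits \<phi> (lab M u) (truth u))\<rparr>"

lemma mk_simps [simp]:
  "lbl (mk v) = lab M v" "holds (mk v) = truth v" "due (mk v) = near_truth (layer (stage v)) v"
  "res (mk v) = stage v mod L" "inc (mk v) = (\<exists>u. (u, v) \<in> R \<and> stage u < stage v)"
  "zero (mk v) = (stage v = 0)" "lst (mk v) = (v \<notin> Domain R)" "alive (mk v) = active (pr v)"
  "dn (mk v) = {lab M u | u. u \<in> proc_past v \<and> stage u = stage v}"
  "seen (mk v) = (\<Union>u\<in>proc_past v. hits \<phi> (lab M u) (truth u))"
  by (simp_all add: mk_def)

text \<open>A due claim has its path inside the layer of \<open>v\<close> and so never crosses into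
  a new epoch. Every true claim at \<open>v\<close> has its witness in the next layer, hence what
  remains of it is due after a crossing.\<close>

lemma link_mk:
  assumes T: "T = R \<and> \<pi> = Proc \<or> T = S \<and> \<pi> = Msg" and vw: "(v, w) \<in> T"
  shows "link A \<pi> (stage w \<noteq> stage v) (lab M v) (truth v) (near_truth (layer (stage v)) v)
    (lab M w) (truth w) (near_truth (layer (stage w)) w)"
proof -
  have n: "v \<in> N" "w \<in> N" "stage w = stage v \<or> stage w = Suc (stage v)"
    using stepD[of v w] stage_step[of v w] T vw by auto
  have right: "w' = w" if "(v, w') \<in> T" for w' using T vw that proc_unique_right msg_unique_right by blast
  have left: "v' = v" if "(v', w) \<in> T" for v' using T vw that proc_unique_left msg_unique_left by blast
  have s1: "v \<in> sem (Dia \<pi> k) \<longleftrightarrow> w \<in> sem k" and s2: "w \<in> sem (BDia \<pi> k) \<longleftrightarrow> v \<in> sem k"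
    and s3: "v \<in> near W (Dia \<pi> k) \<longleftrightarrow> v \<in> W \<and> w \<in> W \<and> w \<in> near W k" for k W
  proof -
    have "v \<in> sem (Dia \<pi> k) \<longleftrightarrow> (\<exists>w'. (v, w') \<in> T \<and> w' \<in> sem k)"
      "w \<in> sem (BDia \<pi> k) \<longleftrightarrow> (\<exists>v'. (v', w) \<in> T \<and> v' \<in> sem k)"
      "v \<in> near W (Dia \<pi> k) \<longleftrightarrow> (\<exists>w'. (v, w') \<in> T \<and> v \<in> W \<and> w' \<in> W \<and> w' \<in> near W k)"
      using T n(1,2) by auto
    then show "v \<in> sem (Dia \<pi> k) \<longleftrightarrow> w \<in> sem k" "w \<in> sem (BDia \<pi> k) \<longleftrightarrow> v \<in> sem k"
      "v \<in> near W (Dia \<pi> k) \<longleftrightarrow> v \<in> W \<and> w \<in> W \<and> w \<in> near W k"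
      using vw right left by blast+
  qed
  have cl: "Dia \<pi> k \<in> A \<Longrightarrow> form_atoms k \<subseteq> A" "BDia \<pi> k \<in> A \<Longrightarrow> form_atoms k \<subseteq> A" for k
    using all_atoms_closed[of Dia \<pi> k \<phi>] all_atoms_closed[of BDia \<pi> k \<phi>] T by auto
  have e1: "Dia \<pi> k \<in> truth v \<longleftrightarrow> eval k (lab M w) (truth w) (truth w)" if "Dia \<pi> k \<in> A" for k
    using that eval_truth(2)[of k] cl(1)[OF that] n s1 by (auto simp: truth_def)
  have e2: "BDia \<pi> k \<in> truth w \<longleftrightarrow> eval k (lab M v) (truth v) (truth v)" if "BDia \<pi> k \<in> A" for k
    using that eval_truth(2)[of k] cl(2)[OF that] n s2 by (auto simp: truth_def)
  have e3: "stage w = stage v" "eval k (lab M w) (truth w) (near_truth (layer (stage w)) w)"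
    if k: "Dia \<pi> k \<in> near_truth (layer (stage v)) v" for k
  proof -
    have *: "Dia \<pi> k \<in> A" "w \<in> layer (stage v)" "w \<in> near (layer (stage v)) k"
      using k s3 unfolding near_truth_def by auto
    then show "stage w = stage v" using layer_stage[OF n(2)] n(3) by auto
    with * show "eval k (lab M w) (truth w) (near_truth (layer (stage w)) w)"
      using eval_near[OF cl(1) n(2)] by simp
  qed
  have e4: "eval k (lab M w) (truth w) (near_truth (layer (stage w)) w)"
    if k: "Dia \<pi> k \<in> truth v" and jump: "stage w = Suc (stage v)" for k
  proof -
    have a: "Dia \<pi> k \<in> A" "v \<in> sem (Dia \<pi> k)" using k unfolding truth_def by auto
    have "v \<in> layer (stage v)" using layer_stage[OF n(1)] by simp
    then have "witness v (Dia \<pi> k) \<subseteq> layer (stage w)"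
      unfolding jump using layer_Suc[of "stage v"] a(1) by blast
    then have "v \<in> near (layer (stage w)) (Dia \<pi> k)" by (rule witness(3)[OF a(2)])
    then have "w \<in> near (layer (stage w)) k" using s3 by blast
    then show ?thesis using eval_near[OF cl(1)[OF a(1)] n(2)] by simp
  qed
  show ?thesis unfolding link_def using e1 e2 e3 e4 n(3) by auto
qed

definition packet :: "'v \<Rightarrow> 'p packet" where
  "packet v = (truth v, near_truth (layer (stage v)) v, stage v mod L)"

definition msg_of :: "'v \<Rightarrow> 'p packet" where
  "msg_of v = packet (if v \<in> Range S then SOME u. (u, v) \<in> S else v)"

lemma msg_of_recv: "(u, v) \<in> S \<Longrightarrow> msg_of v = packet u"
proof -
  assume uv: "(u, v) \<in> S"
  then have "(SOME u. (u, v) \<in> S) = u" by (intro some_equality) (auto dest: msg_unique_left)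
  moreover have "v \<in> Range S" using uv by blast
  ultimately show ?thesis by (simp add: msg_of_def)
qed

lemma send_not_Range: "lab M v = Send p q \<Longrightarrow> v \<notin> Range S"
  by (auto simp: msg_rel_rank)

lemma recv_not_Domain: "lab M v = Recv p q \<Longrightarrow> v \<notin> Domain S"
  by (auto simp: msg_rel_rank)

lemma msg_of_send: "(u, v) \<in> S \<Longrightarrow> msg_of u = packet u"
proof -
  assume "(u, v) \<in> S"
  then have "u \<notin> Range S" using send_not_Range msg_labE by metis
  then show ?thesis by (simp add: msg_of_def)
qed

lemma near_truth_subset: "near_truth W v \<subseteq> truth v"
  unfolding near_truth_def truth_def using near_subset by blast

lemma packet_ctrl: "packet v \<in> Pow A \<times> Pow A \<times> {..<L}"
  unfolding packet_def truth_def near_truth_def by (auto simp: modulus_def)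

lemma valid_mk: "v \<in> N \<Longrightarrow> valid (pr v) (mk v)"
proof -
  assume v: "v \<in> N"
  have "hits \<phi> \<sigma> B \<subseteq> basic_gsub \<phi>" for \<sigma> B unfolding hits_def by auto
  moreover have "lab M u \<in> Sigma_loc P (pr v)" if "u \<in> proc_past v" for u
    using lab_loc[of u] le_nodes[of u v] that unfolding proc_past_def by auto
  moreover have "lab M v \<in> active (pr v)" if "stage v \<noteq> 0"
    using stage_dead[OF v] that lab_loc[OF v] unfolding active_def by auto
  moreover have "Dia Proc k \<notin> truth v" if "v \<notin> Domain R" for k
    using that unfolding truth_def by auto
  ultimately show ?thesis
    using lab_loc[OF v] near_truth_subset
    unfolding valid_def mk_simps by (auto simp: modulus_def active_def truth_def)
qed

lemma comm_mk: "v \<in> N \<Longrightarrow> comm (mk v) (msg_of v)"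
proof -
  assume v: "v \<in> N"
  show ?thesis
  proof (cases "lab M v")
    case (Send p q)
    then have "v \<notin> Range S" by (rule send_not_Range)
    then show ?thesis using Send unfolding comm_def msg_of_def packet_def by (auto simp: truth_def)
  next
    case (Recv q p)
    then obtain u where u: "(u, v) \<in> S" using recv_matched[OF v] by blast
    have lab: "lab M u = Send p q" using Recv u by (auto simp: msg_rel_rank)
    have st: "stage v = stage u \<or> stage v = Suc (stage u)" using stage_step u by blast
    have "stage v mod L \<noteq> stage u mod L \<longleftrightarrow> stage v \<noteq> stage u"
      using st mod_add_neq_nat[of 1 L "stage u"] by (auto simp: modulus_def)
    then have "link A Msg (stage v mod L \<noteq> stage u mod L) (Send p q) (truth u) (near_truth (layer (stage u)) u)
        (lab M v) (truth v) (near_truth (layer (stage v)) v)"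
      using link_mk[of S Msg u v] u lab by simp
    moreover have "stage v mod L = stage u mod L \<or> stage v mod L = (stage u mod L + 1) mod L"
      using st by (auto simp: mod_Suc_eq)
    moreover have "Dia Msg k \<notin> truth v" for k
      using recv_not_Domain[OF Recv] unfolding truth_def by auto
    ultimately show ?thesis using Recv unfolding comm_def msg_of_recv[OF u] packet_def by auto
  qed
qed

lemma start_mk: "v \<in> N \<Longrightarrow> v \<notin> Range R \<Longrightarrow> start (mk v)"
  unfolding start_def by (auto simp: proc_past_first stage_first truth_def)

lemma succ_mk:
  assumes uv: "(u, v) \<in> R"
  shows "succ (mk u) (mk v)"
proof -
  note n = procD[OF uv]
  have inc: "inc (mk v) \<longleftrightarrow> stage v \<noteq> stage u"
  proof -
    have "inc (mk v) \<longleftrightarrow> stage u < stage v" unfolding mk_simps using uv proc_unique_left[OF _ uv] by blast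
    then show ?thesis using stage_mono[OF n(4)] by auto
  qed
  have past: "proc_past v = insert v (proc_past u)" using proc_past_succ[OF uv] by blast
  have le: "stage w \<le> stage u" if "w \<in> proc_past u" for w
    using that stage_mono unfolding proc_past_def by blast
  \<comment> \<open>Every active label occurs in the stage of \<open>u\<close>, and on this process
    such an event cannot come after \<open>v\<close>, whose stage is later.\<close>
  have act: "active (pr u) \<subseteq> dn (mk u)" if j: "stage v \<noteq> stage u"
  proof
    fix \<sigma> assume \<sigma>: "\<sigma> \<in> active (pr u)"
    then obtain w where w: "w \<in> N" "lab M w = \<sigma>" "stage w = stage u"
      using stage_label[of \<sigma> "stage u"] unfolding active_def by blast
    have "pr w = pr u" using \<sigma> w(2) unfolding active_def Sigma_loc_def by auto
    moreover have "\<not> v \<sqsubseteq> w" using stage_mono[of v w] w(3) j stage_mono[OF n(4)] by auto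
    ultimately have "w \<in> proc_past u" using proc_between[OF uv w(1)] n(3) unfolding proc_past_def by auto
    then show "\<sigma> \<in> dn (mk u)" using w by auto
  qed
  show ?thesis
  proof (cases "stage v = stage u")
    case True
    then have "dn (mk v) = insert (lab M v) (dn (mk u))" unfolding mk_simps past by auto
    then show ?thesis using True inc link_mk[of R Proc u v] uv n(3) past
      unfolding succ_def by (simp del: mk_simps(5,9)) auto
  next
    case False
    then have st: "stage v = Suc (stage u)" using stage_step uv by blast
    have "dn (mk v) = {lab M v}" unfolding mk_simps past using le st by fastforce
    then show ?thesis using False st inc act link_mk[of R Proc u v] uv n(3) past
      unfolding succ_def by (simp del: mk_simps(5,9) add: mod_Suc_eq) auto
  qed
qed

lemma run_mk: "is_run P pdl_cfm M (\<lambda>_. []) (\<lambda>v. Some (mk v)) msg_of"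
proof -
  have st: "Some (mk v) \<in> pdl_states (pr v)" if "v \<in> N" for v
    using valid_mk[OF that] by (simp add: pdl_states_def)
  have m: "msg_of v \<in> Pow A \<times> Pow A \<times> {..<L}" for v unfolding msg_of_def by (rule packet_ctrl)
  show ?thesis
    unfolding is_run_def
  proof (intro conjI ballI impI)
    show "(\<lambda>v. Some (mk v)) ` N \<subseteq> (\<Union>p\<in>P. states pdl_cfm p)"
      using st pr_in unfolding pdl_cfm_def by auto
    show "msg_of ` N \<subseteq> ctrl pdl_cfm" using m by (simp add: pdl_cfm_def image_subset_iff)
  next
    fix e assume "e \<in> S"
    then show "case e of (v, v') \<Rightarrow> msg_of v = msg_of v'" using msg_of_recv msg_of_send by fastforce
  next
    fix e assume "e \<in> R"
    then obtain u v where e: "e = (u, v)" "(u, v) \<in> R" by (cases e) auto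
    note n = procD[OF e(2)]
    show "case e of (u, v) \<Rightarrow> (Some (mk u), (lab M v, [], msg_of v), Some (mk v)) \<in> trans_rel pdl_cfm (pr v)"
      using st[OF n(1)] n(3) m valid_mk[OF n(2)] comm_mk[OF n(2)] succ_mk[OF e(2)] unfolding e(1) pdl_cfm_def
      by (simp del: mk_simps(2-))
  next
    fix v assume "v \<in> N" "v \<notin> Range R"
    then show "(init pdl_cfm (pr v), (lab M v, [], msg_of v), Some (mk v)) \<in> trans_rel pdl_cfm (pr v)"
      using m valid_mk comm_mk start_mk unfolding pdl_cfm_def
      by (simp del: mk_simps(2-) add: pdl_states_def)
  qed
qed

abbreviation "cof p \<equiv> cofinal pdl_cfm M (\<lambda>v. Some (mk v)) p"

definition good_end :: "'p \<Rightarrow> 'p mark option \<Rightarrow> bool" where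
  "good_end p s \<longleftrightarrow> s \<in> cof p \<and> fin_ok p s \<and> alive_of s = active p \<and>
     seen_of s = (\<Union>v\<in>nodes_of M p. hits \<phi> (lab M v) (truth v))"

lemma cofinalI:
  assumes "a \<in> nodes_of M p" "\<And>v. v \<in> nodes_of M p \<Longrightarrow> \<exists>w\<in>nodes_of M p. v \<sqsubseteq> w \<and> mk w = mk a"
  shows "Some (mk a) \<in> cof p"
    "seen (mk a) = (\<Union>v\<in>nodes_of M p. hits \<phi> (lab M v) (truth v))"
proof -
  have "Some (mk a) \<in> pdl_states p" using valid_mk[of a] assms(1) by (auto simp: pdl_states_def nodes_of_def)
  then show "Some (mk a) \<in> cof p" using assms unfolding cofinal_def pdl_cfm_def by auto
  have "proc_past w \<subseteq> nodes_of M p" if "w \<in> nodes_of M p" for w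
    using that le_nodes unfolding proc_past_def nodes_of_def by auto
  then have "seen (mk a) \<subseteq> (\<Union>v\<in>nodes_of M p. hits \<phi> (lab M v) (truth v))"
    using assms(1) unfolding mk_simps by blast
  moreover have "hits \<phi> (lab M v) (truth v) \<subseteq> seen (mk a)" if v: "v \<in> nodes_of M p" for v
  proof -
    obtain w where w: "w \<in> nodes_of M p" "v \<sqsubseteq> w" "mk w = mk a" using assms(2)[OF v] by blast
    then have "v \<in> proc_past w" using v unfolding proc_past_def nodes_of_def by auto
    then have "hits \<phi> (lab M v) (truth v) \<subseteq> seen (mk w)" unfolding mk_simps by blast
    then show ?thesis using w(3) by simp
  qed
  ultimately show "seen (mk a) = (\<Union>v\<in>nodes_of M p. hits \<phi> (lab M v) (truth v))" by blast
qed

lemma good_end_active: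
  assumes p: "p \<in> P" and act: "active p \<noteq> {}"
  shows "\<exists>s. good_end p s"
proof -
  obtain \<sigma> where \<sigma>: "\<sigma> \<in> active p" using act by blast
  define Z where "Z = {v \<in> nodes_of M p. inc (mk v) \<and> res (mk v) = 3 * idx p}"
  \<comment> \<open>The first event of the given stage on \<open>p\<close> carries
    \<open>inc\<close>. \<open>Suc d\<close> keeps the stage positive, which excludes the first
    event of the process.\<close>
  have ex: "\<exists>v\<in>Z. stage v = L * Suc d + 3 * idx p" for d
  proof -
    let ?i = "L * Suc d + 3 * idx p"
    let ?X = "{v \<in> nodes_of M p. stage v = ?i}"
    obtain x where "x \<in> N" "lab M x = \<sigma>" "stage x = ?i"
      using stage_label[of \<sigma> ?i] \<sigma> unfolding active_def by blast
    then have "x \<in> ?X" using \<sigma> by (auto simp: nodes_of_def active_def Sigma_loc_def)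
    then have "\<exists>v\<in>?X. \<forall>u\<in>?X. v \<sqsubseteq> u"
      by (intro least_exists) (use total in \<open>auto simp: nodes_of_def\<close>)
    then obtain v where v: "v \<in> ?X" "\<forall>u\<in>?X. v \<sqsubseteq> u" by blast
    then have vN: "v \<in> N" "pr v = p" by (auto simp: nodes_of_def)
    have "0 < ?i" by (simp add: modulus_def)
    then have "stage v \<noteq> 0" using v(1) by (simp only: mem_Collect_eq)
    then have "v \<in> Range R" using stage_first[OF vN(1)] by metis
    then obtain u where u: "(u, v) \<in> R" by blast
    have "u \<notin> ?X" using v(2) procD[OF u] le_antisym by blast
    then have "stage u < stage v" using stage_mono[OF procD(4)[OF u]] v(1) procD[OF u] vN(2)
      by (auto simp: nodes_of_def)
    then have "inc (mk v)" using u by auto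
    moreover have "?i mod L = 3 * idx p"
    proof -
      have "3 * idx p < L" using idx_less[OF p] by (simp add: modulus_def)
      then show ?thesis by (simp only: mod_mult_self4 mod_less)
    qed
    then have "res (mk v) = 3 * idx p" using v(1) by simp
    ultimately show ?thesis using v(1) unfolding Z_def by blast
  qed
  have "infinite Z"
  proof
    assume "finite Z"
    obtain v where v: "v \<in> Z" "stage v = L * Suc (Max (stage ` Z)) + 3 * idx p" using ex by blast
    have "stage v \<le> Max (stage ` Z)" using v(1) \<open>finite Z\<close> by (intro Max_ge) auto
    also have "\<dots> < Suc (Max (stage ` Z))" by simp
    also have "\<dots> = 1 * Suc (Max (stage ` Z))" by simp
    also have "\<dots> \<le> L * Suc (Max (stage ` Z))" by (rule mult_le_mono1) (simp add: modulus_def)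
    also have "\<dots> \<le> stage v" unfolding v(2) by (rule le_add1)
    finally show False by simp
  qed
  moreover have "finite ((\<lambda>v. Some (mk v)) ` Z)"
    by (rule finite_subset[OF _ finite_pdl_states[of p]])
      (use valid_mk in \<open>auto simp: Z_def pdl_states_def nodes_of_def\<close>)
  \<comment> \<open>There are only finitely many marks, so one recurs infinitely often; as pasts are
    finite, it is cofinal.\<close>
  ultimately have "\<exists>a\<in>Z. infinite {v \<in> Z. Some (mk v) = Some (mk a)}" by (rule pigeonhole_infinite)
  then obtain a where a: "a \<in> Z" "infinite {v \<in> Z. Some (mk v) = Some (mk a)}" by blast
  have aV: "a \<in> nodes_of M p" using a(1) by (simp add: Z_def)
  have later: "\<exists>w\<in>nodes_of M p. v \<sqsubseteq> w \<and> mk w = mk a" if v: "v \<in> nodes_of M p" for v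
  proof -
    have "\<not> {v \<in> Z. Some (mk v) = Some (mk a)} \<subseteq> {u. u \<sqsubseteq> v}" using a(2) past_finite finite_subset by blast
    then obtain w where w: "w \<in> Z" "mk w = mk a" "\<not> w \<sqsubseteq> v" by auto
    then show ?thesis using total[of v w] v by (auto simp: Z_def nodes_of_def)
  qed
  have "good_end p (Some (mk a))"
    using cofinalI[OF aV later] a(1) aV act
    unfolding good_end_def fin_ok_def alive_of_def seen_of_def Z_def nodes_of_def
    by (auto simp del: mk_simps(4,5,10))
  then show ?thesis ..
qed

text \<open>Finitely many labels, each occurring finitely often, leave no events at all or a last
  one, whose mark is cofinal.\<close>

lemma good_end_inactive:
  assumes p: "p \<in> P" and act: "active p = {}"
  shows "\<exists>s. good_end p s"
proof (cases "nodes_of M p = {}")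
  case True
  then have "good_end p None"
    using act unfolding good_end_def fin_ok_def alive_of_def seen_of_def cofinal_def pdl_cfm_def by simp
  then show ?thesis ..
next
  case False
  have "nodes_of M p = (\<Union>\<sigma>\<in>Sigma_loc P p. {v \<in> N. lab M v = \<sigma>})"
    using lab_loc by (auto simp: nodes_of_def Sigma_loc_def)
  then have "finite (nodes_of M p)" using act finite_Sigma_loc[OF finP, of p] unfolding active_def by auto
  then obtain x where x: "x \<in> nodes_of M p" "\<forall>v \<in> nodes_of M p. v \<sqsubseteq> x" using greatest_exists False by blast
  have "x \<notin> Domain R"
  proof
    assume "x \<in> Domain R"
    then obtain y where y: "(x, y) \<in> R" by blast
    then show False using x procD[OF y] le_antisym by (auto simp: nodes_of_def)
  qed
  moreover have "\<exists>w\<in>nodes_of M p. v \<sqsubseteq> w \<and> mk w = mk x" if "v \<in> nodes_of M p" for v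
    using x that by blast
  moreover have "pr x = p" using x(1) by (simp add: nodes_of_def)
  ultimately have "good_end p (Some (mk x))"
    using cofinalI[OF x(1)] act
    unfolding good_end_def fin_ok_def alive_of_def seen_of_def
    by (simp del: mk_simps(10))
  then show ?thesis ..
qed

lemma accepting_mk:
  assumes sat: "gsat P M \<phi>"
  shows "accepting P pdl_cfm M (\<lambda>v. Some (mk v))"
proof -
  define f where "f = (\<lambda>p\<in>P. SOME s. good_end p s)"
  have f: "good_end p (f p)" if "p \<in> P" for p
    using good_end_active[OF that] good_end_inactive[OF that] that unfolding f_def by (auto intro: someI_ex)
  \<comment> \<open>The two labels of a channel occur equally often, so both are active or neither
    is.\<close>
  have ch: "Send p q \<in> alive_of (f p) \<longleftrightarrow> Recv q p \<in> alive_of (f q)" if "(p, q) \<in> Ch P" for p q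
  proof -
    have "p \<in> P" "q \<in> P" "Send p q \<in> Sigma_loc P p" "Recv q p \<in> Sigma_loc P q"
      using that by (auto simp: Ch_def Sigma_loc_def)
    then show ?thesis
      using f eqpoll_finite_iff[OF channel_eqpoll[OF that]] unfolding good_end_def active_def by auto
  qed
  have "(\<Union>p\<in>P. seen_of (f p)) = (\<Union>p\<in>P. \<Union>v\<in>nodes_of M p. hits \<phi> (lab M v) (truth v))"
    using f unfolding good_end_def by auto
  also have "\<dots> = (\<Union>v\<in>N. hits \<phi> (lab M v) (truth v))"
    using pr_in by (auto simp: nodes_of_def)
  finally have seen: "(\<Union>p\<in>P. seen_of (f p)) = (\<Union>v\<in>N. hits \<phi> (lab M v) (truth v))" .
  have ev: "eval \<alpha> (lab M v) (truth v) (truth v) \<longleftrightarrow> v \<in> sem \<alpha>"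
    if "GE \<alpha> \<in> basic_gsub \<phi> \<or> GA \<alpha> \<in> basic_gsub \<phi>" "v \<in> N" for \<alpha> v
    using eval_truth(2) form_atoms_all_atoms[OF basic_in_local_subs[OF that(1)]] that(2) by blast
  have gv: "gval (\<Union>p\<in>P. seen_of (f p)) \<phi>"
    unfolding seen
    by (subst gval_gsat[where \<phi> = \<phi>]) (use ev sat in \<open>auto simp: hits_def\<close>)
  have "s \<in> pdl_states p" if "s \<in> cof p" for s p
    using that unfolding cofinal_def pdl_cfm_def by (auto simp: pdl_states_def split: if_splits)
  then have "f \<in> PiE P pdl_states" using f unfolding good_end_def f_def by auto
  then have "f \<in> final pdl_cfm"
    using f ch gv unfolding pdl_cfm_def good_end_def by auto
  then show ?thesis using f unfolding accepting_def good_end_def by blast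
qed

end

lemma (in translation) lang0_pdl_cfm:
  assumes "is_msc P (M :: ('v, 'p) msc)"
  shows "M \<in> lang0 P pdl_cfm \<longleftrightarrow> gsat P M \<phi>"
proof
  assume "M \<in> lang0 P pdl_cfm"
  then obtain \<rho> \<mu> where "is_run P pdl_cfm M (\<lambda>_. []) \<rho> \<mu>" "accepting P pdl_cfm M \<rho>"
    unfolding lang0_def lang_def by auto
  then interpret accepted_run P \<phi> idx M \<rho> \<mu> using assms finite_P by unfold_locales
  show "gsat P M \<phi>" by (rule satisfied)
next
  assume sat: "gsat P M \<phi>"
  interpret model P \<phi> idx M using assms finite_P by unfold_locales
  have "dim pdl_cfm = 0" by (simp add: pdl_cfm_def)
  then show "M \<in> lang0 P pdl_cfm"
    using assms run_mk accepting_mk[OF sat] unfolding lang0_def lang_def bits_def by auto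
qed

theorem theorem5p2:
  "\<exists>K :: nat. \<forall>(P :: 'p set) (\<phi> :: 'p act gform).
     finite P \<and> acts_gform \<phi> \<subseteq> Sigma_all P \<longrightarrow>
     (\<exists>A :: ('p, nat, nat) cfm.
        is_cfm P A \<and> dim A = 0 \<and>
        (\<forall>M :: ('v, 'p) msc. is_msc P M \<longrightarrow> (M \<in> lang0 P A \<longleftrightarrow> gsat P M \<phi>)) \<and>
        (\<forall>l m n.
           l = card (basic_gsub \<phi>) \<and> m = card (modal_subs \<phi>) \<and> size_bound \<phi> n \<longrightarrow>
           (\<forall>p \<in> P. card (states A p) \<le>
              2 ^ (K * (m * (n + card P) + card P * l + (card P)\<^sup>2))) \<and>
           card (ctrl A) \<le> 2 ^ (K * (l + m * n + (card P)\<^sup>2))))"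
proof (intro exI[of _ 16] allI impI)
  fix P :: "'p set" and \<phi> :: "'p act gform"
  assume "finite P \<and> acts_gform \<phi> \<subseteq> Sigma_all P"
  then have P: "finite P" by blast
  \<comment> \<open>The numbering supplies the distinct residues \<open>3 * idx p\<close> of the
    accepting states.\<close>
  obtain idx where idx: "bij_betw idx P {0..<card P}" using ex_bij_betw_finite_nat[OF P] by blast
  interpret translation P \<phi> idx
    using P idx by unfold_locales (auto simp: bij_betw_def)
  have st: "states pdl_cfm p = pdl_states p" "dim pdl_cfm = 0" for p by (simp_all add: pdl_cfm_def)
  obtain A :: "('p, nat, nat) cfm" where A: "is_cfm P A" "dim A = 0"
    "\<And>M :: ('v, 'p) msc. M \<in> lang0 P A \<longleftrightarrow> M \<in> lang0 P pdl_cfm"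
    "\<And>p. p \<in> P \<Longrightarrow> card (states A p) \<le> card (pdl_states p)" "card (ctrl A) \<le> card (ctrl pdl_cfm)"
    using exists_nat_cfm[OF is_cfm_pdl P, where 'v = 'v] unfolding st by metis
  show "\<exists>A :: ('p, nat, nat) cfm.
        is_cfm P A \<and> dim A = 0 \<and>
        (\<forall>M :: ('v, 'p) msc. is_msc P M \<longrightarrow> (M \<in> lang0 P A \<longleftrightarrow> gsat P M \<phi>)) \<and>
        (\<forall>l m n.
           l = card (basic_gsub \<phi>) \<and> m = card (modal_subs \<phi>) \<and> size_bound \<phi> n \<longrightarrow>
           (\<forall>p \<in> P. card (states A p) \<le>
              2 ^ (16 * (m * (n + card P) + card P * l + (card P)\<^sup>2))) \<and>
           card (ctrl A) \<le> 2 ^ (16 * (l + m * n + (card P)\<^sup>2)))"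
    using A lang0_pdl_cfm order_trans[OF A(4) card_pdl_states] order_trans[OF A(5) card_pdl_ctrl]
    by (intro exI[of _ A]) blast
qed

end
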